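(* Let $(\Sigma^2,\tilde J)$ be a complex curve with a holomorphic $(1,0)$-form $\Upsilon_1-i\Upsilon_2$ ($\Upsilon_1,\Upsilon_2$ real), let $I_s^+,I_y^+\subset\mathbb{R}^+$ be open intervals, let $u=u(y)$ ($y\in I_y^+$) and $w=w(s)$ ($s\in I_s^+$) be two smooth $1$-parameter families of positive functions on $\Sigma^2$, and let $\tilde\omega(s,y)$, $(s,y)\in I_s^+\times I_y^+$, be a smooth family of Kähler forms on $(\Sigma^2,\tilde J)$ satisfying $$-(s\,y)\,\tilde\omega=(u\,w)\,\Upsilon_1\wedge\Upsilon_2,\qquad \frac{\partial^2\tilde\omega}{\partial y^2}=d_\Sigma d_\Sigma^cu,\qquad \frac{\partial^2\tilde\omega}{\partial s^2}=d_\Sigma d_\Sigma^cw,\qquad \frac{\partial^2\tilde\omega}{\partial y\,\partial s}=0.$$ Then there exists, on the "nilbundle" over $\Sigma^2\times I_s^+\times I_y^+$ defined by connection $1$-forms $\alpha,\kappa,\xi,\eta$ with curvature $2$-forms $$d\alpha=-d_\Sigma^cu\wedge dy+\frac{\partial\tilde\omega}{\partial y},\qquad d\kappa=d_\Sigma^cw\wedge ds-\frac{\partial\tilde\omega}{\partial s},$$ $$d\xi=\Upsilon_1\wedge\kappa+\Upsilon_2\wedge w\,ds,\qquad d\eta=\alpha\wedge\Upsilon_2+u\,dy\wedge\Upsilon_1,$$ a torsion free $Spin(7)$-structure $\Phi$ inducing the metric $$g_\Phi=s^{-2}\eta^2+y^{-2}\xi^2+y\,s\,\big(u^{-1}\alpha^2+u\,dy^2+w^{-1}\kappa^2+w\,ds^2+g_{\tilde\omega}\big),$$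 where $g_{\tilde\omega}$ is the Kähler metric on $(\Sigma^2,\tilde J)$ determined by $\tilde\omega$.
   Context: Conventions. For a complex structure $J$ and a $1$-form $\beta$, $J\beta(\cdot):=\beta(J\cdot)$. $d_\Sigma$ is the exterior differential on $\Sigma^2$, $d_\Sigma^c:=\tilde J\circ d_\Sigma$, and $g_{\tilde\omega}(\cdot,\cdot)=\tilde\omega(\cdot,\tilde J\cdot)$. "Nilbundle": one first takes the $\mathbb{T}^2$-bundle $P^6\to\Sigma^2\times I_s^+\times I_y^+$ with connection $1$-forms $(\alpha,\kappa)$ having the given curvatures, and then the $\mathbb{T}^2$-bundle $N^8\to P^6$ with connection $1$-forms $(\xi,\eta)$ having the given curvatures (which are $2$-forms on $P^6$). It is assumed that these curvature forms define integral cohomology classes (ignoring factors of $2\pi$), so that such bundles and connections exist; this is always so locally. Connection $1$-forms are normalised to equal $1$ on the generator of their circle action, and forms on the base are identified with their pullbacks. A $Spin(7)$-structure on an 8-manifold is a $4$-form $\Phi$ pointwise linearly equivalent to $\Phi_0=dx_{0123}+dx_{0145}+dx_{0167}+dx_{0246}-dx_{0257}-dx_{0347}-dx_{0356}+dx_{2345}+dx_{2367}+dx_{4567}-dx_{1247}-dx_{1256}-dx_{1346}+dx_{1357}$ on $\mathbb{R}^8$; it induces a Riemannian metric $g_\Phi$ and is torsion free iff $d\Phi=0$. *)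

theory Defs
  imports "HOL-Analysis.Analysis" "HOL-Complex_Analysis.Complex_Analysis"
    "HOL-Combinatorics.Permutations" "HOL-Library.Numeral_Type"
begin

section \<open>Smooth maps between open subsets of Euclidean spaces\<close>

text \<open>Only used for open \<open>S\<close>, where it is the usual notion of a \<open>C\<^sup>k\<close> map.\<close>

primrec Ck_on :: "nat \<Rightarrow> 'a::euclidean_space set \<Rightarrow> ('a \<Rightarrow> 'b::real_normed_vector) \<Rightarrow> bool" where
  "Ck_on 0 S f \<longleftrightarrow> continuous_on S f"
| "Ck_on (Suc k) S f \<longleftrightarrow> (\<forall>x\<in>S. f differentiable (at x)) \<and>
     (\<forall>v. Ck_on k S (\<lambda>x. frechet_derivative f (at x) v))"

definition smooth_on :: "'a::euclidean_space set \<Rightarrow> ('a \<Rightarrow> 'b::real_normed_vector) \<Rightarrow> bool" where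
  "smooth_on S f \<longleftrightarrow> (\<forall>k. Ck_on k S f)"


section \<open>Manifolds\<close>

text \<open>A chart is a pair of its domain and its coordinate map.\<close>

type_synonym ('a, 'e) chart = "'a set \<times> ('a \<Rightarrow> 'e)"

datatype ('a, 'e) mfd = Mfd (mtop: "'a topology") (atlas: "('a, 'e) chart set")

abbreviation points :: "('a, 'e) mfd \<Rightarrow> 'a set" where
  "points M \<equiv> topspace (mtop M)"

definition param :: "('a, 'e) chart \<Rightarrow> 'e \<Rightarrow> 'a" where
  "param c = inv_into (fst c) (snd c)"

definition topological_manifold :: "('a, 'e::euclidean_space) mfd \<Rightarrow> bool" where
  "topological_manifold M \<longleftrightarrow>
     Hausdorff_space (mtop M) \<and> second_countable (mtop M) \<and>
     (\<Union>c\<in>atlas M. fst c) = points M \<and>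
     (\<forall>c\<in>atlas M. openin (mtop M) (fst c) \<and> open (snd c ` fst c) \<and>
        homeomorphic_map (subtopology (mtop M) (fst c)) (top_of_set (snd c ` fst c)) (snd c))"

definition smooth_manifold :: "('a, 'e::euclidean_space) mfd \<Rightarrow> bool" where
  "smooth_manifold M \<longleftrightarrow> topological_manifold M \<and>
     (\<forall>c\<in>atlas M. \<forall>d\<in>atlas M. smooth_on (snd c ` (fst c \<inter> fst d)) (snd d \<circ> param c))"

definition complex_curve :: "('a, complex) mfd \<Rightarrow> bool" where
  "complex_curve X \<longleftrightarrow> topological_manifold X \<and>
     (\<forall>c\<in>atlas X. \<forall>d\<in>atlas X. (snd d \<circ> param c) holomorphic_on (snd c ` (fst c \<inter> fst d)))"

definition smooth_map ::
  "('a, 'e::euclidean_space) mfd \<Rightarrow> ('b, 'f::euclidean_space) mfd \<Rightarrow> ('a \<Rightarrow> 'b) \<Rightarrow> bool" where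
  "smooth_map M N f \<longleftrightarrow> continuous_map (mtop M) (mtop N) f \<and>
     (\<forall>c\<in>atlas M. \<forall>d\<in>atlas N.
        smooth_on (snd c ` (fst c \<inter> f -` fst d)) (snd d \<circ> f \<circ> param c))"

definition diffeo ::
  "('a, 'e::euclidean_space) mfd \<Rightarrow> ('b, 'f::euclidean_space) mfd \<Rightarrow> ('a \<Rightarrow> 'b) \<Rightarrow> bool" where
  "diffeo M N f \<longleftrightarrow> smooth_map M N f \<and>
     (\<exists>g. smooth_map N M g \<and> (\<forall>x\<in>points M. g (f x) = x) \<and> (\<forall>y\<in>points N. f (g y) = y))"

definition eucl :: "'e::euclidean_space set \<Rightarrow> ('e, 'e) mfd" where
  "eucl S = Mfd (top_of_set S) {(S, id)}"

definition prod_mfd :: "('a, 'e) mfd \<Rightarrow> ('b, 'f) mfd \<Rightarrow> ('a \<times> 'b, 'e \<times> 'f) mfd" where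
  "prod_mfd M N = Mfd (prod_topology (mtop M) (mtop N))
     {(fst c \<times> fst d, map_prod (snd c) (snd d)) | c d. c \<in> atlas M \<and> d \<in> atlas N}"

definition open_sub :: "('a, 'e) mfd \<Rightarrow> 'a set \<Rightarrow> ('a, 'e) mfd" where
  "open_sub M U = Mfd (subtopology (mtop M) U) {(fst c \<inter> U, snd c) | c. c \<in> atlas M}"

definition circle_mfd :: "(complex, real) mfd" where
  "circle_mfd = Mfd (top_of_set (sphere 0 1))
     {(cis ` {a<..<a + 2 * pi}, inv_into {a<..<a + 2 * pi} cis) | a. True}"

definition torus_mfd :: "(complex \<times> complex, real \<times> real) mfd" where
  "torus_mfd = prod_mfd circle_mfd circle_mfd"


section \<open>Tangent vectors, forms and the exterior differential\<close>

text \<open>The tangent space of \<open>M\<close> at \<open>p\<close> is identified with the model space \<open>'e\<close> by means of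
  one chart around \<open>p\<close>, chosen once and for all.\<close>

definition chart_at :: "('a, 'e) mfd \<Rightarrow> 'a \<Rightarrow> ('a, 'e) chart" where
  "chart_at M p = (SOME c. c \<in> atlas M \<and> p \<in> fst c)"

definition mdiff ::
  "('a, 'e::euclidean_space) mfd \<Rightarrow> ('b, 'f::euclidean_space) mfd \<Rightarrow> ('a \<Rightarrow> 'b) \<Rightarrow> 'a \<Rightarrow> 'e \<Rightarrow> 'f" where
  "mdiff M N f p = frechet_derivative (snd (chart_at N (f p)) \<circ> f \<circ> param (chart_at M p))
     (at (snd (chart_at M p) p))"

text \<open>A \<open>k\<close>-form takes its arguments as a sequence of tangent vectors, of which only the first
  \<open>k\<close> are relevant. Functions are \<open>0\<close>-forms.\<close>

type_synonym ('a, 'e, 'r) form = "'a \<Rightarrow> (nat \<Rightarrow> 'e) \<Rightarrow> 'r"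

definition alt_form :: "nat \<Rightarrow> ((nat \<Rightarrow> 'e::real_vector) \<Rightarrow> 'r::real_vector) \<Rightarrow> bool" where
  "alt_form k \<phi> \<longleftrightarrow>
     (\<forall>v w. (\<forall>i<k. v i = w i) \<longrightarrow> \<phi> v = \<phi> w) \<and>
     (\<forall>i<k. \<forall>v. linear (\<lambda>x. \<phi> (v(i := x)))) \<and>
     (\<forall>i<k. \<forall>j<k. i \<noteq> j \<longrightarrow> (\<forall>v. v i = v j \<longrightarrow> \<phi> v = 0))"

text \<open>With this normalisation \<open>(\<alpha> \<and> \<beta>)(v, w) = \<alpha>(v) \<beta>(w) - \<alpha>(w) \<beta>(v)\<close> for \<open>1\<close>-forms.\<close>

definition wedge :: "nat \<Rightarrow> nat \<Rightarrow> ((nat \<Rightarrow> 'e) \<Rightarrow> real) \<Rightarrow> ((nat \<Rightarrow> 'e) \<Rightarrow> real) \<Rightarrow> (nat \<Rightarrow> 'e) \<Rightarrow> real" where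
  "wedge k l \<phi> \<psi> v =
     (\<Sum>\<sigma> | \<sigma> permutes {..<k + l}.
        of_int (sign \<sigma>) * \<phi> (\<lambda>i. v (\<sigma> i)) * \<psi> (\<lambda>i. v (\<sigma> (k + i)))) / (fact k * fact l)"

abbreviation wedge11 (infixr \<open>\<and>\<^sub>1\<close> 70) where
  "\<phi> \<and>\<^sub>1 \<psi> \<equiv> wedge 1 1 \<phi> \<psi>"

definition pullback ::
  "('a, 'e::euclidean_space) mfd \<Rightarrow> ('b, 'f::euclidean_space) mfd \<Rightarrow> ('a \<Rightarrow> 'b) \<Rightarrow>
   ('b, 'f, 'r) form \<Rightarrow> ('a, 'e, 'r) form" where
  "pullback M N f \<omega> p v = \<omega> (f p) (\<lambda>i. mdiff M N f p (v i))"

definition local_rep ::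
  "('a, 'e::euclidean_space) mfd \<Rightarrow> ('a, 'e) chart \<Rightarrow> ('a, 'e, 'r) form \<Rightarrow> ('e, 'e, 'r) form" where
  "local_rep M c = pullback (eucl (snd c ` fst c)) M (param c)"

definition smooth_form :: "nat \<Rightarrow> ('a, 'e::euclidean_space) mfd \<Rightarrow> ('a, 'e, real) form \<Rightarrow> bool" where
  "smooth_form k M \<omega> \<longleftrightarrow> (\<forall>p\<in>points M. alt_form k (\<omega> p)) \<and>
     (\<forall>c\<in>atlas M. \<forall>v. smooth_on (snd c ` fst c) (\<lambda>x. local_rep M c \<omega> x v))"

text \<open>Joint smoothness in the point and the parameter, which ranges over the open set \<open>T\<close>.\<close>

definition smooth_family ::
  "nat \<Rightarrow> ('a, 'e::euclidean_space) mfd \<Rightarrow> 't::euclidean_space set \<Rightarrow> ('t \<Rightarrow> ('a, 'e, real) form) \<Rightarrow> bool" where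
  "smooth_family k M T \<omega> \<longleftrightarrow> (\<forall>t\<in>T. \<forall>p\<in>points M. alt_form k (\<omega> t p)) \<and>
     (\<forall>c\<in>atlas M. \<forall>v. smooth_on (snd c ` fst c \<times> T) (\<lambda>(x, t). local_rep M c (\<omega> t) x v))"

definition ext_d_eucl :: "nat \<Rightarrow> ('e::euclidean_space, 'e, real) form \<Rightarrow> ('e, 'e, real) form" where
  "ext_d_eucl k \<omega> x v =
     (\<Sum>i\<le>k. (- 1) ^ i *
        frechet_derivative (\<lambda>z. \<omega> z (\<lambda>j. if j < i then v j else v (Suc j))) (at x) (v i))"

definition ext_d :: "nat \<Rightarrow> ('a, 'e::euclidean_space) mfd \<Rightarrow> ('a, 'e, real) form \<Rightarrow> ('a, 'e, real) form" where
  "ext_d k M \<omega> p = ext_d_eucl k (local_rep M (chart_at M p) \<omega>) (snd (chart_at M p) p)"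

definition d_fun :: "('a, 'e::euclidean_space) mfd \<Rightarrow> ('a \<Rightarrow> real) \<Rightarrow> ('a, 'e, real) form" where
  "d_fun M f = ext_d 0 M (\<lambda>p v. f p)"

definition sym_prod :: "((nat \<Rightarrow> 'e) \<Rightarrow> real) \<Rightarrow> 'e \<Rightarrow> 'e \<Rightarrow> real" where
  "sym_prod \<beta> a b = \<beta> (\<lambda>_. a) * \<beta> (\<lambda>_. b)"


section \<open>Complex curves\<close>

text \<open>The complex structure is multiplication by \<open>\<i>\<close> in any holomorphic chart, in
  particular in the one used to identify the tangent space with \<open>complex\<close>.\<close>

definition J_form :: "('a, complex, 'r) form \<Rightarrow> ('a, complex, 'r) form" where
  "J_form \<beta> p v = \<beta> p (\<lambda>i. \<i> * v i)"

definition dc_fun :: "('a, complex) mfd \<Rightarrow> ('a \<Rightarrow> real) \<Rightarrow> ('a, complex, real) form" where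
  "dc_fun X f = J_form (d_fun X f)"

definition ddc :: "('a, complex) mfd \<Rightarrow> ('a \<Rightarrow> real) \<Rightarrow> ('a, complex, real) form" where
  "ddc X f = ext_d 1 X (dc_fun X f)"

text \<open>A \<open>(1,0)\<close>-form is \<open>h dz\<close> in a chart with coordinate \<open>z\<close>; the coefficient \<open>h\<close> is its value
  on the coordinate vector \<open>1\<close>.\<close>

definition holomorphic_10_form :: "('a, complex) mfd \<Rightarrow> ('a, complex, complex) form \<Rightarrow> bool" where
  "holomorphic_10_form X \<Upsilon> \<longleftrightarrow>
     (\<forall>p\<in>points X. alt_form 1 (\<Upsilon> p) \<and> (\<forall>v. J_form \<Upsilon> p v = \<i> * \<Upsilon> p v)) \<and>
     (\<forall>c\<in>atlas X. (\<lambda>z. local_rep X c \<Upsilon> z (\<lambda>_. 1)) holomorphic_on (snd c ` fst c))"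

definition kaehler_metric :: "((nat \<Rightarrow> complex) \<Rightarrow> real) \<Rightarrow> complex \<Rightarrow> complex \<Rightarrow> real" where
  "kaehler_metric \<phi> a b = \<phi> (\<lambda>i. if i = 0 then a else \<i> * b)"

definition kaehler_form :: "('a, complex) mfd \<Rightarrow> ('a, complex, real) form \<Rightarrow> bool" where
  "kaehler_form X \<omega> \<longleftrightarrow> smooth_form 2 X \<omega> \<and>
     (\<forall>p\<in>points X. ext_d 2 X \<omega> p = (\<lambda>_. 0) \<and> J_form \<omega> p = \<omega> p \<and>
        (\<forall>a. a \<noteq> 0 \<longrightarrow> kaehler_metric (\<omega> p) a a > 0))"

text \<open>Derivatives with respect to the parameters of a family \<open>\<omega>(s, y)\<close> of forms.\<close>

definition partial_s :: "(real \<Rightarrow> real \<Rightarrow> ('a, 'e, real) form) \<Rightarrow> real \<Rightarrow> real \<Rightarrow> ('a, 'e, real) form" where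
  "partial_s \<omega> s y p v = deriv (\<lambda>t. \<omega> t y p v) s"

definition partial_y :: "(real \<Rightarrow> real \<Rightarrow> ('a, 'e, real) form) \<Rightarrow> real \<Rightarrow> real \<Rightarrow> ('a, 'e, real) form" where
  "partial_y \<omega> s y p v = deriv (\<lambda>t. \<omega> s t p v) y"


section \<open>Principal torus bundles and connection forms\<close>

definition principal_torus_bundle ::
  "('b, 'f::euclidean_space) mfd \<Rightarrow> ('c, 'e::euclidean_space) mfd \<Rightarrow> ('c \<Rightarrow> 'b) \<Rightarrow>
   (complex \<Rightarrow> complex \<Rightarrow> 'c \<Rightarrow> 'c) \<Rightarrow> bool" where
  "principal_torus_bundle B E \<pi> act \<longleftrightarrow>
     smooth_manifold E \<and> smooth_map E B \<pi> \<and>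
     smooth_map (prod_mfd torus_mfd E) E (\<lambda>((z1, z2), p). act z1 z2 p) \<and>
     (\<forall>p\<in>points E. act 1 1 p = p) \<and>
     (\<forall>p\<in>points E. \<forall>z1\<in>sphere 0 1. \<forall>z2\<in>sphere 0 1.
        \<pi> (act z1 z2 p) = \<pi> p \<and>
        (\<forall>w1\<in>sphere 0 1. \<forall>w2\<in>sphere 0 1.
           act (w1 * z1) (w2 * z2) p = act w1 w2 (act z1 z2 p))) \<and>
     (\<forall>b\<in>points B. \<exists>U \<psi>. openin (mtop B) U \<and> b \<in> U \<and>
        diffeo (open_sub E (\<pi> -` U)) (prod_mfd (open_sub B U) torus_mfd) \<psi> \<and>
        (\<forall>p\<in>points E \<inter> \<pi> -` U. fst (\<psi> p) = \<pi> p \<and>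
           (\<forall>z1\<in>sphere 0 1. \<forall>z2\<in>sphere 0 1.
              snd (\<psi> (act z1 z2 p)) = (z1 * fst (snd (\<psi> p)), z2 * snd (snd (\<psi> p))))))"

definition generator1 ::
  "('c, 'e::euclidean_space) mfd \<Rightarrow> (complex \<Rightarrow> complex \<Rightarrow> 'c \<Rightarrow> 'c) \<Rightarrow> 'c \<Rightarrow> 'e" where
  "generator1 E act p = mdiff (eucl (UNIV :: real set)) E (\<lambda>t. act (cis t) 1 p) 0 1"

definition generator2 ::
  "('c, 'e::euclidean_space) mfd \<Rightarrow> (complex \<Rightarrow> complex \<Rightarrow> 'c \<Rightarrow> 'c) \<Rightarrow> 'c \<Rightarrow> 'e" where
  "generator2 E act p = mdiff (eucl (UNIV :: real set)) E (\<lambda>t. act 1 (cis t) p) 0 1"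

definition torus_invariant ::
  "('c, 'e::euclidean_space) mfd \<Rightarrow> (complex \<Rightarrow> complex \<Rightarrow> 'c \<Rightarrow> 'c) \<Rightarrow> ('c, 'e, real) form \<Rightarrow> bool" where
  "torus_invariant E act \<theta> \<longleftrightarrow> (\<forall>z1\<in>sphere 0 1. \<forall>z2\<in>sphere 0 1. \<forall>p\<in>points E.
     pullback E E (act z1 z2) \<theta> p = \<theta> p)"

definition connection_forms ::
  "('c, 'e::euclidean_space) mfd \<Rightarrow> (complex \<Rightarrow> complex \<Rightarrow> 'c \<Rightarrow> 'c) \<Rightarrow>
   ('c, 'e, real) form \<Rightarrow> ('c, 'e, real) form \<Rightarrow> bool" where
  "connection_forms E act \<theta>1 \<theta>2 \<longleftrightarrow>
     smooth_form 1 E \<theta>1 \<and> smooth_form 1 E \<theta>2 \<and>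
     torus_invariant E act \<theta>1 \<and> torus_invariant E act \<theta>2 \<and>
     (\<forall>p\<in>points E.
        \<theta>1 p (\<lambda>_. generator1 E act p) = 1 \<and> \<theta>1 p (\<lambda>_. generator2 E act p) = 0 \<and>
        \<theta>2 p (\<lambda>_. generator1 E act p) = 0 \<and> \<theta>2 p (\<lambda>_. generator2 E act p) = 1)"

text \<open>The components of a map into \<open>\<Sigma> \<times> I\<^sub>s \<times> I\<^sub>y\<close>.\<close>

definition pr_curve :: "('c \<Rightarrow> 'a \<times> real \<times> real) \<Rightarrow> 'c \<Rightarrow> 'a" where
  "pr_curve \<pi> q = fst (\<pi> q)"

definition pr_s :: "('c \<Rightarrow> 'a \<times> real \<times> real) \<Rightarrow> 'c \<Rightarrow> real" where
  "pr_s \<pi> q = fst (snd (\<pi> q))"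

definition pr_y :: "('c \<Rightarrow> 'a \<times> real \<times> real) \<Rightarrow> 'c \<Rightarrow> real" where
  "pr_y \<pi> q = snd (snd (\<pi> q))"

text \<open>The pullback along \<open>\<pi>\<close> of the form on \<open>\<Sigma> \<times> I\<^sub>s \<times> I\<^sub>y\<close> given by a family of
  forms on \<open>\<Sigma>\<close>.\<close>

definition lift_family ::
  "('c, 'e::euclidean_space) mfd \<Rightarrow> ('a, complex) mfd \<Rightarrow> ('c \<Rightarrow> 'a \<times> real \<times> real) \<Rightarrow>
   (real \<Rightarrow> real \<Rightarrow> ('a, complex, real) form) \<Rightarrow> ('c, 'e, real) form" where
  "lift_family E X \<pi> \<omega> q = pullback E X (pr_curve \<pi>) (\<omega> (pr_s \<pi> q) (pr_y \<pi> q)) q"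


section \<open>Spin(7)-structures\<close>

definition dx :: "8 \<Rightarrow> (nat \<Rightarrow> real^8) \<Rightarrow> real" where
  "dx i v = v 0 $ i"

definition dx4 :: "8 \<Rightarrow> 8 \<Rightarrow> 8 \<Rightarrow> 8 \<Rightarrow> (nat \<Rightarrow> real^8) \<Rightarrow> real" where
  "dx4 i j k l = wedge 2 2 (dx i \<and>\<^sub>1 dx j) (dx k \<and>\<^sub>1 dx l)"

definition Phi0 :: "(nat \<Rightarrow> real^8) \<Rightarrow> real" where
  "Phi0 v = dx4 0 1 2 3 v + dx4 0 1 4 5 v + dx4 0 1 6 7 v + dx4 0 2 4 6 v
     - dx4 0 2 5 7 v - dx4 0 3 4 7 v - dx4 0 3 5 6 v
     + dx4 2 3 4 5 v + dx4 2 3 6 7 v + dx4 4 5 6 7 v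
     - dx4 1 2 4 7 v - dx4 1 2 5 6 v - dx4 1 3 4 6 v + dx4 1 3 5 7 v"

text \<open>A linear identification with \<open>\<real>\<^sup>8\<close> taking \<open>\<phi>\<close> to the model form. It is
  unique up to the stabiliser of the model form, which is the subgroup Spin(7) of SO(8).\<close>

definition spin7_frame :: "((nat \<Rightarrow> 'e::real_vector) \<Rightarrow> real) \<Rightarrow> ('e \<Rightarrow> real^8) \<Rightarrow> bool" where
  "spin7_frame \<phi> A \<longleftrightarrow> linear A \<and> bij A \<and> (\<forall>v. \<phi> v = Phi0 (\<lambda>i. A (v i)))"

definition spin7_structure :: "('a, 'e::euclidean_space) mfd \<Rightarrow> ('a, 'e, real) form \<Rightarrow> bool" where
  "spin7_structure M \<Phi> \<longleftrightarrow> smooth_form 4 M \<Phi> \<and> (\<forall>p\<in>points M. \<exists>A. spin7_frame (\<Phi> p) A)"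

definition torsion_free :: "('a, 'e::euclidean_space) mfd \<Rightarrow> ('a, 'e, real) form \<Rightarrow> bool" where
  "torsion_free M \<Phi> \<longleftrightarrow> (\<forall>p\<in>points M. ext_d 4 M \<Phi> p = (\<lambda>_. 0))"

definition induces_metric ::
  "('a, 'e::euclidean_space) mfd \<Rightarrow> ('a, 'e, real) form \<Rightarrow> ('a \<Rightarrow> 'e \<Rightarrow> 'e \<Rightarrow> real) \<Rightarrow> bool" where
  "induces_metric M \<Phi> g \<longleftrightarrow>
     (\<forall>p\<in>points M. \<exists>A. spin7_frame (\<Phi> p) A \<and> (\<forall>a b. g p a b = A a \<bullet> A b))"

end

theory Submission
  imports Defs
begin

text \<open>Put \<open>\<sigma> = sy (\<omega> - \<alpha> \<and> dy + \<kappa> \<and> ds)\<close>; the curvature equations for \<open>\<alpha>\<close> and \<open>\<kappa>\<close> make \<open>\<sigma>/(sy)\<close>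
  closed. With \<open>\<Omega> = sy (\<alpha> - iu dy) \<and> (\<kappa> + iw ds) \<and> (\<Upsilon>\<^sub>1 - i\<Upsilon>\<^sub>2)\<close>, the form
  \<open>\<Phi> = (sy)\<^sup>-\<^sup>1 \<eta> \<and> \<xi> \<and> \<sigma> + s\<^sup>-\<^sup>1 \<eta> \<and> Re \<Omega> - y\<^sup>-\<^sup>1 \<xi> \<and> Im \<Omega> + \<sigma>\<^sup>2/2\<close> is the model form in an
  orthonormal coframe of the asserted metric. At each point \<open>du\<close> and \<open>dw\<close> are combinations of
  \<open>\<Upsilon>\<^sub>1, \<Upsilon>\<^sub>2, dy\<close> and \<open>\<Upsilon>\<^sub>1, \<Upsilon>\<^sub>2, ds\<close>, so \<open>d\<Phi>\<close> becomes a combination of monomials in the coframe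
  \<open>\<eta>, \<xi>, \<alpha>, dy, \<kappa>, ds, \<Upsilon>\<^sub>1, \<Upsilon>\<^sub>2\<close>, whose coefficients cancel. The coframe is linearly independent
  because the tangent spaces of the fibres are spanned by the generators of the torus actions.\<close>

section \<open>Wedge products of covectors\<close>

text \<open>The volume condition makes \<omega> the multiple -uw/(sy) of \<Upsilon>1 \<and>
  \<Upsilon>2. Its parameter derivatives are therefore explicit in u, w, u', w', and the curvature
  equations become structure equations with scalar coefficients at each point. Positivity of the
  Kaehler form prevents \<Upsilon> from having zeros, which is what allows \<Upsilon>1, \<Upsilon>2
  to serve as a coframe of the curve. Two obstacles shape the work. The products in the statement
  are sums over permutations, unwieldy in degree five; products of covectors are therefore kept as
  lists, on which d acts symbolically by the Leibniz rule, and only values and differentials at one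
  point enter. Moreover a form stores its value at each point in a chart chosen for that point, with
  no regularity from one point to the next. Every form must be moved to one fixed chart before it is
  differentiated, and d must be shown to commute with pullbacks. This is done in degree one, the
  degree of the coframe, and rests on the symmetry of second derivatives.\<close>

definition drop_arg :: "nat \<Rightarrow> (nat \<Rightarrow> 'e) \<Rightarrow> nat \<Rightarrow> 'e" where
  "drop_arg i v = (\<lambda>j. if j < i then v j else v (Suc j))"

text \<open>The exterior product of a covector with a k-form by expansion along the covector. It has
  k + 1 terms where the permutation sum has (k + 1)!, and it suits recursion.\<close>

definition wedge_cov :: "('e \<Rightarrow> real) \<Rightarrow> nat \<Rightarrow> ((nat \<Rightarrow> 'e) \<Rightarrow> real) \<Rightarrow> (nat \<Rightarrow> 'e) \<Rightarrow> real" where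
  "wedge_cov \<phi> k \<psi> v = (\<Sum>i\<le>k. (- 1) ^ i * \<phi> (v i) * \<psi> (drop_arg i v))"

text \<open>The exterior product of a two-form with a k-form. The positions removed are i and
  \<open>Suc j\<close> with i \<le> j, so the usual sign (-1)^(i + Suc j - 1) becomes (-1)^(i +
  j).\<close>

definition wedge_pair :: "('e \<Rightarrow> 'e \<Rightarrow> real) \<Rightarrow> nat \<Rightarrow> ((nat \<Rightarrow> 'e) \<Rightarrow> real) \<Rightarrow> (nat \<Rightarrow> 'e) \<Rightarrow> real" where
  "wedge_pair \<theta> k \<psi> v =
     (\<Sum>j\<le>k. \<Sum>i\<le>j. (- 1) ^ (i + j) * \<theta> (v i) (v (Suc j)) * \<psi> (drop_arg i (drop_arg (Suc j) v)))"

primrec wedge_list :: "('e \<Rightarrow> real) list \<Rightarrow> (nat \<Rightarrow> 'e) \<Rightarrow> real" where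
  "wedge_list [] = (\<lambda>_. 1)"
| "wedge_list (a # as) = wedge_cov a (length as) (wedge_list as)"

text \<open>Removing position i first shifts all later positions down by one, which is where
  \<open>Suc j\<close> comes from.\<close>

lemma drop_arg_drop_arg: "i \<le> j \<Longrightarrow> drop_arg j (drop_arg i v) = drop_arg i (drop_arg (Suc j) v)"
  by (auto simp: drop_arg_def fun_eq_iff)

lemma drop_arg_comp: "drop_arg i (\<lambda>j. f (v j)) = (\<lambda>j. f (drop_arg i v j))"
  by (auto simp: drop_arg_def)

text \<open>An ordered pair of distinct positions is encoded by the one removed first and the index
  of the other in what remains. The two triangles i \<le> j and i > j are the two orders of removing
  the same positions.\<close>

lemma sum_triangles:
  fixes a :: "nat \<Rightarrow> nat \<Rightarrow> 'b::comm_monoid_add"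
  shows "(\<Sum>i\<le>Suc k. \<Sum>j\<le>k. a i j) = (\<Sum>j\<le>k. \<Sum>i\<le>j. a i j + a (Suc j) i)"
proof (induction k)
  case (Suc k)
  have "(\<Sum>i\<le>Suc (Suc k). \<Sum>j\<le>Suc k. a i j)
      = (\<Sum>i\<le>Suc k. \<Sum>j\<le>k. a i j) + (\<Sum>i\<le>Suc k. a i (Suc k)) + (\<Sum>j\<le>Suc k. a (Suc (Suc k)) j)"
    by (simp add: sum.distrib add_ac)
  then show ?case
    unfolding Suc.IH by (simp add: sum.distrib add_ac)
qed (simp add: add_ac)

text \<open>The two orders of removal carry opposite signs, so the double sum antisymmetrises the
  summand. This serves products of two covectors as well as both halves of the Leibniz rule.\<close>

lemma sum_drop_drop:
  "(\<Sum>i\<le>Suc k. (- 1) ^ i * (\<Sum>j\<le>k. (- 1) ^ j * (G i j :: real) * \<psi> i (drop_arg j (drop_arg i v))))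
   = (\<Sum>j\<le>k. \<Sum>i\<le>j. (- 1) ^ (i + j) * (G i j * \<psi> i (drop_arg i (drop_arg (Suc j) v))
                             - G (Suc j) i * \<psi> (Suc j) (drop_arg i (drop_arg (Suc j) v))))"
proof -
  have "(\<Sum>i\<le>Suc k. (- 1) ^ i * (\<Sum>j\<le>k. (- 1) ^ j * G i j * \<psi> i (drop_arg j (drop_arg i v))))
      = (\<Sum>i\<le>Suc k. \<Sum>j\<le>k. (- 1) ^ (i + j) * G i j * \<psi> i (drop_arg j (drop_arg i v)))"
    by (simp add: sum_distrib_left power_add mult_ac)
  also have "\<dots> = (\<Sum>j\<le>k. \<Sum>i\<le>j. (- 1) ^ (i + j) * G i j * \<psi> i (drop_arg j (drop_arg i v))
      + (- 1) ^ (Suc j + i) * G (Suc j) i * \<psi> (Suc j) (drop_arg i (drop_arg (Suc j) v)))"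
    by (rule sum_triangles)
  also have "\<dots> = (\<Sum>j\<le>k. \<Sum>i\<le>j. (- 1) ^ (i + j) * (G i j * \<psi> i (drop_arg i (drop_arg (Suc j) v))
                             - G (Suc j) i * \<psi> (Suc j) (drop_arg i (drop_arg (Suc j) v))))"
    by (intro sum.cong refl) (simp add: drop_arg_drop_arg algebra_simps)
  finally show ?thesis .
qed

lemma wedge_cov_wedge_cov:
  "wedge_cov \<phi> (Suc k) (wedge_cov \<mu> k \<psi>) = wedge_pair (\<lambda>a b. \<phi> a * \<mu> b - \<phi> b * \<mu> a) k \<psi>"
proof
  fix v
  have "wedge_cov \<phi> (Suc k) (wedge_cov \<mu> k \<psi>) v
      = (\<Sum>i\<le>Suc k. (- 1) ^ i * (\<Sum>j\<le>k. (- 1) ^ j * (\<phi> (v i) * \<mu> (drop_arg i v j)) * \<psi> (drop_arg j (drop_arg i v))))"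
    unfolding wedge_cov_def sum_distrib_left by (intro sum.cong refl) (simp add: mult_ac)
  also have "\<dots> = (\<Sum>j\<le>k. \<Sum>i\<le>j. (- 1) ^ (i + j) *
        (\<phi> (v i) * \<mu> (drop_arg i v j) * \<psi> (drop_arg i (drop_arg (Suc j) v))
         - \<phi> (v (Suc j)) * \<mu> (drop_arg (Suc j) v i) * \<psi> (drop_arg i (drop_arg (Suc j) v))))"
    by (rule sum_drop_drop)
  also have "\<dots> = wedge_pair (\<lambda>a b. \<phi> a * \<mu> b - \<phi> b * \<mu> a) k \<psi> v"
    unfolding wedge_pair_def by (intro sum.cong refl) (simp add: drop_arg_def algebra_simps)
  finally show "wedge_cov \<phi> (Suc k) (wedge_cov \<mu> k \<psi>) v = wedge_pair (\<lambda>a b. \<phi> a * \<mu> b - \<phi> b * \<mu> a) k \<psi> v" .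
qed

lemma wedge_cov_lin:
  "wedge_cov (\<lambda>a. c * \<phi> a) k \<psi> = (\<lambda>v. c * wedge_cov \<phi> k \<psi> v)"
  "wedge_cov (\<lambda>a. \<phi> a + \<mu> a) k \<psi> = (\<lambda>v. wedge_cov \<phi> k \<psi> v + wedge_cov \<mu> k \<psi> v)"
  "wedge_cov (\<lambda>a. 0) k \<psi> = (\<lambda>v. 0)"
  "wedge_cov \<phi> k (\<lambda>v. c * \<psi> v) = (\<lambda>v. c * wedge_cov \<phi> k \<psi> v)"
  "wedge_cov \<phi> k (\<lambda>v. \<psi> v + \<psi>' v) = (\<lambda>v. wedge_cov \<phi> k \<psi> v + wedge_cov \<phi> k \<psi>' v)"
  "wedge_cov \<phi> k (\<lambda>v. 0) = (\<lambda>v. 0)"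
  by (auto simp: wedge_cov_def fun_eq_iff sum_distrib_left algebra_simps sum.distrib sum_negf)

lemma wedge_pair_lin:
  "wedge_pair (\<lambda>a b. c * \<theta> a b) k \<psi> = (\<lambda>v. c * wedge_pair \<theta> k \<psi> v)"
  "wedge_pair (\<lambda>a b. \<theta> a b + \<theta>' a b) k \<psi> = (\<lambda>v. wedge_pair \<theta> k \<psi> v + wedge_pair \<theta>' k \<psi> v)"
  "wedge_pair (\<lambda>a b. 0) k \<psi> = (\<lambda>v. 0)"
  by (auto simp: wedge_pair_def fun_eq_iff sum_distrib_left algebra_simps sum.distrib)

text \<open>Behind the common prefix the two covectors enter only through their alternating
  two-form, and exchanging them negates it.\<close>

lemma wedge_list_swap: "wedge_list (as @ a # b # bs) v = - wedge_list (as @ b # a # bs) v"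
proof (induction as arbitrary: v)
  case Nil
  have "wedge_pair (\<lambda>x y. a x * b y - a y * b x) k \<psi>
      = (\<lambda>v. - 1 * wedge_pair (\<lambda>x y. b x * a y - b y * a x) k \<psi> v)" for k \<psi>
    by (subst wedge_pair_lin(1)[symmetric]) (simp add: mult.commute)
  then show ?case by (simp add: wedge_cov_wedge_cov)
qed (simp add: wedge_cov_def sum_negf)

lemma wedge_list_same: "wedge_list (as @ a # a # bs) v = 0"
  using wedge_list_swap[of as a a bs v] by simp

text \<open>Dependence on \<open>v 0\<close> alone suffices to evaluate the two permutations of a
  pair; no linearity enters.\<close>

lemma wedge11_cov:
  assumes "\<And>v w. v 0 = w 0 \<Longrightarrow> \<phi> v = \<phi> w" "\<And>v w. v 0 = w 0 \<Longrightarrow> \<psi> v = \<psi> w"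
  shows "wedge 1 1 \<phi> \<psi> v = \<phi> (\<lambda>_. v 0) * \<psi> (\<lambda>_. v 1) - \<phi> (\<lambda>_. v 1) * \<psi> (\<lambda>_. v 0)"
proof -
  let ?t = "Transposition.transpose (0 :: nat) 1"
  have "{p. p permutes {..<1 + 1 :: nat}} = {id, ?t}"
    by (auto simp: lessThan_Suc insert_commute permutes_doubleton_iff)
  moreover have "?t \<noteq> id"
    by (metis id_apply transpose_apply_first zero_neq_one)
  ultimately have "wedge 1 1 \<phi> \<psi> v
      = \<phi> (\<lambda>i. v i) * \<psi> (\<lambda>i. v (Suc i)) - \<phi> (\<lambda>i. v (?t i)) * \<psi> (\<lambda>i. v (?t (Suc i)))"
    by (simp add: wedge_def sign_swap_id)
  moreover have "\<phi> (\<lambda>i. v i) = \<phi> (\<lambda>_. v 0)" "\<psi> (\<lambda>i. v (Suc i)) = \<psi> (\<lambda>_. v 1)"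
    "\<phi> (\<lambda>i. v (?t i)) = \<phi> (\<lambda>_. v 1)" "\<psi> (\<lambda>i. v (?t (Suc i))) = \<psi> (\<lambda>_. v 0)"
    by (rule assms; simp add: transpose_def)+
  ultimately show ?thesis by simp
qed

section \<open>The exterior differential of wedge products\<close>

abbreviation fderiv :: "('a::real_normed_vector \<Rightarrow> 'b::real_normed_vector) \<Rightarrow> 'a \<Rightarrow> 'a \<Rightarrow> 'b" where
  "fderiv f x \<equiv> frechet_derivative f (at x)"

lemma ext_d_eucl_drop_arg:
  "ext_d_eucl k \<omega> x v = (\<Sum>i\<le>k. (- 1) ^ i * fderiv (\<lambda>z. \<omega> z (drop_arg i v)) x (v i))"
  by (simp add: ext_d_eucl_def drop_arg_def)

lemma frechet_derivative_mult:
  fixes f g :: "'e::real_normed_vector \<Rightarrow> real"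
  assumes "f differentiable (at x)" "g differentiable (at x)"
  shows "fderiv (\<lambda>z. f z * g z) x a
    = fderiv f x a * g x + f x * fderiv g x a"
proof -
  have "((\<lambda>z. f z * g z) has_derivative
      (\<lambda>a. f x * fderiv g x a + fderiv f x a * g x)) (at x)"
    using assms by (intro has_derivative_mult) (simp_all add: frechet_derivative_works)
  from frechet_derivative_at[OF this, symmetric] show ?thesis by simp
qed

lemma frechet_derivative_sum:
  fixes f :: "'i \<Rightarrow> 'e::real_normed_vector \<Rightarrow> real"
  assumes "\<And>i. i \<in> A \<Longrightarrow> f i differentiable (at x)"
  shows "fderiv (\<lambda>z. \<Sum>i\<in>A. f i z) x a = (\<Sum>i\<in>A. fderiv (f i) x a)"
proof -
  have "((\<lambda>z. \<Sum>i\<in>A. f i z) has_derivative (\<lambda>a. \<Sum>i\<in>A. fderiv (f i) x a)) (at x)"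
    using assms by (intro has_derivative_sum) (simp add: frechet_derivative_works)
  from frechet_derivative_at[OF this, symmetric] show ?thesis by simp
qed

lemma frechet_derivative_cmult:
  fixes f :: "'e::real_normed_vector \<Rightarrow> real"
  assumes "f differentiable (at x)"
  shows "fderiv (\<lambda>z. c * f z) x a = c * fderiv f x a"
  using frechet_derivative_mult[OF differentiable_const assms, of c] by simp

lemma differentiable_wedge_cov:
  fixes \<beta> :: "'e::euclidean_space \<Rightarrow> 'e \<Rightarrow> real"
  assumes "\<And>a. (\<lambda>z. \<beta> z a) differentiable (at x)" "\<And>v. (\<lambda>z. \<psi> z v) differentiable (at x)"
  shows "(\<lambda>z. wedge_cov (\<beta> z) k (\<psi> z) v) differentiable (at x)"
  unfolding wedge_cov_def using assms by (intro differentiable_sum differentiable_mult differentiable_const) auto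

lemma differentiable_wedge_list:
  fixes b :: "'i \<Rightarrow> 'e::euclidean_space \<Rightarrow> 'e \<Rightarrow> real"
  assumes "\<And>i a. i \<in> set I \<Longrightarrow> (\<lambda>z. b i z a) differentiable (at x)"
  shows "(\<lambda>z. wedge_list (map (\<lambda>i. b i z) I) v) differentiable (at x)"
  using assms by (induction I arbitrary: v) (auto intro!: differentiable_wedge_cov)

text \<open>The Leibniz rule d(\<beta> \<and> \<psi>) = d\<beta> \<and> \<psi> - \<beta> \<and>
  d\<psi>. The product rule splits each directional derivative in two: the first halves
  antisymmetrise to d\<beta>; in the second the differentiating vector trades places with the
  argument of \<beta>, whence the minus sign.\<close>

lemma ext_d_eucl_wedge_cov:
  fixes \<beta> :: "'e::euclidean_space \<Rightarrow> 'e \<Rightarrow> real"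
  assumes \<beta>: "\<And>a. (\<lambda>z. \<beta> z a) differentiable (at x)"
    and \<psi>: "\<And>v. (\<lambda>z. \<psi> z v) differentiable (at x)"
  shows "ext_d_eucl (Suc k) (\<lambda>z. wedge_cov (\<beta> z) k (\<psi> z)) x v
    = wedge_pair (\<lambda>a b. fderiv (\<lambda>z. \<beta> z b) x a - fderiv (\<lambda>z. \<beta> z a) x b) k (\<psi> x) v
      - wedge_cov (\<beta> x) (Suc k) (ext_d_eucl k \<psi> x) v"
proof -
  let ?D\<beta> = "\<lambda>a b. fderiv (\<lambda>z. \<beta> z b) x a"
  let ?D\<psi> = "\<lambda>a w. fderiv (\<lambda>z. \<psi> z w) x a"
  let ?dd = "\<lambda>i j. drop_arg i (drop_arg (Suc j) v)"
  have D: "fderiv (\<lambda>z. wedge_cov (\<beta> z) k (\<psi> z) w) x a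
      = (\<Sum>j\<le>k. (- 1) ^ j * ?D\<beta> a (w j) * \<psi> x (drop_arg j w))
        + (\<Sum>j\<le>k. (- 1) ^ j * \<beta> x (w j) * ?D\<psi> a (drop_arg j w))" for a w
  proof -
    have "fderiv (\<lambda>z. wedge_cov (\<beta> z) k (\<psi> z) w) x a
      = (\<Sum>j\<le>k. (- 1) ^ j * (?D\<beta> a (w j) * \<psi> x (drop_arg j w) + \<beta> x (w j) * ?D\<psi> a (drop_arg j w)))"
      unfolding wedge_cov_def using \<beta> \<psi>
      by (subst frechet_derivative_sum)
         (auto simp: mult.assoc frechet_derivative_mult frechet_derivative_cmult intro!: differentiable_mult)
    then show ?thesis by (simp add: distrib_left sum.distrib mult.assoc)
  qed
  have "ext_d_eucl (Suc k) (\<lambda>z. wedge_cov (\<beta> z) k (\<psi> z)) x v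
    = (\<Sum>i\<le>Suc k. (- 1) ^ i * (\<Sum>j\<le>k. (- 1) ^ j * ?D\<beta> (v i) (drop_arg i v j) * \<psi> x (drop_arg j (drop_arg i v))))
    + (\<Sum>i\<le>Suc k. (- 1) ^ i * (\<Sum>j\<le>k. (- 1) ^ j * \<beta> x (drop_arg i v j) * ?D\<psi> (v i) (drop_arg j (drop_arg i v))))"
    unfolding ext_d_eucl_drop_arg D distrib_left sum.distrib by simp
  also have "(\<Sum>i\<le>Suc k. (- 1) ^ i * (\<Sum>j\<le>k. (- 1) ^ j * ?D\<beta> (v i) (drop_arg i v j) * \<psi> x (drop_arg j (drop_arg i v))))
    = wedge_pair (\<lambda>a b. ?D\<beta> a b - ?D\<beta> b a) k (\<psi> x) v"
    unfolding wedge_pair_def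
    by (rule trans[OF sum_drop_drop[where G = "\<lambda>i j. ?D\<beta> (v i) (drop_arg i v j)" and \<psi> = "\<lambda>_. \<psi> x"]],
        intro sum.cong refl) (simp add: drop_arg_def algebra_simps)
  also have "(\<Sum>i\<le>Suc k. (- 1) ^ i * (\<Sum>j\<le>k. (- 1) ^ j * \<beta> x (drop_arg i v j) * ?D\<psi> (v i) (drop_arg j (drop_arg i v))))
    = (\<Sum>j\<le>k. \<Sum>i\<le>j. (- 1) ^ (i + j) * (\<beta> x (drop_arg i v j) * ?D\<psi> (v i) (?dd i j)
                             - \<beta> x (drop_arg (Suc j) v i) * ?D\<psi> (v (Suc j)) (?dd i j)))"
    by (rule sum_drop_drop)
  also have "\<dots> = - (\<Sum>j\<le>k. \<Sum>i\<le>j. (- 1) ^ (i + j) * (\<beta> x (v i) * ?D\<psi> (drop_arg i v j) (?dd i j)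
                             - \<beta> x (v (Suc j)) * ?D\<psi> (drop_arg (Suc j) v i) (?dd i j)))"
    unfolding sum_negf[symmetric] by (intro sum.cong refl) (simp add: drop_arg_def algebra_simps)
  \<comment> \<open>The rearrangement is now read backwards, with the whole summand absorbed into
    \<open>G\<close> and the constant 1 in place of \<psi>.\<close>
  also have "(\<Sum>j\<le>k. \<Sum>i\<le>j. (- 1) ^ (i + j) * (\<beta> x (v i) * ?D\<psi> (drop_arg i v j) (?dd i j)
                             - \<beta> x (v (Suc j)) * ?D\<psi> (drop_arg (Suc j) v i) (?dd i j)))
    = (\<Sum>i\<le>Suc k. (- 1) ^ i * (\<Sum>j\<le>k. (- 1) ^ j * \<beta> x (v i) * ?D\<psi> (drop_arg i v j) (drop_arg j (drop_arg i v))))"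
    using sum_drop_drop[where G = "\<lambda>i j. \<beta> x (v i) * ?D\<psi> (drop_arg i v j) (drop_arg j (drop_arg i v))" and \<psi> = "\<lambda>_ _. 1" and k = k and v = v]
    by (simp add: drop_arg_drop_arg mult.assoc)
  also have "\<dots> = wedge_cov (\<beta> x) (Suc k) (ext_d_eucl k \<psi> x) v"
    unfolding wedge_cov_def ext_d_eucl_drop_arg sum_distrib_left by (simp add: mult_ac)
  finally show ?thesis by simp
qed

lemma ext_d_eucl_const: "ext_d_eucl k (\<lambda>z v. c) x v = 0"
  by (simp add: ext_d_eucl_def)

lemma ext_d_eucl_cmult:
  fixes f :: "'e::euclidean_space \<Rightarrow> real"
  assumes "(f has_derivative f') (at x)" "\<And>v. (\<lambda>z. \<psi> z v) differentiable (at x)"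
  shows "ext_d_eucl k (\<lambda>z v. f z * \<psi> z v) x v = wedge_cov f' k (\<psi> x) v + f x * ext_d_eucl k \<psi> x v"
proof -
  have "f differentiable (at x)" using assms(1) by (auto simp: differentiable_def)
  then have "fderiv (\<lambda>z. f z * \<psi> z w) x a = f' a * \<psi> x w + f x * fderiv (\<lambda>z. \<psi> z w) x a" for a w
    using frechet_derivative_mult[of f x "\<lambda>z. \<psi> z w"] assms frechet_derivative_at[OF assms(1)] by simp
  then show ?thesis
    by (simp add: ext_d_eucl_drop_arg wedge_cov_def algebra_simps sum.distrib sum_distrib_left)
qed

lemma ext_d_eucl_sum_list:
  fixes \<psi> :: "'i \<Rightarrow> ('e::euclidean_space, 'e, real) form"
  assumes "\<And>i v. i \<in> set L \<Longrightarrow> (\<lambda>z. \<psi> i z v) differentiable (at x)"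
  shows "(\<forall>v. (\<lambda>z. \<Sum>i\<leftarrow>L. \<psi> i z v) differentiable (at x)) \<and>
    ext_d_eucl k (\<lambda>z v. \<Sum>i\<leftarrow>L. \<psi> i z v) x v = (\<Sum>i\<leftarrow>L. ext_d_eucl k (\<psi> i) x v)"
  using assms
proof (induction L)
  case Nil
  then show ?case by (simp add: ext_d_eucl_const)
next
  case (Cons i L)
  have L: "\<And>v. (\<lambda>z. \<Sum>i\<leftarrow>L. \<psi> i z v) differentiable (at x)" and i: "\<And>v. (\<lambda>z. \<psi> i z v) differentiable (at x)"
    using Cons by auto
  have "fderiv (\<lambda>z. \<psi> i z w + (\<Sum>i\<leftarrow>L. \<psi> i z w)) x a
      = fderiv (\<lambda>z. \<psi> i z w) x a + fderiv (\<lambda>z. \<Sum>i\<leftarrow>L. \<psi> i z w) x a" for w a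
    using frechet_derivative_at[OF has_derivative_add[OF
      i[of w, unfolded frechet_derivative_works] L[of w, unfolded frechet_derivative_works]], symmetric]
    by simp
  then have "ext_d_eucl k (\<lambda>z v. \<psi> i z v + (\<Sum>i\<leftarrow>L. \<psi> i z v)) x v
      = ext_d_eucl k (\<psi> i) x v + ext_d_eucl k (\<lambda>z v. \<Sum>i\<leftarrow>L. \<psi> i z v) x v"
    by (simp add: ext_d_eucl_drop_arg algebra_simps sum.distrib)
  moreover have "(\<lambda>z. \<psi> i z v + (\<Sum>i\<leftarrow>L. \<psi> i z v)) differentiable (at x)" for v
    using i L by (rule differentiable_add)
  ultimately show ?case using Cons by simp
qed

text \<open>An entry \<open>(c, p, q)\<close> of \<open>D i\<close> stands for a term \<open>c b\<^sub>p \<and> b\<^sub>q\<close> of \<open>d b\<^sub>i\<close>, and an entry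
  \<open>(c, [i, \<dots>, j])\<close> of the result for \<open>c b\<^sub>i \<and> \<dots> \<and> b\<^sub>j\<close>.\<close>

primrec diff_monomial :: "(nat \<Rightarrow> (real \<times> nat \<times> nat) list) \<Rightarrow> nat list \<Rightarrow> (real \<times> nat list) list" where
  "diff_monomial D [] = []"
| "diff_monomial D (i # I) =
     map (\<lambda>(c, p, q). (c, p # q # I)) (D i) @ map (\<lambda>(c, J). (- c, i # J)) (diff_monomial D I)"

lemma wedge_pair_sum_list:
  "wedge_pair (\<lambda>a b. \<Sum>(c, p, q)\<leftarrow>L. c * (\<phi> p a * \<phi> q b - \<phi> p b * \<phi> q a)) (length I) (wedge_list (map \<phi> I)) v
   = (\<Sum>(c, p, q)\<leftarrow>L. c * wedge_list (map \<phi> (p # q # I)) v)"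
proof (induction L)
  case (Cons x L)
  obtain c p q where x: "x = (c, p, q)" by (cases x) auto
  show ?case using Cons
    by (simp add: x wedge_pair_lin wedge_cov_wedge_cov)
qed (simp add: wedge_pair_lin)

lemma wedge_cov_sum_list:
  "wedge_cov \<phi> k (\<lambda>v. \<Sum>i\<leftarrow>L. f i v) v = (\<Sum>i\<leftarrow>L. wedge_cov \<phi> k (f i) v)"
  by (induction L) (simp_all add: wedge_cov_lin)

lemma length_diff_monomial: "(c, J) \<in> set (diff_monomial D I) \<Longrightarrow> length J = Suc (length I)"
  by (induction I arbitrary: c J) auto

text \<open>The structure equations are asked for at \<open>x\<close> alone, since d of a product of
  one-forms at a point involves only the values and differentials of the factors there.\<close>

lemma ext_d_eucl_wedge_list:
  fixes b :: "nat \<Rightarrow> 'e::euclidean_space \<Rightarrow> 'e \<Rightarrow> real"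
  assumes diff: "\<And>i a. i \<in> set I \<Longrightarrow> (\<lambda>z. b i z a) differentiable (at x)"
    and D: "\<And>i a a'. i \<in> set I \<Longrightarrow>
      fderiv (\<lambda>z. b i z a') x a - fderiv (\<lambda>z. b i z a) x a'
      = (\<Sum>(c, p, q)\<leftarrow>D i. c * (b p x a * b q x a' - b p x a' * b q x a))"
  shows "ext_d_eucl (length I) (\<lambda>z. wedge_list (map (\<lambda>i. b i z) I)) x v
    = (\<Sum>(c, J)\<leftarrow>diff_monomial D I. c * wedge_list (map (\<lambda>i. b i x) J) v)"
  using assms
proof (induction I arbitrary: v)
  case Nil
  then show ?case by (simp add: ext_d_eucl_const)
next
  case (Cons i I)
  let ?W = "\<lambda>J. wedge_list (map (\<lambda>i. b i x) J)"
  have IH: "ext_d_eucl (length I) (\<lambda>z. wedge_list (map (\<lambda>i. b i z) I)) x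
      = (\<lambda>w. \<Sum>(c, J)\<leftarrow>diff_monomial D I. c * ?W J w)"
    using Cons by auto
  have "ext_d_eucl (length (i # I)) (\<lambda>z. wedge_list (map (\<lambda>i. b i z) (i # I))) x v
      = wedge_pair (\<lambda>a a'. \<Sum>(c, p, q)\<leftarrow>D i. c * (b p x a * b q x a' - b p x a' * b q x a))
          (length I) (?W I) v
        - wedge_cov (b i x) (Suc (length I)) (\<lambda>w. \<Sum>(c, J)\<leftarrow>diff_monomial D I. c * ?W J w) v"
    using Cons.prems by (simp add: ext_d_eucl_wedge_cov differentiable_wedge_list IH)
  also have "wedge_cov (b i x) (Suc (length I)) (\<lambda>w. \<Sum>(c, J)\<leftarrow>diff_monomial D I. c * ?W J w) v
      = (\<Sum>(c, J)\<leftarrow>diff_monomial D I. c * ?W (i # J) v)"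
    unfolding wedge_cov_sum_list
    by (intro arg_cong[where f = sum_list] map_cong refl)
       (auto simp: wedge_cov_lin length_diff_monomial)
  also have "\<dots> = - (\<Sum>(c, J)\<leftarrow>map (\<lambda>(c, J). (- c, i # J)) (diff_monomial D I). c * ?W J v)"
    unfolding uminus_sum_list_map by (simp add: o_def case_prod_unfold)
  finally show ?case
    using wedge_pair_sum_list[where L = "D i" and \<phi> = "\<lambda>i. b i x" and I = I and v = v]
    by (simp add: o_def case_prod_unfold)
qed

text \<open>The analysis of d ends with this reduction to list arithmetic. An entry of
  \<open>L\<close> consists of a coefficient function, the expansion of its differential at
  \<open>x\<close> in the covectors \<open>b\<close>, and a monomial.\<close>

lemma ext_d_eucl_combination:
  fixes b :: "nat \<Rightarrow> 'e::euclidean_space \<Rightarrow> 'e \<Rightarrow> real"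
  assumes diff: "\<And>i a. i \<in> A \<Longrightarrow> (\<lambda>z. b i z a) differentiable (at x)"
    and D: "\<And>i a a'. i \<in> A \<Longrightarrow>
      fderiv (\<lambda>z. b i z a') x a - fderiv (\<lambda>z. b i z a) x a'
      = (\<Sum>(c, p, q)\<leftarrow>D i. c * (b p x a * b q x a' - b p x a' * b q x a))"
    and L: "\<And>f df I. (f, df, I) \<in> set L \<Longrightarrow> length I = k \<and> set I \<subseteq> A \<and>
      (f has_derivative (\<lambda>a. \<Sum>(c, j)\<leftarrow>df. c * b j x a)) (at x)"
  shows "ext_d_eucl k (\<lambda>z v. \<Sum>(f, df, I)\<leftarrow>L. f z * wedge_list (map (\<lambda>i. b i z) I) v) x v
    = (\<Sum>(f, df, I)\<leftarrow>L. (\<Sum>(c, j)\<leftarrow>df. c * wedge_list (map (\<lambda>i. b i x) (j # I)) v)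
        + f x * (\<Sum>(c, J)\<leftarrow>diff_monomial D I. c * wedge_list (map (\<lambda>i. b i x) J) v))"
proof -
  let ?W = "\<lambda>z I. wedge_list (map (\<lambda>i. b i z) I)"
  let ?\<psi> = "\<lambda>(f, df, I) z v. f z * ?W z I v"
  have diffI: "(\<lambda>z. ?W z I v) differentiable (at x)"
    if "(f, df, I) \<in> set L" for f df I v
    using L[OF that] diff by (intro differentiable_wedge_list) auto
  have "(\<lambda>z. ?\<psi> t z v) differentiable (at x)" if "t \<in> set L" for t v
  proof -
    obtain f df I where t: "t = (f, df, I)" by (cases t) auto
    have "f differentiable (at x)" using that L[of f df I] unfolding t differentiable_def by blast
    then show ?thesis using diffI[of f df I] that unfolding t by (simp add: differentiable_mult)
  qed
  then have "ext_d_eucl k (\<lambda>z v. \<Sum>t\<leftarrow>L. ?\<psi> t z v) x v = (\<Sum>t\<leftarrow>L. ext_d_eucl k (?\<psi> t) x v)"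
    using ext_d_eucl_sum_list[where \<psi> = ?\<psi>] by blast
  also have "\<dots> = (\<Sum>(f, df, I)\<leftarrow>L. (\<Sum>(c, j)\<leftarrow>df. c * ?W x (j # I) v)
        + f x * (\<Sum>(c, J)\<leftarrow>diff_monomial D I. c * ?W x J v))"
  proof (intro arg_cong[where f = sum_list] map_cong refl)
    fix t assume "t \<in> set L"
    moreover obtain f df I where t: "t = (f, df, I)" by (cases t) auto
    ultimately have tL: "(f, df, I) \<in> set L" by simp
    note I = L[OF tL]
    have 1: "wedge_cov (\<lambda>a. \<Sum>(c, j)\<leftarrow>df. c * b j x a) k \<psi> v = (\<Sum>(c, j)\<leftarrow>df. c * wedge_cov (b j x) k \<psi> v)" for \<psi>
      by (induction df) (auto simp: wedge_cov_lin)
    have 2: "ext_d_eucl k (\<lambda>z. ?W z I) x v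
        = (\<Sum>(c, J)\<leftarrow>diff_monomial D I. c * ?W x J v)"
    proof -
      have A: "i \<in> A" if "i \<in> set I" for i using that I by blast
      have "k = length I" using I by simp
      then show ?thesis
        using ext_d_eucl_wedge_list[where I = I and b = b and x = x and D = D and v = v, OF diff[OF A] D[OF A]] by simp
    qed
    show "ext_d_eucl k (?\<psi> t) x v = (case t of (f, df, I) \<Rightarrow>
        (\<Sum>(c, j)\<leftarrow>df. c * ?W x (j # I) v)
        + f x * (\<Sum>(c, J)\<leftarrow>diff_monomial D I. c * ?W x J v))"
      using ext_d_eucl_cmult[OF conjunct2[OF conjunct2[OF I]] diffI[OF tL], where k = k and v = v] I
      by (simp add: t 1 2)
  qed
  finally show ?thesis by (simp add: case_prod_unfold)
qed

section \<open>The Cayley form and its closedness from structure equations at a point\<close>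

text \<open>The monomials of the form \<open>\<Phi>\<close> above in the coframe \<open>\<eta>, \<xi>, \<alpha>, dy, \<kappa>, ds, \<Upsilon>\<^sub>1, \<Upsilon>\<^sub>2\<close>, numbered
  from \<open>0\<close> to \<open>7\<close>.\<close>

definition cayley_terms :: "real \<Rightarrow> real \<Rightarrow> real \<Rightarrow> real \<Rightarrow> (real \<times> nat list) list" where
  "cayley_terms s y u w =
     [(- 1, [0, 1, 2, 3]), (1, [0, 1, 4, 5]), (- (u * w * (inverse s * inverse y)), [0, 1, 6, 7]),
      (y, [0, 2, 4, 6]), (y * w, [0, 2, 5, 7]), (- (y * u), [0, 3, 4, 7]), (y * u * w, [0, 3, 5, 6]),
      (- ((y * s) * (y * s)), [2, 3, 4, 5]), (y * s * u * w, [2, 3, 6, 7]), (- (y * s * u * w), [4, 5, 6, 7]),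
      (s, [1, 2, 4, 7]), (- (s * w), [1, 2, 5, 6]), (s * u, [1, 3, 4, 6]), (s * u * w, [1, 3, 5, 7])]"

definition cayley_form :: "real \<Rightarrow> real \<Rightarrow> real \<Rightarrow> real \<Rightarrow> (nat \<Rightarrow> 'e \<Rightarrow> real) \<Rightarrow> (nat \<Rightarrow> 'e) \<Rightarrow> real" where
  "cayley_form s y u w b v = (\<Sum>(c, I)\<leftarrow>cayley_terms s y u w. c * wedge_list (map b I) v)"

text \<open>The differentials of the coframe, for \<open>du = c\<^sub>1 \<Upsilon>\<^sub>1 + c\<^sub>2 \<Upsilon>\<^sub>2 + u' dy\<close> and
  \<open>dw = e\<^sub>1 \<Upsilon>\<^sub>1 + e\<^sub>2 \<Upsilon>\<^sub>2 + w' ds\<close>, hence \<open>d\<^sup>c u = c\<^sub>1 \<Upsilon>\<^sub>2 - c\<^sub>2 \<Upsilon>\<^sub>1\<close> and \<open>d\<^sup>c w = e\<^sub>1 \<Upsilon>\<^sub>2 - e\<^sub>2 \<Upsilon>\<^sub>1\<close> on the curve.\<close>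

definition structure_terms ::
  "real \<Rightarrow> real \<Rightarrow> real \<Rightarrow> real \<Rightarrow> real \<Rightarrow> real \<Rightarrow> real \<Rightarrow> real \<Rightarrow> real \<Rightarrow> real \<Rightarrow> nat \<Rightarrow> (real \<times> nat \<times> nat) list" where
  "structure_terms s y u w c1 c2 u' e1 e2 w' = (\<lambda>i. [])(0 := [(1, 2, 7), (u, 3, 6)], 1 := [(1, 6, 4), (w, 7, 5)],
     2 := [(- c1, 7, 3), (c2, 6, 3), (- (w / s) * (u' / y - u / y\<^sup>2), 6, 7)],
     4 := [(e1, 7, 5), (- e2, 6, 5), ((u / y) * (w' / s - w / s\<^sup>2), 6, 7)])"

text \<open>The differentials of u and w at \<open>x\<close> enter through the free constants p, q,
  u', p', q', w'. Once all fivefold products are sorted, the claim is a polynomial identity in these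
  constants, in s, y, u, w and in the inverses of s and y.\<close>

lemma cayley_form_closed:
  fixes b :: "nat \<Rightarrow> 'e::euclidean_space \<Rightarrow> 'e \<Rightarrow> real" and s y u w :: "'e \<Rightarrow> real"
  assumes nz: "s x \<noteq> 0" "y x \<noteq> 0"
    and diff: "\<And>i a. i < 8 \<Longrightarrow> (\<lambda>z. b i z a) differentiable (at x)"
    and ds: "(s has_derivative b 5 x) (at x)"
    and dy: "(y has_derivative b 3 x) (at x)"
    and du: "(u has_derivative (\<lambda>a. p * b 6 x a + q * b 7 x a + u' * b 3 x a)) (at x)"
    and dw: "(w has_derivative (\<lambda>a. p' * b 6 x a + q' * b 7 x a + w' * b 5 x a)) (at x)"
    and D: "D = structure_terms (s x) (y x) (u x) (w x) p q u' p' q' w'"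
    and struct: "\<And>i a a'. i < 8 \<Longrightarrow>
      fderiv (\<lambda>z. b i z a') x a - fderiv (\<lambda>z. b i z a) x a'
      = (\<Sum>(c, p, q)\<leftarrow>D i. c * (b p x a * b q x a' - b p x a' * b q x a))"
  shows "ext_d_eucl 4 (\<lambda>z. cayley_form (s z) (y z) (u z) (w z) (\<lambda>i. b i z)) x v = 0"
proof -
  \<comment> \<open>Separate names for the inverses avoid division: the cancellation becomes
    polynomial modulo s S = 1 and y Y = 1.\<close>
  define S Y where "S = inverse (s x)" and "Y = inverse (y x)"
  have SY: "s x * S = 1" "y x * Y = 1"
    using nz by (auto simp: S_def Y_def)
  have D': "D = (\<lambda>i. [])(0 := [(1, 2, 7), (u x, 3, 6)], 1 := [(1, 6, 4), (w x, 7, 5)],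
      2 := [(- p, 7, 3), (q, 6, 3), (- (w x * S) * (u' * Y - u x * (Y * Y)), 6, 7)],
      4 := [(p', 7, 5), (- q', 6, 5), ((u x * Y) * (w' * S - w x * (S * S)), 6, 7)])"
    by (simp add: D structure_terms_def S_def Y_def divide_inverse power2_eq_square)
  \<comment> \<open>The monomials of \<open>cayley_terms\<close> again. The middle components are
    the differentials of the coefficients, worked out by the product rule from du, dw, dy =
    \<open>b 3\<close> and ds = \<open>b 5\<close>.\<close>
  define L :: "(('e \<Rightarrow> real) \<times> (real \<times> nat) list \<times> nat list) list" where
    "L = [(\<lambda>z. - 1, [], [0, 1, 2, 3]), (\<lambda>z. 1, [], [0, 1, 4, 5]),
      (\<lambda>z. - (u z * w z * (inverse (s z) * inverse (y z))),
        [(- w x * S * Y * p, 6), (- w x * S * Y * q, 7), (- w x * S * Y * u', 3),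
         (- u x * S * Y * p', 6), (- u x * S * Y * q', 7), (- u x * S * Y * w', 5),
         (u x * w x * S * S * Y, 5), (u x * w x * S * Y * Y, 3)], [0, 1, 6, 7]),
      (\<lambda>z. y z, [(1, 3)], [0, 2, 4, 6]),
      (\<lambda>z. y z * w z, [(w x, 3), (y x * p', 6), (y x * q', 7), (y x * w', 5)], [0, 2, 5, 7]),
      (\<lambda>z. - (y z * u z), [(- u x, 3), (- y x * p, 6), (- y x * q, 7), (- y x * u', 3)], [0, 3, 4, 7]),
      (\<lambda>z. y z * u z * w z, [(u x * w x, 3), (y x * w x * p, 6), (y x * w x * q, 7), (y x * w x * u', 3),
         (y x * u x * p', 6), (y x * u x * q', 7), (y x * u x * w', 5)], [0, 3, 5, 6]),
      (\<lambda>z. - ((y z * s z) * (y z * s z)), [(- 2 * y x * s x * s x, 3), (- 2 * y x * y x * s x, 5)], [2, 3, 4, 5]),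
      (\<lambda>z. y z * s z * u z * w z, [(s x * u x * w x, 3), (y x * u x * w x, 5),
         (y x * s x * w x * p, 6), (y x * s x * w x * q, 7), (y x * s x * w x * u', 3),
         (y x * s x * u x * p', 6), (y x * s x * u x * q', 7), (y x * s x * u x * w', 5)], [2, 3, 6, 7]),
      (\<lambda>z. - (y z * s z * u z * w z), [(- s x * u x * w x, 3), (- y x * u x * w x, 5),
         (- y x * s x * w x * p, 6), (- y x * s x * w x * q, 7), (- y x * s x * w x * u', 3),
         (- y x * s x * u x * p', 6), (- y x * s x * u x * q', 7), (- y x * s x * u x * w', 5)], [4, 5, 6, 7]),
      (\<lambda>z. s z, [(1, 5)], [1, 2, 4, 7]),
      (\<lambda>z. - (s z * w z), [(- w x, 5), (- s x * p', 6), (- s x * q', 7), (- s x * w', 5)], [1, 2, 5, 6]),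
      (\<lambda>z. s z * u z, [(u x, 5), (s x * p, 6), (s x * q, 7), (s x * u', 3)], [1, 3, 4, 6]),
      (\<lambda>z. s z * u z * w z, [(u x * w x, 5), (s x * w x * p, 6), (s x * w x * q, 7), (s x * w x * u', 3),
         (s x * u x * p', 6), (s x * u x * q', 7), (s x * u x * w', 5)], [1, 3, 5, 7])]"
  define V where "V = (\<lambda>i j k l m. wedge_list (map (\<lambda>i. b i x) [i, j, k, l, m]) v)"
  have V: "wedge_list [b i x, b j x, b k x, b l x, b m x] v = V i j k l m" for i j k l m
    by (simp add: V_def)
  \<comment> \<open>Adjacent transpositions sort each product; the strict inequalities orient the
    rewriting so that it terminates.\<close>
  have swap: "i > j \<Longrightarrow> V i j k l m = - V j i k l m" "j > k \<Longrightarrow> V i j k l m = - V i k j l m"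
    "k > l \<Longrightarrow> V i j k l m = - V i j l k m" "l > m \<Longrightarrow> V i j k l m = - V i j k m l" for i j k l m
    using wedge_list_swap[of "[]" "b i x" "b j x" "[b k x, b l x, b m x]" v]
      wedge_list_swap[of "[b i x]" "b j x" "b k x" "[b l x, b m x]" v]
      wedge_list_swap[of "[b i x, b j x]" "b k x" "b l x" "[b m x]" v]
      wedge_list_swap[of "[b i x, b j x, b k x]" "b l x" "b m x" "[]" v]
    by (simp_all add: V_def del: wedge_list.simps)
  have same: "V i i k l m = 0" "V i k k l m = 0" "V i k l l m = 0" "V i k l m m = 0" for i k l m
    using wedge_list_same[of "[]" "b i x" "[b k x, b l x, b m x]" v] wedge_list_same[of "[b i x]" "b k x" "[b l x, b m x]" v]
      wedge_list_same[of "[b i x, b k x]" "b l x" "[b m x]" v] wedge_list_same[of "[b i x, b k x, b l x]" "b m x" "[]" v]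
    by (simp_all add: V_def del: wedge_list.simps)
  have "\<forall>(f, df, I)\<in>set L. length I = 4 \<and> set I \<subseteq> {..<8} \<and>
      (f has_derivative (\<lambda>a. \<Sum>(c, j)\<leftarrow>df. c * b j x a)) (at x)"
    unfolding L_def list.set ball_simps prod.case
    by (intro conjI TrueI;
        (simp; fail | (rule has_derivative_eq_rhs, (rule ds dy du dw nz derivative_intros)+,
           simp add: S_def[symmetric] Y_def[symmetric] algebra_simps)))
  then have L: "length I = 4 \<and> set I \<subseteq> {..<8} \<and>
      (f has_derivative (\<lambda>a. \<Sum>(c, j)\<leftarrow>df. c * b j x a)) (at x)" if "(f, df, I) \<in> set L" for f df I
    using that by blast
  \<comment> \<open>In the differential of the multiple of \<alpha> \<and> dy \<and> \<kappa> \<and>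
    ds, the forms d\<alpha> and d\<kappa> contribute the derivatives of uw/(sy). With the inverses
    cleared, these terms can cancel against those from d(syuw), d\<eta> and d\<xi>.\<close>
  have cancel: "y x * s x * (y x * s x) * (u x * Y * (w' * S - w x * (S * S)) * a - w x * S * (u' * Y - u x * (Y * Y)) * c)
      = u x * (y x * s x * w' - y x * w x) * a - w x * (y x * s x * u' - s x * u x) * c" for a c
    using SY by algebra
  have "ext_d_eucl 4 (\<lambda>z v. \<Sum>(f, df, I)\<leftarrow>L. f z * wedge_list (map (\<lambda>i. b i z) I) v) x v
    = (\<Sum>(f, df, I)\<leftarrow>L. (\<Sum>(c, j)\<leftarrow>df. c * wedge_list (map (\<lambda>i. b i x) (j # I)) v)
        + f x * (\<Sum>(c, J)\<leftarrow>diff_monomial D I. c * wedge_list (map (\<lambda>i. b i x) J) v))"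
    by (rule ext_d_eucl_combination[where A = "{..<8}"]) (use diff struct L in auto)
  also have "\<dots> = 0"
    unfolding L_def D'
    by (simp add: V swap same cancel del: wedge_list.simps)
       (simp add: algebra_simps)
  also have "(\<lambda>z v. \<Sum>(f, df, I)\<leftarrow>L. f z * wedge_list (map (\<lambda>i. b i z) I) v)
      = (\<lambda>z. cayley_form (s z) (y z) (u z) (w z) (\<lambda>i. b i z))"
    by (simp add: L_def cayley_form_def cayley_terms_def fun_eq_iff del: wedge_list.simps)
  finally show ?thesis .
qed

section \<open>Smooth maps\<close>

text \<open>Near \<open>x\<close> both functions admit the same derivatives, so the choice made by
  \<open>frechet_derivative\<close> is the same, whether or not a derivative exists.\<close>

lemma frechet_derivative_cong:
  assumes "open S" "x \<in> S" "\<And>z. z \<in> S \<Longrightarrow> f z = g z"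
  shows "fderiv f x = fderiv g x" "f differentiable (at x) \<longleftrightarrow> g differentiable (at x)"
proof -
  have "(f has_derivative f') (at x) \<longleftrightarrow> (g has_derivative f') (at x)" for f'
    using has_derivative_transform_within_open[of f f' x UNIV S g]
      has_derivative_transform_within_open[of g f' x UNIV S f] assms by auto
  then show "fderiv f x = fderiv g x" "f differentiable (at x) \<longleftrightarrow> g differentiable (at x)"
    by (simp_all add: frechet_derivative_def differentiable_def)
qed

lemma frechet_derivative_eq:
  "(f has_derivative f') (at x) \<Longrightarrow> fderiv f x = f'"
  by (rule frechet_derivative_at[symmetric])

lemma Ck_on_cong:
  assumes "open S" "\<And>x. x \<in> S \<Longrightarrow> f x = g x" "Ck_on k S f"
  shows "Ck_on k S g"
  using assms
proof (induction k arbitrary: f g)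
  case 0
  then show ?case by (auto cong: continuous_on_cong)
next
  case (Suc k)
  have "g differentiable (at x)" "fderiv f x = fderiv g x" if "x \<in> S" for x
    using frechet_derivative_cong[OF Suc.prems(1) that, of f g] Suc.prems that by auto
  moreover have "Ck_on k S (\<lambda>x. fderiv g x v)" for v
    by (rule Suc.IH[of "\<lambda>x. fderiv f x v"]) (use Suc.prems calculation in auto)
  ultimately show ?case by simp
qed

lemma Ck_on_subset: "Ck_on k S f \<Longrightarrow> T \<subseteq> S \<Longrightarrow> Ck_on k T f"
  by (induction k arbitrary: f) (auto intro: continuous_on_subset)

lemma Ck_on_local:
  assumes "\<And>x. x \<in> S \<Longrightarrow> \<exists>T. open T \<and> x \<in> T \<and> Ck_on k T f"
  shows "Ck_on k S f"
  using assms
proof (induction k arbitrary: f)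
  case 0
  then have "continuous (at x) f" if "x \<in> S" for x
    using that continuous_on_eq_continuous_at by fastforce
  then show ?case by (simp add: continuous_at_imp_continuous_on)
next
  case (Suc k)
  show ?case
  proof (simp, intro conjI ballI allI)
    fix x assume "x \<in> S"
    then show "f differentiable (at x)" using Suc.prems by force
  next
    fix v
    show "Ck_on k S (\<lambda>x. fderiv f x v)"
      by (rule Suc.IH) (use Suc.prems in force)
  qed
qed

lemma Ck_on_Suc_imp: "Ck_on (Suc k) S f \<Longrightarrow> Ck_on k S f"
proof (induction k arbitrary: f)
  case 0
  then show ?case
    by (auto intro!: continuous_at_imp_continuous_on differentiable_imp_continuous_within)
next
  case (Suc k)
  then have "\<forall>v. Ck_on (Suc k) S (\<lambda>x. fderiv f x v)" "\<forall>x\<in>S. f differentiable (at x)"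
    by simp_all
  with Suc.IH show ?case by simp
qed

lemma Ck_on_const [intro]: "Ck_on k S (\<lambda>x. c)"
  by (induction k arbitrary: c) simp_all

lemma Ck_on_linear:
  fixes f :: "'a::euclidean_space \<Rightarrow> 'b::real_normed_vector"
  assumes "linear f" shows "Ck_on k S f"
proof (cases k)
  case 0
  then show ?thesis using assms by (simp add: linear_continuous_on linear_conv_bounded_linear)
next
  case (Suc k')
  have "(f has_derivative f) (at x)" for x
    using assms by (simp add: linear_conv_bounded_linear bounded_linear_imp_has_derivative)
  from this frechet_derivative_eq[OF this] show ?thesis
    using Suc by (auto simp: differentiable_def)
qed

lemma Ck_on_add:
  assumes "open S" "Ck_on k S f" "Ck_on k S g"
  shows "Ck_on k S (\<lambda>x. f x + g x)"
  using assms(2,3)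
proof (induction k arbitrary: f g)
  case (Suc k)
  have D: "((\<lambda>x. f x + g x) has_derivative (\<lambda>v. fderiv f x v + fderiv g x v)) (at x)"
    if "x \<in> S" for x
    using Suc.prems that by (intro has_derivative_add) (simp_all add: frechet_derivative_works)
  have "Ck_on k S (\<lambda>x. fderiv (\<lambda>x. f x + g x) x v)" for v
    by (rule Ck_on_cong[OF assms(1) _ Suc.IH[of "\<lambda>x. fderiv f x v" "\<lambda>x. fderiv g x v"]])
       (use Suc.prems in \<open>auto simp: frechet_derivative_eq[OF D]\<close>)
  then show ?case using D by (auto simp: differentiable_def)
qed (auto intro: continuous_on_add)

lemma Ck_on_bilinear:
  assumes "open S" "bounded_bilinear bil" "Ck_on k S f" "Ck_on k S g"
  shows "Ck_on k S (\<lambda>x. bil (f x) (g x))"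
  using assms(3,4)
proof (induction k arbitrary: f g)
  case 0
  then show ?case using bounded_bilinear.continuous_on[OF assms(2)] by auto
next
  case (Suc k)
  have D: "((\<lambda>x. bil (f x) (g x)) has_derivative
      (\<lambda>v. bil (f x) (fderiv g x v) + bil (fderiv f x v) (g x))) (at x)"
    if "x \<in> S" for x
    using Suc.prems that
    by (intro bounded_bilinear.FDERIV[OF assms(2)]) (simp_all add: frechet_derivative_works)
  \<comment> \<open>In each term of the Leibniz rule one factor is differentiated; the regularity of
    the other has to be lowered from \<open>Suc k\<close> to \<open>k\<close>.\<close>
  have k: "Ck_on k S f" "Ck_on k S g"
    using Suc.prems Ck_on_Suc_imp by blast+
  have "Ck_on k S (\<lambda>x. fderiv (\<lambda>x. bil (f x) (g x)) x v)" for v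
    by (rule Ck_on_cong[OF assms(1) _ Ck_on_add[OF assms(1)
          Suc.IH[OF k(1), of "\<lambda>x. fderiv g x v"]
          Suc.IH[OF _ k(2), of "\<lambda>x. fderiv f x v"]]])
       (use Suc.prems in \<open>auto simp: frechet_derivative_eq[OF D]\<close>)
  then show ?case using D by (auto simp: differentiable_def)
qed

lemma Ck_on_sum:
  assumes "open S" "\<And>i. i \<in> A \<Longrightarrow> Ck_on k S (f i)"
  shows "Ck_on k S (\<lambda>x. \<Sum>i\<in>A. f i x)"
  using assms(2) by (induction A rule: infinite_finite_induct) (auto intro: Ck_on_add[OF assms(1)])

lemma linear_basis_expansion:
  fixes L :: "'a::euclidean_space \<Rightarrow> 'b::real_vector"
  assumes "linear L"
  shows "L v = (\<Sum>b\<in>Basis. (v \<bullet> b) *\<^sub>R L b)"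
proof -
  have "L v = L (\<Sum>b\<in>Basis. (v \<bullet> b) *\<^sub>R b)" by (simp add: euclidean_representation)
  then show ?thesis using assms by (simp add: linear_sum linear_cmul)
qed

text \<open>The induction hypothesis speaks of derivatives of \<open>f\<close> in fixed directions,
  but the chain rule differentiates \<open>f\<close> in the moving direction g'(v). Expanding that
  direction in \<open>Basis\<close> separates the two.\<close>

lemma Ck_on_compose:
  fixes f :: "'b::euclidean_space \<Rightarrow> 'c::real_normed_vector" and g :: "'a::euclidean_space \<Rightarrow> 'b"
  assumes "open S" "open T" "Ck_on k T f" "Ck_on k S g" "g ` S \<subseteq> T"
  shows "Ck_on k S (\<lambda>x. f (g x))"
  using assms(3,4)
proof (induction k arbitrary: f)
  case 0
  then show ?case using assms(5) by (auto intro: continuous_on_compose2)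
next
  case (Suc k)
  have D: "((\<lambda>x. f (g x)) has_derivative (\<lambda>v. fderiv f (g x) (fderiv g x v))) (at x)"
    if "x \<in> S" for x
    using Suc.prems that assms(5) has_derivative_compose[of g "fderiv g x" x UNIV f]
    by (auto simp: frechet_derivative_works)
  have D': "fderiv (\<lambda>x. f (g x)) x v
      = (\<Sum>b\<in>Basis. (fderiv g x v \<bullet> b) *\<^sub>R fderiv f (g x) b)"
    if "x \<in> S" for x v
  proof -
    have "linear (fderiv f (g x))"
      using Suc.prems(1) that assms(5) by (intro linear_frechet_derivative) auto
    then show ?thesis using D[OF that] linear_basis_expansion by (auto simp: frechet_derivative_eq)
  qed
  have k: "Ck_on k S g" using Suc.prems Ck_on_Suc_imp by blast
  have "Ck_on k S (\<lambda>x. fderiv (\<lambda>x. f (g x)) x v)" for v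
  proof (rule Ck_on_cong[OF assms(1)])
    show "Ck_on k S (\<lambda>x. \<Sum>b\<in>Basis. (fderiv g x v \<bullet> b) *\<^sub>R fderiv f (g x) b)"
    proof (intro Ck_on_sum[OF assms(1)] Ck_on_bilinear[OF assms(1) bounded_bilinear_scaleR])
      fix b :: 'b
      show "Ck_on k S (\<lambda>x. fderiv g x v \<bullet> b)"
        using Suc.prems by (intro Ck_on_bilinear[OF assms(1) bounded_bilinear_inner]) auto
      show "Ck_on k S (\<lambda>x. fderiv f (g x) b)"
        using Suc.prems k by (intro Suc.IH) auto
    qed
  qed (simp add: D')
  then show ?case using D by (auto simp: differentiable_def)
qed

lemma Ck_on_linear_comp:
  fixes L :: "'b::euclidean_space \<Rightarrow> 'c::real_normed_vector" and f :: "'a::euclidean_space \<Rightarrow> 'b"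
  assumes "open S" "linear L" "Ck_on k S f"
  shows "Ck_on k S (\<lambda>x. L (f x))"
  using Ck_on_compose[OF assms(1) open_UNIV Ck_on_linear[OF assms(2)] assms(3)] by simp

text \<open>The derivative -v/x^2 is again built from products of \<open>inverse\<close> with
  itself, so the induction closes.\<close>

lemma Ck_on_inverse: "Ck_on k (- {0}) (inverse :: real \<Rightarrow> real)"
proof (induction k)
  case 0
  then show ?case by (auto intro: continuous_intros)
next
  case (Suc k)
  have D: "(inverse has_derivative (\<lambda>v. - (inverse x * v * inverse x))) (at x)" if "x \<noteq> 0" for x :: real
    using that by (rule has_derivative_inverse')
  have "Ck_on k (- {0}) (\<lambda>x. fderiv inverse x (v::real))" for v
  proof (rule Ck_on_cong)
    have "linear (\<lambda>x. - v * x :: real)" by (intro linearI) (auto simp: algebra_simps)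
    from Ck_on_linear_comp[OF _ this Ck_on_bilinear[OF _ bounded_bilinear_mult Suc Suc]]
    show "Ck_on k (- {0}) (\<lambda>x. - v * (inverse x * inverse x))" by auto
  qed (auto simp: frechet_derivative_eq[OF D])
  then show ?case using D by (auto simp: differentiable_def)
qed

lemma smooth_on_cong: "open S \<Longrightarrow> (\<And>x. x \<in> S \<Longrightarrow> f x = g x) \<Longrightarrow> smooth_on S f \<Longrightarrow> smooth_on S g"
  unfolding smooth_on_def using Ck_on_cong by blast

lemma smooth_on_subset: "smooth_on S f \<Longrightarrow> T \<subseteq> S \<Longrightarrow> smooth_on T f"
  unfolding smooth_on_def using Ck_on_subset by blast

lemma smooth_on_local:
  "(\<And>x. x \<in> S \<Longrightarrow> \<exists>T. open T \<and> x \<in> T \<and> smooth_on T f) \<Longrightarrow> smooth_on S f"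
  unfolding smooth_on_def by (meson Ck_on_local)

lemma smooth_on_const: "smooth_on S (\<lambda>x. c)"
  by (simp add: smooth_on_def Ck_on_const)

lemma smooth_on_linear:
  fixes f :: "'a::euclidean_space \<Rightarrow> 'b::real_normed_vector"
  shows "linear f \<Longrightarrow> smooth_on S f"
  by (simp add: smooth_on_def Ck_on_linear)

lemma smooth_on_add: "open S \<Longrightarrow> smooth_on S f \<Longrightarrow> smooth_on S g \<Longrightarrow> smooth_on S (\<lambda>x. f x + g x)"
  by (simp add: smooth_on_def Ck_on_add)

lemma smooth_on_mult:
  fixes f g :: "'a::euclidean_space \<Rightarrow> real"
  shows "open S \<Longrightarrow> smooth_on S f \<Longrightarrow> smooth_on S g \<Longrightarrow> smooth_on S (\<lambda>x. f x * g x)"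
  by (simp add: smooth_on_def Ck_on_bilinear[OF _ bounded_bilinear_mult])

lemma smooth_on_sum:
  "open S \<Longrightarrow> (\<And>i. i \<in> A \<Longrightarrow> smooth_on S (f i)) \<Longrightarrow> smooth_on S (\<lambda>x. \<Sum>i\<in>A. f i x)"
  by (simp add: smooth_on_def Ck_on_sum)

lemma smooth_on_linear_comp:
  fixes L :: "'b::euclidean_space \<Rightarrow> 'c::real_normed_vector" and f :: "'a::euclidean_space \<Rightarrow> 'b"
  shows "open S \<Longrightarrow> linear L \<Longrightarrow> smooth_on S f \<Longrightarrow> smooth_on S (\<lambda>x. L (f x))"
  by (simp add: smooth_on_def Ck_on_linear_comp)

lemma smooth_on_compose:
  fixes f :: "'b::euclidean_space \<Rightarrow> 'c::real_normed_vector" and g :: "'a::euclidean_space \<Rightarrow> 'b"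
  shows "open S \<Longrightarrow> open T \<Longrightarrow> smooth_on T f \<Longrightarrow> smooth_on S g \<Longrightarrow> g ` S \<subseteq> T \<Longrightarrow> smooth_on S (\<lambda>x. f (g x))"
  using Ck_on_compose unfolding smooth_on_def by blast

lemma smooth_on_Pair:
  fixes f :: "'a::euclidean_space \<Rightarrow> 'b::euclidean_space" and g :: "'a \<Rightarrow> 'c::euclidean_space"
  assumes "open S" "smooth_on S f" "smooth_on S g"
  shows "smooth_on S (\<lambda>x. (f x, g x))"
proof -
  have "linear (\<lambda>a. (a, 0) :: 'b \<times> 'c)" "linear (\<lambda>a. (0, a) :: 'b \<times> 'c)"
    by (auto intro: linearI)
  from smooth_on_add[OF assms(1) smooth_on_linear_comp[OF assms(1) this(1) assms(2)]
      smooth_on_linear_comp[OF assms(1) this(2) assms(3)]]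
  show ?thesis by simp
qed

lemma smooth_on_inverse:
  fixes f :: "'a::euclidean_space \<Rightarrow> real"
  assumes "open S" "smooth_on S f" "\<And>x. x \<in> S \<Longrightarrow> f x \<noteq> 0"
  shows "smooth_on S (\<lambda>x. inverse (f x))"
  by (rule smooth_on_compose[where T = "- {0}"]) (use assms Ck_on_inverse in \<open>auto simp: smooth_on_def\<close>)

lemma smooth_on_differentiable: "smooth_on S f \<Longrightarrow> x \<in> S \<Longrightarrow> f differentiable (at x)"
  unfolding smooth_on_def by (metis Ck_on.simps(2))

lemma smooth_on_has_derivative:
  "smooth_on S f \<Longrightarrow> x \<in> S \<Longrightarrow> (f has_derivative fderiv f x) (at x)"
  using smooth_on_differentiable frechet_derivative_works by blast

lemma smooth_on_frechet_derivative: "smooth_on S f \<Longrightarrow> smooth_on S (\<lambda>x. fderiv f x v)"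
  unfolding smooth_on_def by (metis Ck_on.simps(2))

lemma frechet_derivative_compose:
  assumes "g differentiable (at x)" "f differentiable (at (g x))"
  shows "(\<lambda>z. f (g z)) differentiable (at x)"
    "fderiv (\<lambda>z. f (g z)) x v = fderiv f (g x) (fderiv g x v)"
proof -
  have "((\<lambda>x. f (g x)) has_derivative (\<lambda>v. fderiv f (g x) (fderiv g x v))) (at x)"
    using assms has_derivative_compose[of g "fderiv g x" x UNIV f]
    by (auto simp: frechet_derivative_works)
  then show "(\<lambda>z. f (g z)) differentiable (at x)"
    "fderiv (\<lambda>z. f (g z)) x v = fderiv f (g x) (fderiv g x v)"
    by (auto simp: differentiable_def frechet_derivative_eq)
qed

text \<open>The induction runs over all holomorphic functions at once, because the complex
  derivative is again holomorphic.\<close>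

lemma holomorphic_on_Ck_on:
  assumes "open S" "f holomorphic_on S" shows "Ck_on k S f"
  using assms(2)
proof (induction k arbitrary: f)
  case 0
  then show ?case by (simp add: holomorphic_on_imp_continuous_on)
next
  case (Suc k)
  have D: "(f has_derivative (\<lambda>v. deriv f x * v)) (at x)" if "x \<in> S" for x
    using holomorphic_derivI[OF Suc.prems assms(1) that] by (simp add: has_field_derivative_def)
  have "Ck_on k S (\<lambda>x. fderiv f x v)" for v
  proof (rule Ck_on_cong[OF assms(1)])
    have "linear (\<lambda>z. z * v)" by (intro linearI) (auto simp: algebra_simps)
    from Ck_on_linear_comp[OF assms(1) this Suc.IH[OF holomorphic_deriv[OF Suc.prems assms(1)]]]
    show "Ck_on k S (\<lambda>x. deriv f x * v)" .
  qed (simp add: frechet_derivative_eq[OF D])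
  then show ?case using D by (auto simp: differentiable_def)
qed

lemma holomorphic_on_smooth_on: "open S \<Longrightarrow> f holomorphic_on S \<Longrightarrow> smooth_on S f"
  by (simp add: smooth_on_def holomorphic_on_Ck_on)

section \<open>Symmetry of second derivatives\<close>

lemma has_real_derivative_line:
  fixes f :: "'e::real_normed_vector \<Rightarrow> real"
  assumes "f differentiable (at (a + t *\<^sub>R v))"
  shows "((\<lambda>t. f (a + t *\<^sub>R v)) has_real_derivative fderiv f (a + t *\<^sub>R v) v) (at t)"
proof -
  have "((\<lambda>t. a + t *\<^sub>R v) has_derivative (\<lambda>h. h *\<^sub>R v)) (at t)"
    by (auto intro!: derivative_eq_intros)
  from has_derivative_compose[OF this assms[unfolded frechet_derivative_works]]
  have "((\<lambda>t. f (a + t *\<^sub>R v)) has_derivative (\<lambda>h. fderiv f (a + t *\<^sub>R v) (h *\<^sub>R v))) (at t)" .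
  moreover have "fderiv f (a + t *\<^sub>R v) (h *\<^sub>R v) = fderiv f (a + t *\<^sub>R v) v * h" for h
    using linear_cmul[OF linear_frechet_derivative[OF assms]] by simp
  ultimately show ?thesis by (simp add: has_field_derivative_def)
qed

text \<open>The mean value theorem is applied to the second difference along v and then to the
  resulting difference along w. The intermediate point lies in the parallelogram spanned by h v and
  h w, which gives the bound.\<close>

lemma second_difference_mvt:
  fixes f :: "'e::euclidean_space \<Rightarrow> real"
  assumes S: "Ck_on 2 S f" "ball x r \<subseteq> S" and h: "h > 0" "h * (norm v + norm w) < r"
  shows "\<exists>z. norm (z - x) \<le> h * (norm v + norm w) \<and>
    f (x + h *\<^sub>R v + h *\<^sub>R w) - f (x + h *\<^sub>R v) - f (x + h *\<^sub>R w) + f x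
    = h * h * fderiv (\<lambda>z. fderiv f z v) z w"
proof -
  have n: "norm (a *\<^sub>R v + b *\<^sub>R w) \<le> h * (norm v + norm w)" if "0 \<le> a" "a \<le> h" "0 \<le> b" "b \<le> h" for a b
    using that norm_triangle_ineq[of "a *\<^sub>R v" "b *\<^sub>R w"]
      mult_right_mono[of a h "norm v"] mult_right_mono[of b h "norm w"] by (simp add: distrib_left)
  have in_S: "x + (a *\<^sub>R v + b *\<^sub>R w) \<in> S" if "0 \<le> a" "a \<le> h" "0 \<le> b" "b \<le> h" for a b
  proof (rule subsetD[OF S(2)])
    have "dist (x + (a *\<^sub>R v + b *\<^sub>R w)) x = norm (a *\<^sub>R v + b *\<^sub>R w)"
      unfolding dist_norm add_diff_cancel_left' ..
    then show "x + (a *\<^sub>R v + b *\<^sub>R w) \<in> ball x r"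
      using n[OF that] h by (simp only: mem_ball dist_commute[of x])
  qed
  have f1: "f differentiable (at z)" "(\<lambda>z. fderiv f z v) differentiable (at z)" if "z \<in> S" for z
    using S(1) that by (simp_all add: numeral_2_eq_2)
  let ?\<phi> = "\<lambda>s. f ((x + h *\<^sub>R w) + s *\<^sub>R v) - f (x + s *\<^sub>R v)"
  have "\<exists>\<xi>>0. \<xi> < h \<and> ?\<phi> h - ?\<phi> 0 = (h - 0) *
      (fderiv f ((x + h *\<^sub>R w) + \<xi> *\<^sub>R v) v - fderiv f (x + \<xi> *\<^sub>R v) v)"
  proof (rule MVT2)
    fix s assume "0 \<le> s" "s \<le> h"
    then have "x + h *\<^sub>R w + s *\<^sub>R v \<in> S" "x + s *\<^sub>R v \<in> S"
      using in_S[of s h] in_S[of s 0] h by (simp_all add: algebra_simps)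
    then show "(?\<phi> has_real_derivative (fderiv f ((x + h *\<^sub>R w) + s *\<^sub>R v) v
        - fderiv f (x + s *\<^sub>R v) v)) (at s)"
      by (intro DERIV_diff has_real_derivative_line f1)
  qed (use h in auto)
  then obtain \<xi> where \<xi>: "0 < \<xi>" "\<xi> < h" "?\<phi> h - ?\<phi> 0 = h *
      (fderiv f ((x + h *\<^sub>R w) + \<xi> *\<^sub>R v) v - fderiv f (x + \<xi> *\<^sub>R v) v)"
    by auto
  let ?\<psi> = "\<lambda>t. fderiv f ((x + \<xi> *\<^sub>R v) + t *\<^sub>R w) v"
  let ?F = "\<lambda>z. fderiv (\<lambda>z. fderiv f z v) z w"
  have "\<exists>\<eta>>0. \<eta> < h \<and> ?\<psi> h - ?\<psi> 0 = (h - 0) * ?F ((x + \<xi> *\<^sub>R v) + \<eta> *\<^sub>R w)"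
  proof (rule MVT2)
    fix t assume "0 \<le> t" "t \<le> h"
    then have "x + \<xi> *\<^sub>R v + t *\<^sub>R w \<in> S"
      using in_S[of \<xi> t] \<xi> by (simp add: algebra_simps)
    then show "(?\<psi> has_real_derivative ?F ((x + \<xi> *\<^sub>R v) + t *\<^sub>R w)) (at t)"
      by (intro has_real_derivative_line f1)
  qed (use h in auto)
  then obtain \<eta> where \<eta>: "0 < \<eta>" "\<eta> < h" "?\<psi> h - ?\<psi> 0 = h * ?F ((x + \<xi> *\<^sub>R v) + \<eta> *\<^sub>R w)"
    by auto
  have "f (x + h *\<^sub>R v + h *\<^sub>R w) - f (x + h *\<^sub>R v) - f (x + h *\<^sub>R w) + f x = ?\<phi> h - ?\<phi> 0"
    by (simp add: algebra_simps)
  also have "\<dots> = h * (?\<psi> h - ?\<psi> 0)"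
    unfolding \<xi>(3) by (simp add: add_ac)
  also have "\<dots> = h * h * ?F (x + \<xi> *\<^sub>R v + \<eta> *\<^sub>R w)"
    unfolding \<eta>(3) by simp
  finally show ?thesis
    using n[of \<xi> \<eta>] \<xi>(1,2) \<eta>(1,2) by (intro exI[of _ "x + \<xi> *\<^sub>R v + \<eta> *\<^sub>R w"]) (simp add: add.assoc)
qed

text \<open>The second difference does not see the order of the two directions, so the mixed
  derivatives agree when taken at two suitable points arbitrarily close to \<open>x\<close>;
  continuity does the rest.\<close>

lemma second_derivative_symmetric:
  fixes f :: "'e::euclidean_space \<Rightarrow> real"
  assumes "open S" "Ck_on 2 S f" "x \<in> S"
  shows "fderiv (\<lambda>z. fderiv f z v) x w
    = fderiv (\<lambda>z. fderiv f z w) x v"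
proof (rule ccontr)
  let ?F = "\<lambda>v w z. fderiv (\<lambda>z. fderiv f z v) z w"
  assume ne: "?F v w x \<noteq> ?F w v x"
  \<comment> \<open>Half of the supposed gap: two errors below \<open>e\<close> cannot bridge
    it.\<close>
  define e where "e = \<bar>?F v w x - ?F w v x\<bar> / 2"
  have e: "e > 0" using ne by (simp add: e_def)
  have cont: "continuous_on S (?F v w)" for v w
    using assms(2) by (simp add: numeral_2_eq_2)
  have "\<exists>d>0. \<forall>z. dist z x < d \<longrightarrow> dist (?F v w z) (?F v w x) < e" for v w
  proof -
    have "((?F v w) \<longlongrightarrow> ?F v w x) (at x)"
      using cont[of v w] assms(1,3) by (auto simp: continuous_on_eq_continuous_at intro: isContD)
    from tendstoD[OF this e] obtain d where "d > 0" "\<And>z. z \<noteq> x \<Longrightarrow> dist z x < d \<Longrightarrow> dist (?F v w z) (?F v w x) < e"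
      unfolding eventually_at by blast
    then show ?thesis using e by (metis dist_self)
  qed
  then obtain d1 d2 where d: "d1 > 0" "\<And>z. dist z x < d1 \<Longrightarrow> dist (?F v w z) (?F v w x) < e"
      "d2 > 0" "\<And>z. dist z x < d2 \<Longrightarrow> dist (?F w v z) (?F w v x) < e"
    by metis
  obtain r where r: "r > 0" "ball x r \<subseteq> S" using assms(1,3) openE by blast
  define m where "m = min r (min d1 d2)"
  \<comment> \<open>The summand 1 keeps the denominator positive when both directions are
    zero.\<close>
  define h where "h = m / (2 * (norm v + norm w + 1))"
  have m: "m > 0" using d r by (simp add: m_def)
  have h: "h > 0" using m by (simp add: h_def add_nonneg_pos)
  have "h * (norm v + norm w) \<le> h * (norm v + norm w + 1)" using h by simp
  also have "\<dots> = m / 2" by (simp add: h_def field_simps add_nonneg_eq_0_iff)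
  finally have hm: "h * (norm v + norm w) < m" using m by simp
  from second_difference_mvt[OF assms(2) r(2) h, of v w] hm obtain z where z: "dist z x < m"
    "f (x + h *\<^sub>R v + h *\<^sub>R w) - f (x + h *\<^sub>R v) - f (x + h *\<^sub>R w) + f x = h * h * ?F v w z"
    by (force simp: m_def dist_norm)
  from second_difference_mvt[OF assms(2) r(2) h, of w v] hm obtain z' where z': "dist z' x < m"
    "f (x + h *\<^sub>R w + h *\<^sub>R v) - f (x + h *\<^sub>R w) - f (x + h *\<^sub>R v) + f x = h * h * ?F w v z'"
    by (force simp: m_def dist_norm add.commute)
  have "h * h * ?F v w z = h * h * ?F w v z'"
    using z(2) z'(2) by (simp add: algebra_simps)
  then have "?F v w z = ?F w v z'" using h by simp
  moreover have "dist (?F v w z) (?F v w x) < e" "dist (?F w v z') (?F w v x) < e"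
    using d(2)[of z] d(4)[of z'] z(1) z'(1) by (auto simp: m_def)
  ultimately show False
    unfolding e_def dist_real_def by (simp add: field_simps abs_if split: if_splits)
qed

section \<open>Alternating forms on open sets and the naturality of d in degree one\<close>

lemma alt_form_1_eq: "alt_form 1 \<phi> \<Longrightarrow> \<phi> v = \<phi> (\<lambda>_. v 0)"
  unfolding alt_form_def by (metis less_one)

lemma alt_form_1_linear: "alt_form 1 \<phi> \<Longrightarrow> linear (\<lambda>a. \<phi> (\<lambda>_. a))"
proof -
  assume a: "alt_form 1 \<phi>"
  have "linear (\<lambda>a. \<phi> ((\<lambda>_. 0)(0 := a)))"
    using a[unfolded alt_form_def, THEN conjunct2, THEN conjunct1, rule_format, of 0 "\<lambda>_. 0"] by simp
  moreover have "\<phi> ((\<lambda>_. 0)(0 := a)) = \<phi> (\<lambda>_. a)" for a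
    using alt_form_1_eq[OF a, of "(\<lambda>_. 0)(0 := a)"] by simp
  ultimately show ?thesis by simp
qed

lemma alt_form_1I: "(\<And>v. \<phi> v = L (v 0)) \<Longrightarrow> linear L \<Longrightarrow> alt_form 1 \<phi>"
  unfolding alt_form_def by simp

lemma alt_form_linear_comp:
  assumes "alt_form k \<phi>" "linear L"
  shows "alt_form k (\<lambda>v. \<phi> (\<lambda>i. L (v i)))"
proof -
  have upd: "(\<lambda>j. L ((v(i := x)) j)) = (\<lambda>j. L (v j))(i := L x)" for v i x
    by auto
  have "linear (\<lambda>x. \<phi> (\<lambda>j. L ((v(i := x)) j)))" if "i < k" for i v
  proof -
    have "linear (\<lambda>x. \<phi> ((\<lambda>j. L (v j))(i := x)))"
      using assms(1) that unfolding alt_form_def by blast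
    from linear_compose[OF assms(2) this] show ?thesis unfolding upd by (simp add: o_def)
  qed
  moreover have "\<phi> (\<lambda>i. L (v i)) = \<phi> (\<lambda>i. L (w i))" if "\<forall>i<k. v i = w i" for v w
    using assms(1)[unfolded alt_form_def, THEN conjunct1, rule_format, of "\<lambda>i. L (v i)" "\<lambda>i. L (w i)"] that
    by simp
  moreover have "\<phi> (\<lambda>i. L (v i)) = 0" if "i < k" "j < k" "i \<noteq> j" "v i = v j" for i j v
    using assms(1)[unfolded alt_form_def, THEN conjunct2, THEN conjunct2, rule_format, of i j "\<lambda>i. L (v i)"] that
    by simp
  ultimately show ?thesis unfolding alt_form_def by blast
qed

lemma ext_d_eucl_1:
  assumes "open S" "x \<in> S" "\<And>z. z \<in> S \<Longrightarrow> alt_form 1 (\<omega> z)"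
  shows "ext_d_eucl 1 \<omega> x v = fderiv (\<lambda>z. \<omega> z (\<lambda>_. v 1)) x (v 0)
    - fderiv (\<lambda>z. \<omega> z (\<lambda>_. v 0)) x (v 1)"
proof -
  have "fderiv (\<lambda>z. \<omega> z w) x = fderiv (\<lambda>z. \<omega> z (\<lambda>_. w 0)) x" for w
    by (rule frechet_derivative_cong(1)[OF assms(1,2)]) (rule alt_form_1_eq[OF assms(3)])
  from this[of "drop_arg 0 v"] this[of "drop_arg 1 v"]
  show ?thesis by (simp add: ext_d_eucl_drop_arg drop_arg_def)
qed

lemma ext_d_eucl_cong:
  assumes "open S" "x \<in> S" "\<And>z v. z \<in> S \<Longrightarrow> \<omega> z v = \<omega>' z v"
  shows "ext_d_eucl k \<omega> x v = ext_d_eucl k \<omega>' x v"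
proof -
  have "fderiv (\<lambda>z. \<omega> z w) x = fderiv (\<lambda>z. \<omega>' z w) x" for w
    by (rule frechet_derivative_cong(1)[OF assms(1,2)]) (rule assms(3))
  then show ?thesis by (simp add: ext_d_eucl_drop_arg)
qed

text \<open>The second derivatives of \<open>\<tau>\<close> cancel by symmetry.\<close>

lemma ext_d_eucl_1_pullback:
  fixes \<tau> :: "'e::euclidean_space \<Rightarrow> 'f::euclidean_space" and \<omega> :: "('f, 'f, real) form"
  assumes S: "open S" "x \<in> S" and T: "open T" and \<tau>: "smooth_on S \<tau>" "\<tau> ` S \<subseteq> T"
    and alt: "\<And>z. z \<in> T \<Longrightarrow> alt_form 1 (\<omega> z)" and sm: "\<And>v. smooth_on T (\<lambda>z. \<omega> z v)"
  shows "ext_d_eucl 1 (\<lambda>z v. \<omega> (\<tau> z) (\<lambda>i. fderiv \<tau> z (v i))) x v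
    = ext_d_eucl 1 \<omega> (\<tau> x) (\<lambda>i. fderiv \<tau> x (v i))"
proof -
  let ?D = "\<lambda>z. fderiv \<tau> z"
  let ?a = "\<lambda>z b. \<omega> z (\<lambda>_. b)"
  let ?t = "\<lambda>b z. \<tau> z \<bullet> b"
  have \<tau>x: "\<tau> x \<in> T" using \<tau> S by auto
  have lin: "linear (?a z)" if "z \<in> T" for z using alt_form_1_linear[OF alt[OF that]] .
  have linD: "linear (?D z)" if "z \<in> S" for z
    using smooth_on_differentiable[OF \<tau>(1) that] by (rule linear_frechet_derivative)
  have t: "smooth_on S (?t b)" "\<And>z v. z \<in> S \<Longrightarrow> fderiv (?t b) z v = ?D z v \<bullet> b" for b
  proof -
    have l: "linear (\<lambda>y. y \<bullet> b)" by (simp add: bounded_linear.linear bounded_linear_inner_left)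
    from smooth_on_linear_comp[OF S(1) l \<tau>(1)] show "smooth_on S (?t b)" .
    fix z v assume "z \<in> S"
    from has_derivative_inner_left[OF smooth_on_has_derivative[OF \<tau>(1) this], of b]
    show "fderiv (?t b) z v = ?D z v \<bullet> b"
      by (simp add: frechet_derivative_eq)
  qed
  \<comment> \<open>The moving vector D\<tau>(u) is expanded in \<open>Basis\<close>. The sum
    collects the second derivatives of \<tau>; the last term differentiates \<omega> along
    D\<tau>(v) with its argument frozen.\<close>
  have D: "fderiv (\<lambda>z. ?a (\<tau> z) (?D z u)) x v
      = (\<Sum>b\<in>Basis. fderiv (\<lambda>z. fderiv (?t b) z u) x v * ?a (\<tau> x) b)
        + fderiv (\<lambda>z. ?a z (?D x u)) (\<tau> x) (?D x v)" for u v
  proof -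
    have "fderiv (\<lambda>z. ?a (\<tau> z) (?D z u)) x v
      = fderiv (\<lambda>z. \<Sum>b\<in>Basis. fderiv (?t b) z u * ?a (\<tau> z) b) x v"
    proof (subst frechet_derivative_cong(1)[OF S])
      fix z assume z: "z \<in> S"
      then show "?a (\<tau> z) (?D z u) = (\<Sum>b\<in>Basis. fderiv (?t b) z u * ?a (\<tau> z) b)"
        using linear_basis_expansion[OF lin, of "\<tau> z" "?D z u"] \<tau>(2) by (auto simp: t)
    qed simp
    also have "\<dots> = (\<Sum>b\<in>Basis. fderiv (\<lambda>z. fderiv (?t b) z u) x v * ?a (\<tau> x) b
          + fderiv (?t b) x u * fderiv (\<lambda>z. ?a (\<tau> z) b) x v)"
    proof -
      have 1: "(\<lambda>z. fderiv (?t b) z u) differentiable (at x)" for b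
        using smooth_on_differentiable[OF smooth_on_frechet_derivative[OF t(1)] S(2)] .
      have 2: "(\<lambda>z. ?a (\<tau> z) b) differentiable (at x)" for b
        using smooth_on_differentiable[OF smooth_on_compose[OF S(1) T sm \<tau>] S(2)] .
      show ?thesis using 1 2
        by (subst frechet_derivative_sum) (auto intro!: differentiable_mult simp: frechet_derivative_mult)
    qed
    also have "\<dots> = (\<Sum>b\<in>Basis. fderiv (\<lambda>z. fderiv (?t b) z u) x v * ?a (\<tau> x) b)
        + (\<Sum>b\<in>Basis. (?D x u \<bullet> b) * fderiv (\<lambda>z. ?a z b) (\<tau> x) (?D x v))"
    proof -
      have "fderiv (\<lambda>z. ?a (\<tau> z) b) x v = fderiv (\<lambda>z. ?a z b) (\<tau> x) (?D x v)" for b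
        using smooth_on_differentiable[OF \<tau>(1) S(2)] smooth_on_differentiable[OF sm \<tau>x]
        by (rule frechet_derivative_compose)
      then show ?thesis by (simp add: t S sum.distrib)
    qed
    also have "(\<Sum>b\<in>Basis. (?D x u \<bullet> b) * fderiv (\<lambda>z. ?a z b) (\<tau> x) (?D x v))
        = fderiv (\<lambda>z. \<Sum>b\<in>Basis. (?D x u \<bullet> b) * ?a z b) (\<tau> x) (?D x v)"
      using smooth_on_differentiable[OF sm \<tau>x]
      by (subst frechet_derivative_sum) (auto intro!: differentiable_mult simp: frechet_derivative_cmult)
    also have "\<dots> = fderiv (\<lambda>z. ?a z (?D x u)) (\<tau> x) (?D x v)"
      by (subst frechet_derivative_cong(1)[OF T \<tau>x, where g = "\<lambda>z. ?a z (?D x u)"])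
         (use linear_basis_expansion[OF lin, of _ "?D x u"] in auto)
    finally show ?thesis .
  qed
  have sym: "fderiv (\<lambda>z. fderiv (?t b) z u) x v
      = fderiv (\<lambda>z. fderiv (?t b) z v) x u" for b u v
    using t(1) S unfolding smooth_on_def by (intro second_derivative_symmetric) auto
  have "ext_d_eucl 1 (\<lambda>z v. \<omega> (\<tau> z) (\<lambda>i. ?D z (v i))) x v
      = fderiv (\<lambda>z. ?a (\<tau> z) (?D z (v 1))) x (v 0)
        - fderiv (\<lambda>z. ?a (\<tau> z) (?D z (v 0))) x (v 1)"
    using \<tau>(2) by (intro ext_d_eucl_1[OF S] alt_form_linear_comp[OF alt linD]) auto
  also have "\<dots> = ext_d_eucl 1 \<omega> (\<tau> x) (\<lambda>i. ?D x (v i))"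
    using ext_d_eucl_1[OF T \<tau>x alt, where v = "\<lambda>i. ?D x (v i)"] unfolding D sym[of _ "v 1" "v 0"] by simp
  finally show ?thesis .
qed

section \<open>Charts\<close>

abbreviation "img c \<equiv> snd c ` fst c"

abbreviation "coord_map c f d \<equiv> snd d \<circ> f \<circ> param c"

abbreviation "coord_dom c f d \<equiv> snd c ` (fst c \<inter> f -` fst d)"

text \<open>In place of topological manifolds: products need no proof of second countability.\<close>

definition has_charts :: "('a, 'e::euclidean_space) mfd \<Rightarrow> bool" where
  "has_charts M \<longleftrightarrow> (\<Union>c\<in>atlas M. fst c) = points M \<and>
     (\<forall>c\<in>atlas M. openin (mtop M) (fst c) \<and> open (img c) \<and>
        homeomorphic_map (subtopology (mtop M) (fst c)) (top_of_set (img c)) (snd c))"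

definition smooth_atlas :: "('a, 'e::euclidean_space) mfd \<Rightarrow> bool" where
  "smooth_atlas M \<longleftrightarrow> has_charts M \<and>
     (\<forall>c\<in>atlas M. \<forall>d\<in>atlas M. smooth_on (snd c ` (fst c \<inter> fst d)) (snd d \<circ> param c))"

lemma topological_manifold_has_charts: "topological_manifold M \<Longrightarrow> has_charts M"
  by (simp add: topological_manifold_def has_charts_def)

lemma smooth_manifold_smooth_atlas: "smooth_manifold M \<Longrightarrow> smooth_atlas M"
  by (simp add: smooth_manifold_def smooth_atlas_def topological_manifold_has_charts)

lemma has_chartsD:
  assumes "has_charts M" "c \<in> atlas M"
  shows "fst c \<subseteq> points M" "openin (mtop M) (fst c)" "open (img c)" "inj_on (snd c) (fst c)"
    "openin (mtop M) W \<Longrightarrow> open (snd c ` (fst c \<inter> W))"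
proof -
  have c: "openin (mtop M) (fst c)" "open (img c)"
    "homeomorphic_map (subtopology (mtop M) (fst c)) (top_of_set (img c)) (snd c)"
    using assms by (auto simp: has_charts_def)
  show "openin (mtop M) (fst c)" "open (img c)" by fact+
  show sub: "fst c \<subseteq> points M" using c(1) by (rule openin_subset)
  then have "topspace (subtopology (mtop M) (fst c)) = fst c" by auto
  then show "inj_on (snd c) (fst c)"
    using homeomorphic_imp_injective_map[OF c(3)] by simp
  assume "openin (mtop M) W"
  then have "openin (subtopology (mtop M) (fst c)) (fst c \<inter> W)"
    by (auto simp: openin_subtopology)
  then have "openin (top_of_set (img c)) (snd c ` (fst c \<inter> W))"
    using homeomorphic_imp_open_map[OF c(3)] by (simp add: open_map_def)
  then show "open (snd c ` (fst c \<inter> W))" using c(2) by (rule openin_open_trans)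
qed

lemma smooth_atlasD:
  "smooth_atlas M \<Longrightarrow> has_charts M"
  by (simp add: smooth_atlas_def)

lemma param_chart:
  assumes "has_charts M" "c \<in> atlas M"
  shows "p \<in> fst c \<Longrightarrow> param c (snd c p) = p"
    "x \<in> img c \<Longrightarrow> snd c (param c x) = x"
    "x \<in> img c \<Longrightarrow> param c x \<in> fst c"
  using has_chartsD(4)[OF assms]
  by (auto simp: param_def f_inv_into_f inv_into_into)

lemma chart_at:
  assumes "has_charts M" "p \<in> points M"
  shows "chart_at M p \<in> atlas M" "p \<in> fst (chart_at M p)"
proof -
  have "\<exists>c. c \<in> atlas M \<and> p \<in> fst c"
    using assms unfolding has_charts_def by blast
  then show "chart_at M p \<in> atlas M" "p \<in> fst (chart_at M p)"
    unfolding chart_at_def by (metis (mono_tags, lifting) someI_ex)+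
qed

text \<open>\<open>mdiff\<close> is bound to the chosen charts, which may jump from point to point.
  Allowing any two charts makes the derivative comparable at neighbouring points.\<close>

definition chart_deriv ::
  "('a, 'e::euclidean_space) chart \<Rightarrow> ('b, 'f::euclidean_space) chart \<Rightarrow> ('a \<Rightarrow> 'b) \<Rightarrow> 'a \<Rightarrow> 'e \<Rightarrow> 'f" where
  "chart_deriv c d f p = fderiv (coord_map c f d) (snd c p)"

definition fun_deriv :: "('a, 'e::euclidean_space) chart \<Rightarrow> ('a \<Rightarrow> real) \<Rightarrow> 'a \<Rightarrow> 'e \<Rightarrow> real" where
  "fun_deriv c g p = fderiv (g \<circ> param c) (snd c p)"

definition smooth_fun :: "('a, 'e::euclidean_space) mfd \<Rightarrow> ('a \<Rightarrow> real) \<Rightarrow> bool" where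
  "smooth_fun M g \<longleftrightarrow> (\<forall>c\<in>atlas M. smooth_on (img c) (g \<circ> param c))"

lemma smooth_funD: "smooth_fun M g \<Longrightarrow> c \<in> atlas M \<Longrightarrow> smooth_on (img c) (g \<circ> param c)"
  by (simp add: smooth_fun_def)

lemma mdiff_eq: "mdiff M N f p = chart_deriv (chart_at M p) (chart_at N (f p)) f p"
  by (simp add: mdiff_def chart_deriv_def)

locale smooth_between =
  fixes M :: "('a, 'e::euclidean_space) mfd" and N :: "('b, 'f::euclidean_space) mfd" and f :: "'a \<Rightarrow> 'b"
  assumes M: "has_charts M" and N: "has_charts N" and f: "smooth_map M N f"
begin

lemma image_points: "p \<in> points M \<Longrightarrow> f p \<in> points N"
  using f by (auto simp: smooth_map_def continuous_map_def)

lemma smooth_rep: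
  "c \<in> atlas M \<Longrightarrow> d \<in> atlas N \<Longrightarrow> smooth_on (coord_dom c f d) (coord_map c f d)"
  using f by (simp add: smooth_map_def)

lemma open_rep:
  assumes "c \<in> atlas M" "d \<in> atlas N" shows "open (coord_dom c f d)"
proof -
  have "openin (mtop M) {p \<in> points M. f p \<in> fst d}"
    using f has_chartsD(2)[OF N assms(2)]
    by (intro openin_continuous_map_preimage) (auto simp: smooth_map_def)
  moreover have "fst c \<inter> {p \<in> points M. f p \<in> fst d} = fst c \<inter> f -` fst d"
    using has_chartsD(1)[OF M assms(1)] by auto
  ultimately show ?thesis using has_chartsD(5)[OF M assms(1)] by metis
qed

lemma rep_maps:
  assumes "c \<in> atlas M" "x \<in> coord_dom c f d"
  shows "param c x \<in> fst c" "f (param c x) \<in> fst d" "x \<in> img c" "snd c (param c x) = x"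
    "(coord_map c f d) x \<in> img d"
  using assms param_chart(1)[OF M assms(1)] by auto

lemma chart_deriv_has_derivative:
  assumes "c \<in> atlas M" "d \<in> atlas N" "p \<in> fst c" "f p \<in> fst d"
  shows "(coord_map c f d has_derivative chart_deriv c d f p) (at (snd c p))"
  unfolding chart_deriv_def
  using assms by (intro smooth_on_has_derivative[OF smooth_rep]) auto

lemma linear_chart_deriv:
  assumes "c \<in> atlas M" "d \<in> atlas N" "p \<in> fst c" "f p \<in> fst d"
  shows "linear (chart_deriv c d f p)"
  using chart_deriv_has_derivative[OF assms] by (rule has_derivative_linear)

lemma linear_mdiff: "p \<in> points M \<Longrightarrow> linear (mdiff M N f p)"
  unfolding mdiff_eq by (intro linear_chart_deriv chart_at M N image_points)

end

lemma smooth_between_id: "smooth_atlas M \<Longrightarrow> smooth_between M M id"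
  by (simp add: smooth_between_def smooth_map_def smooth_atlas_def)

lemma chart_deriv_id:
  assumes "has_charts M" "c \<in> atlas M" "p \<in> fst c"
  shows "chart_deriv c c id p = id"
proof -
  have "fderiv (coord_map c id c) (snd c p) = fderiv id (snd c p)"
    using assms has_chartsD(3)[OF assms(1,2)] param_chart(2)[OF assms(1,2)]
    by (intro frechet_derivative_cong(1)[of "img c"]) auto
  then show ?thesis by (simp add: chart_deriv_def frechet_derivative_eq[OF has_derivative_id] id_def)
qed

text \<open>The chain rule through an intermediate chart. That chart may cover only part of the
  image of \<open>f\<close>, hence the smaller domain, which also requires \<open>f p\<close> to lie
  in it.\<close>

lemma smooth_rep_comp:
  assumes f: "smooth_between M N f" and g: "smooth_between N K g"
    and c: "c \<in> atlas M" "d \<in> atlas N" "e \<in> atlas K"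
  shows "open (snd c ` (fst c \<inter> f -` (fst d \<inter> g -` fst e)))"
    "smooth_on (snd c ` (fst c \<inter> f -` (fst d \<inter> g -` fst e))) (coord_map c (g \<circ> f) e)"
    "p \<in> fst c \<Longrightarrow> f p \<in> fst d \<Longrightarrow> g (f p) \<in> fst e \<Longrightarrow>
      chart_deriv c e (g \<circ> f) p v = chart_deriv d e g (f p) (chart_deriv c d f p v)"
proof -
  interpret f: smooth_between M N f by fact
  interpret g: smooth_between N K g by fact
  let ?S = "snd c ` (fst c \<inter> f -` (fst d \<inter> g -` fst e))"
  let ?\<tau> = "coord_map c f d" and ?\<sigma> = "coord_map d g e"
  have "openin (mtop N) {q \<in> points N. g q \<in> fst e}"
    using g.f has_chartsD(2)[OF g.N c(3)]
    by (intro openin_continuous_map_preimage) (auto simp: smooth_map_def)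
  from openin_Int[OF has_chartsD(2)[OF f.N c(2)] this]
  have 1: "openin (mtop M) {p \<in> points M. f p \<in> fst d \<inter> {q \<in> points N. g q \<in> fst e}}"
    by (rule openin_continuous_map_preimage[rotated]) (use f.f in \<open>simp add: smooth_map_def\<close>)
  have 2: "fst c \<inter> {p \<in> points M. f p \<in> fst d \<inter> {q \<in> points N. g q \<in> fst e}}
      = fst c \<inter> f -` (fst d \<inter> g -` fst e)"
    using has_chartsD(1)[OF f.M c(1)] f.image_points by auto
  show S: "open ?S"
    using has_chartsD(5)[OF f.M c(1) 1] unfolding 2 .
  have sub: "?S \<subseteq> coord_dom c f d" by auto
  have into: "?\<tau> ` ?S \<subseteq> coord_dom d g e"
    by (auto simp: param_chart(1)[OF f.M c(1)])
  have eq: "?\<sigma> (?\<tau> x) = (coord_map c (g \<circ> f) e) x" if "x \<in> ?S" for x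
    using that by (auto simp: param_chart(1)[OF f.M c(1)] param_chart(1)[OF f.N c(2)])
  have "smooth_on ?S (\<lambda>x. ?\<sigma> (?\<tau> x))"
    by (rule smooth_on_compose[OF S g.open_rep[OF c(2,3)] g.smooth_rep[OF c(2,3)]
          smooth_on_subset[OF f.smooth_rep[OF c(1,2)] sub] into])
  then show "smooth_on ?S (coord_map c (g \<circ> f) e)"
    by (rule smooth_on_cong[OF S, rotated]) (rule eq)
  assume p: "p \<in> fst c" "f p \<in> fst d" "g (f p) \<in> fst e"
  have x: "snd c p \<in> ?S" using p by auto
  have \<tau>p: "?\<tau> (snd c p) = snd d (f p)" using p by (simp add: param_chart(1)[OF f.M c(1)])
  have 3: "chart_deriv c e (g \<circ> f) p v = fderiv (\<lambda>x. ?\<sigma> (?\<tau> x)) (snd c p) v"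
    unfolding chart_deriv_def by (subst frechet_derivative_cong(1)[OF S x eq]) simp_all
  have "((\<lambda>x. ?\<sigma> (?\<tau> x)) has_derivative (\<lambda>v. chart_deriv d e g (f p) (chart_deriv c d f p v))) (at (snd c p))"
    by (rule has_derivative_compose[OF f.chart_deriv_has_derivative[OF c(1,2) p(1,2)]])
       (simp only: \<tau>p g.chart_deriv_has_derivative[OF c(2,3) p(2,3)])
  from frechet_derivative_eq[OF this]
  have "fderiv (\<lambda>x. ?\<sigma> (?\<tau> x)) (snd c p) v = chart_deriv d e g (f p) (chart_deriv c d f p v)"
    by (rule fun_cong)
  with 3 show "chart_deriv c e (g \<circ> f) p v = chart_deriv d e g (f p) (chart_deriv c d f p v)"
    by simp
qed

text \<open>Smoothness is local, and near a given point one intermediate chart is enough.\<close>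

lemma smooth_between_comp:
  assumes f: "smooth_between M N f" and g: "smooth_between N K g"
  shows "smooth_between M K (g \<circ> f)"
proof -
  interpret f: smooth_between M N f by fact
  interpret g: smooth_between N K g by fact
  have "smooth_on (coord_dom c (g \<circ> f) e) (coord_map c (g \<circ> f) e)"
    if c: "c \<in> atlas M" "e \<in> atlas K" for c e
  proof (rule smooth_on_local)
    fix x assume x: "x \<in> coord_dom c (g \<circ> f) e"
    then obtain p where p: "p \<in> fst c" "g (f p) \<in> fst e" "x = snd c p" by auto
    let ?d = "chart_at N (f p)"
    have "p \<in> points M" using has_chartsD(1)[OF f.M c(1)] p by blast
    then have d: "?d \<in> atlas N" "f p \<in> fst ?d"
      using chart_at[OF f.N] f.image_points by auto
    show "\<exists>T. open T \<and> x \<in> T \<and> smooth_on T (coord_map c (g \<circ> f) e)"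
      using smooth_rep_comp(1,2)[OF f g c(1) d(1) c(2)] p d by blast
  qed
  moreover have "continuous_map (mtop M) (mtop K) (g \<circ> f)"
    using f.f g.f by (auto simp: smooth_map_def intro: continuous_map_compose)
  ultimately show ?thesis
    using f.M g.N by (auto simp: smooth_between_def smooth_map_def)
qed

lemma mdiff_comp:
  assumes f: "smooth_between M N f" and g: "smooth_between N K g" and p: "p \<in> points M"
  shows "mdiff M K (g \<circ> f) p v = mdiff N K g (f p) (mdiff M N f p v)"
proof -
  interpret f: smooth_between M N f by fact
  interpret g: smooth_between N K g by fact
  note q = f.image_points[OF p]
  show ?thesis
    using smooth_rep_comp(3)[OF f g chart_at(1)[OF f.M p] chart_at(1)[OF f.N q] chart_at(1)[OF g.N g.image_points[OF q]]
        chart_at(2)[OF f.M p] chart_at(2)[OF f.N q] chart_at(2)[OF g.N g.image_points[OF q]]]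
    by (simp add: mdiff_eq)
qed

section \<open>Forms in charts\<close>

text \<open>The value of a form at \<open>p\<close> refers to the chart chosen at \<open>p\<close>;
  a fixed chart \<open>c\<close> sees it through the derivative of the transition between the
  two.\<close>

lemma local_rep_chart:
  assumes M: "has_charts M" "c \<in> atlas M" "p \<in> fst c"
  shows "local_rep M c \<beta> (snd c p) v = \<beta> p (\<lambda>i. chart_deriv c (chart_at M p) id p (v i))"
proof -
  let ?V = "img c"
  have x: "snd c p \<in> ?V" using M by auto

  \<comment> \<open>An open set of Euclidean space carries a single chart, so the choice is
    forced.\<close>
  have at: "chart_at (eucl ?V) (snd c p) = (?V, id)"
    unfolding chart_at_def eucl_def by (rule some_equality) (use x in auto)
  have "mdiff (eucl ?V) M (param c) (snd c p) = chart_deriv c (chart_at M p) id p"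
  proof -
    have "fderiv (snd (chart_at M p) \<circ> param c \<circ> param (?V, id)) (snd c p)
        = fderiv (coord_map c id (chart_at M p)) (snd c p)"
    proof (rule frechet_derivative_cong(1)[OF has_chartsD(3)[OF M(1,2)] x])
      fix z assume "z \<in> ?V"
      then have "inv_into ?V id z = z" by (metis f_inv_into_f id_apply image_id)
      then show "(snd (chart_at M p) \<circ> param c \<circ> param (?V, id)) z = (coord_map c id (chart_at M p)) z"
        by (simp add: param_def)
    qed
    then show ?thesis
      unfolding mdiff_def chart_deriv_def at using param_chart(1)[OF M] by simp
  qed
  then show ?thesis
    unfolding local_rep_def pullback_def using param_chart(1)[OF M] by simp
qed

lemma local_rep_chart_at:
  assumes M: "has_charts M" "p \<in> points M"
  shows "local_rep M (chart_at M p) \<beta> (snd (chart_at M p) p) v = \<beta> p v"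
  using local_rep_chart[OF M(1) chart_at[OF M]] chart_deriv_id[OF M(1) chart_at[OF M]] by simp

lemma alt_form_local_rep:
  assumes m: "smooth_atlas M" "c \<in> atlas M" "x \<in> img c" and \<beta>: "smooth_form k M \<beta>"
  shows "alt_form k (local_rep M c \<beta> x)"
proof -
  interpret smooth_between M M id using m smooth_between_id by blast
  obtain p where p: "p \<in> fst c" "x = snd c p" using m(3) by auto
  have pM: "p \<in> points M" using has_chartsD(1)[OF N m(2)] p by blast
  have "alt_form k (\<lambda>v. \<beta> p (\<lambda>i. chart_deriv c (chart_at M p) id p (v i)))"
    using \<beta> pM chart_at[OF N pM]
    by (intro alt_form_linear_comp[OF _ linear_chart_deriv[OF m(2)]]) (auto simp: smooth_form_def p)
  moreover have "local_rep M c \<beta> x = (\<lambda>v. \<beta> p (\<lambda>i. chart_deriv c (chart_at M p) id p (v i)))"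
    using local_rep_chart[OF N m(2) p(1)] p(2) by auto
  ultimately show ?thesis by simp
qed

text \<open>Both sides use the derivative of one map, \<open>f\<close> read from \<open>c\<close> to
  the chart chosen at \<open>f p\<close>. It factors through the chart chosen at \<open>p\<close>
  and also through \<open>d\<close>.\<close>

lemma local_rep_pullback:
  assumes f: "smooth_between M N f" and M: "smooth_atlas M" and N: "smooth_atlas N"
    and c: "c \<in> atlas M" "d \<in> atlas N" "p \<in> fst c" "f p \<in> fst d"
  shows "local_rep M c (pullback M N f \<beta>) (snd c p) v
    = local_rep N d \<beta> (snd d (f p)) (\<lambda>i. chart_deriv c d f p (v i))"
proof -
  interpret f: smooth_between M N f by fact
  note idM = smooth_between_id[OF M] and idN = smooth_between_id[OF N]
  have p: "p \<in> points M" using has_chartsD(1)[OF f.M c(1)] c by blast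
  note q = f.image_points[OF p]
  note cp = chart_at[OF f.M p] and cq = chart_at[OF f.N q]
  have "mdiff M N f p (chart_deriv c (chart_at M p) id p v) = chart_deriv d (chart_at N (f p)) id (f p) (chart_deriv c d f p v)" for v
    using smooth_rep_comp(3)[OF idM f c(1) cp(1) cq(1), of p v] smooth_rep_comp(3)[OF f idN c(1,2) cq(1), of p v] c cp cq
    by (simp add: mdiff_eq)
  then show ?thesis
    by (simp add: local_rep_chart[OF f.M c(1,3)] local_rep_chart[OF f.N c(2,4)] pullback_def)
qed

lemma smooth_form_pullback:
  assumes f: "smooth_between M N f" and M: "smooth_atlas M" and N: "smooth_atlas N"
    and \<beta>: "smooth_form 1 N \<beta>"
  shows "smooth_form 1 M (pullback M N f \<beta>)"
proof -
  interpret f: smooth_between M N f by fact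
  have alt: "alt_form 1 (pullback M N f \<beta> p)" if "p \<in> points M" for p
    unfolding pullback_def using \<beta> f.image_points[OF that]
    by (intro alt_form_linear_comp[OF _ f.linear_mdiff[OF that]]) (auto simp: smooth_form_def)
  have "smooth_on (img c) (\<lambda>x. local_rep M c (pullback M N f \<beta>) x v)" if c: "c \<in> atlas M" for c v
  proof (rule smooth_on_local)
    fix x assume "x \<in> img c"
    then obtain p where p: "p \<in> fst c" "x = snd c p" by auto
    let ?d = "chart_at N (f p)"
    let ?S = "coord_dom c f ?d" and ?\<tau> = "coord_map c f ?d"
    have pM: "p \<in> points M" using has_chartsD(1)[OF f.M c] p by blast
    note d = chart_at[OF f.N f.image_points[OF pM]]
    note S = f.open_rep[OF c d(1)] and \<tau> = f.smooth_rep[OF c d(1)]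
    note T = has_chartsD(3)[OF f.N d(1)]
    \<comment> \<open>Smoothness of \<beta> in a chart is given for constant arguments only, so the
      moving vector D\<tau>(v) is written out in \<open>Basis\<close>.\<close>
    have "smooth_on ?S (\<lambda>x. \<Sum>b\<in>Basis. (fderiv ?\<tau> x (v 0) \<bullet> b) * local_rep N ?d \<beta> (?\<tau> x) (\<lambda>_. b))"
    proof (intro smooth_on_sum smooth_on_mult S)
      fix b
      show "smooth_on ?S (\<lambda>x. fderiv ?\<tau> x (v 0) \<bullet> b)"
        by (intro smooth_on_linear_comp[OF S, of "\<lambda>y. y \<bullet> b"] smooth_on_frechet_derivative \<tau>
            bounded_linear.linear bounded_linear_inner_left)
      show "smooth_on ?S (\<lambda>x. local_rep N ?d \<beta> (?\<tau> x) (\<lambda>_. b))"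
        by (rule smooth_on_compose[OF S T _ \<tau>])
           (use \<beta> d f.rep_maps[OF c] in \<open>auto simp: smooth_form_def\<close>)
    qed
    moreover have "(\<Sum>b\<in>Basis. (fderiv ?\<tau> x (v 0) \<bullet> b) * local_rep N ?d \<beta> (?\<tau> x) (\<lambda>_. b))
        = local_rep M c (pullback M N f \<beta>) x v" if "x \<in> ?S" for x
    proof -
      note r = f.rep_maps[OF c that]
      have \<tau>x: "?\<tau> x = snd ?d (f (param c x))" by simp
      have alt: "alt_form 1 (local_rep N ?d \<beta> (?\<tau> x))"
        by (rule alt_form_local_rep[OF N d(1) r(5) \<beta>])
      have "local_rep M c (pullback M N f \<beta>) x v
          = local_rep N ?d \<beta> (?\<tau> x) (\<lambda>i. fderiv ?\<tau> x (v i))"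
        using local_rep_pullback[OF f M N c d(1) r(1,2)] by (simp add: chart_deriv_def r(4))
      also have "\<dots> = local_rep N ?d \<beta> (?\<tau> x) (\<lambda>_. fderiv ?\<tau> x (v 0))"
        by (rule alt_form_1_eq[OF alt])
      also have "\<dots> = (\<Sum>b\<in>Basis. (fderiv ?\<tau> x (v 0) \<bullet> b) *\<^sub>R local_rep N ?d \<beta> (?\<tau> x) (\<lambda>_. b))"
        by (rule linear_basis_expansion[OF alt_form_1_linear[OF alt]])
      finally show ?thesis by simp
    qed
    ultimately have "smooth_on ?S (\<lambda>x. local_rep M c (pullback M N f \<beta>) x v)"
      by (rule smooth_on_cong[OF S, rotated])
    then show "\<exists>T. open T \<and> x \<in> T \<and> smooth_on T (\<lambda>x. local_rep M c (pullback M N f \<beta>) x v)"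
      using S p d by blast
  qed
  then show ?thesis using alt by (simp add: smooth_form_def)
qed

text \<open>With the charts at \<open>p\<close> and \<open>f p\<close> held fixed on a
  neighbourhood, the pullback becomes one between open sets, where naturality is known.\<close>

lemma ext_d_1_pullback:
  assumes f: "smooth_between M N f" and M: "smooth_atlas M" and N: "smooth_atlas N"
    and \<beta>: "smooth_form 1 N \<beta>" and p: "p \<in> points M"
  shows "ext_d 1 M (pullback M N f \<beta>) p v = pullback M N f (ext_d 1 N \<beta>) p v"
proof -
  interpret f: smooth_between M N f by fact
  let ?c = "chart_at M p" and ?d = "chart_at N (f p)"
  let ?S = "coord_dom ?c f ?d" and ?\<tau> = "coord_map ?c f ?d"
  note c = chart_at[OF f.M p] and d = chart_at[OF f.N f.image_points[OF p]]
  note S = f.open_rep[OF c(1) d(1)] and \<tau> = f.smooth_rep[OF c(1) d(1)]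
  note T = has_chartsD(3)[OF f.N d(1)]
  have x: "snd ?c p \<in> ?S" using c d by auto
  have \<tau>x: "?\<tau> (snd ?c p) = snd ?d (f p)" using param_chart(1)[OF f.M c] by simp
  have "ext_d 1 M (pullback M N f \<beta>) p v
    = ext_d_eucl 1 (\<lambda>z v. local_rep N ?d \<beta> (?\<tau> z) (\<lambda>i. fderiv ?\<tau> z (v i))) (snd ?c p) v"
    unfolding ext_d_def
  proof (rule ext_d_eucl_cong[OF S x])
    fix z v assume "z \<in> ?S"
    note r = f.rep_maps[OF c(1) this]
    show "local_rep M ?c (pullback M N f \<beta>) z v
        = local_rep N ?d \<beta> (?\<tau> z) (\<lambda>i. fderiv ?\<tau> z (v i))"
      using local_rep_pullback[OF f M N c(1) d(1) r(1,2)] by (simp add: chart_deriv_def r(4))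
  qed
  also have "\<dots> = ext_d_eucl 1 (local_rep N ?d \<beta>) (?\<tau> (snd ?c p)) (\<lambda>i. fderiv ?\<tau> (snd ?c p) (v i))"
  proof (intro ext_d_eucl_1_pullback[OF S x T \<tau>] alt_form_local_rep[OF N d(1) _ \<beta>])
    show "?\<tau> ` ?S \<subseteq> img ?d" using f.rep_maps(5)[OF c(1)] by blast
    show "smooth_on (img ?d) (\<lambda>z. local_rep N ?d \<beta> z v)" for v
      using \<beta> d by (simp add: smooth_form_def)
  qed
  also have "\<dots> = pullback M N f (ext_d 1 N \<beta>) p v"
    unfolding \<tau>x by (simp add: pullback_def ext_d_def mdiff_def)
  finally show ?thesis .
qed

section \<open>Differentials of functions\<close>

lemma d_fun_eq:
  assumes M: "has_charts M" "p \<in> points M"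
  shows "d_fun M g p v = fun_deriv (chart_at M p) g p (v 0)"
  by (simp add: d_fun_def ext_d_def ext_d_eucl_def local_rep_def pullback_def fun_deriv_def o_def)

lemma fun_deriv_has_derivative:
  assumes "smooth_fun M g" "c \<in> atlas M" "p \<in> fst c"
  shows "((g \<circ> param c) has_derivative fun_deriv c g p) (at (snd c p))"
  using assms unfolding fun_deriv_def smooth_fun_def by (intro smooth_on_has_derivative) auto

lemma smooth_fun_comp:
  assumes f: "smooth_between M N f" and g: "smooth_fun N g"
  shows "smooth_fun M (g \<circ> f)"
    "c \<in> atlas M \<Longrightarrow> d \<in> atlas N \<Longrightarrow> p \<in> fst c \<Longrightarrow> f p \<in> fst d \<Longrightarrow>
      fun_deriv c (g \<circ> f) p v = fun_deriv d g (f p) (chart_deriv c d f p v)"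
proof -
  interpret f: smooth_between M N f by fact
  have eq: "(g \<circ> param d) ((coord_map c f d) x) = ((g \<circ> f) \<circ> param c) x"
    if "c \<in> atlas M" "d \<in> atlas N" "x \<in> coord_dom c f d" for c d x
    using f.rep_maps[OF that(1,3)] param_chart(1)[OF f.N that(2)] by simp
  show "smooth_fun M (g \<circ> f)"
    unfolding smooth_fun_def
  proof (intro ballI smooth_on_local)
    fix c x assume c: "c \<in> atlas M" and "x \<in> img c"
    then obtain p where p: "p \<in> fst c" "x = snd c p" by auto
    let ?d = "chart_at N (f p)"
    let ?S = "coord_dom c f ?d"
    have pM: "p \<in> points M" using has_chartsD(1)[OF f.M c] p by blast
    note d = chart_at[OF f.N f.image_points[OF pM]]
    note S = f.open_rep[OF c d(1)]
    have "smooth_on ?S (\<lambda>x. (g \<circ> param ?d) ((coord_map c f ?d) x))"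
      by (rule smooth_on_compose[OF S has_chartsD(3)[OF f.N d(1)] smooth_funD[OF g d(1)] f.smooth_rep[OF c d(1)]])
         (use f.rep_maps[OF c] in auto)
    then have "smooth_on ?S ((g \<circ> f) \<circ> param c)"
      by (rule smooth_on_cong[OF S, rotated]) (rule eq[OF c d(1)])
    then show "\<exists>T. open T \<and> x \<in> T \<and> smooth_on T ((g \<circ> f) \<circ> param c)"
      using S p d by blast
  qed
  assume c: "c \<in> atlas M" and d: "d \<in> atlas N" and p: "p \<in> fst c" "f p \<in> fst d"
  have \<tau>p: "(coord_map c f d) (snd c p) = snd d (f p)"
    using p by (simp add: param_chart(1)[OF f.M c])
  have "fun_deriv c (g \<circ> f) p v
      = fderiv (\<lambda>x. (g \<circ> param d) ((coord_map c f d) x)) (snd c p) v"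
    unfolding fun_deriv_def
    by (subst frechet_derivative_cong(1)[OF f.open_rep[OF c d] _ eq[OF c d]]) (use p in auto)
  also have "\<dots> = fun_deriv d g (f p) (chart_deriv c d f p v)"
  proof -
    have "((\<lambda>x. (g \<circ> param d) ((coord_map c f d) x)) has_derivative
        (\<lambda>v. fun_deriv d g (f p) (chart_deriv c d f p v))) (at (snd c p))"
      by (rule has_derivative_compose[OF f.chart_deriv_has_derivative[OF c d p]])
         (simp only: \<tau>p fun_deriv_has_derivative[OF g d p(2)])
    from frechet_derivative_eq[OF this] show ?thesis by (rule fun_cong)
  qed
  finally show "fun_deriv c (g \<circ> f) p v = fun_deriv d g (f p) (chart_deriv c d f p v)" .
qed

lemma pullback_d_fun:
  assumes f: "smooth_between M N f" and g: "smooth_fun N g" and p: "p \<in> points M"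
  shows "pullback M N f (d_fun N g) p v = d_fun M (g \<circ> f) p v"
proof -
  interpret f: smooth_between M N f by fact
  note c = chart_at[OF f.M p] and d = chart_at[OF f.N f.image_points[OF p]]
  show ?thesis
    using smooth_fun_comp(2)[OF f g c(1) d(1) c(2) d(2)]
    by (simp add: pullback_def d_fun_eq[OF f.M p] d_fun_eq[OF f.N f.image_points[OF p]] mdiff_eq)
qed

lemma local_rep_d_fun:
  assumes M: "smooth_atlas M" and g: "smooth_fun M g" and c: "c \<in> atlas M" "x \<in> img c"
  shows "local_rep M c (d_fun M g) x v = fderiv (g \<circ> param c) x (v 0)"
proof -
  note id = smooth_between_id[OF M] and M' = smooth_atlasD[OF M]
  obtain p where p: "p \<in> fst c" "x = snd c p" using c by auto
  have pM: "p \<in> points M" using has_chartsD(1)[OF M' c(1)] p by blast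
  note d = chart_at[OF M' pM]
  show ?thesis
    using smooth_fun_comp(2)[OF id g c(1) d(1) p(1), of "v 0"] d
    by (simp add: p(2) local_rep_chart[OF M' c(1) p(1)] d_fun_eq[OF M' pM] fun_deriv_def)
qed

lemma smooth_form_d_fun:
  assumes M: "smooth_atlas M" and g: "smooth_fun M g"
  shows "smooth_form 1 M (d_fun M g)"
  unfolding smooth_form_def
proof (intro conjI ballI allI)
  fix p assume p: "p \<in> points M"
  note M' = smooth_atlasD[OF M]
  show "alt_form 1 (d_fun M g p)"
    using has_derivative_linear[OF fun_deriv_has_derivative[OF g chart_at[OF M' p]]]
    by (intro alt_form_1I[of _ "fun_deriv (chart_at M p) g p"] d_fun_eq[OF M' p])
next
  fix c v assume c: "c \<in> atlas M"
  show "smooth_on (img c) (\<lambda>x. local_rep M c (d_fun M g) x v)"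
    by (rule smooth_on_cong[OF has_chartsD(3)[OF smooth_atlasD[OF M] c]
          local_rep_d_fun[OF M g c, symmetric] smooth_on_frechet_derivative[OF smooth_funD[OF g c]]])
qed

text \<open>In a chart this is the symmetry of the second derivatives of \<open>g\<close>.\<close>

lemma ext_d_1_d_fun:
  assumes M: "smooth_atlas M" and g: "smooth_fun M g" and p: "p \<in> points M"
  shows "ext_d 1 M (d_fun M g) p v = 0"
proof -
  note M' = smooth_atlasD[OF M]
  let ?c = "chart_at M p"
  note c = chart_at[OF M' p]
  let ?V = "img ?c"
  note V = has_chartsD(3)[OF M' c(1)]
  have x: "snd ?c p \<in> ?V" using c by auto
  have sm: "smooth_on ?V (g \<circ> param ?c)" using g c by (auto simp: smooth_fun_def)
  have "ext_d 1 M (d_fun M g) p v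
      = ext_d_eucl 1 (\<lambda>z v. fderiv (g \<circ> param ?c) z (v 0)) (snd ?c p) v"
    unfolding ext_d_def by (rule ext_d_eucl_cong[OF V x local_rep_d_fun[OF M g c(1)]])
  also have "\<dots> = 0"
  proof (subst ext_d_eucl_1[OF V x])
    fix z assume "z \<in> ?V"
    then show "alt_form 1 (\<lambda>v. fderiv (g \<circ> param ?c) z (v 0))"
      using linear_frechet_derivative[OF smooth_on_differentiable[OF sm]] by (intro alt_form_1I) auto
  next
    show "fderiv (\<lambda>z. fderiv (g \<circ> param ?c) z (v 1)) (snd ?c p) (v 0) -
        fderiv (\<lambda>z. fderiv (g \<circ> param ?c) z (v 0)) (snd ?c p) (v 1) = 0"
      using second_derivative_symmetric[OF V _ x] sm by (simp add: smooth_on_def)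
  qed
  finally show ?thesis .
qed

section \<open>Products and complex curves\<close>

lemma has_charts_eucl: "open S \<Longrightarrow> has_charts (eucl S)"
  using homeomorphic_map_id[of "top_of_set S"]
  by (simp add: has_charts_def eucl_def id_def subtopology_subtopology)

lemma points_eucl [simp]: "points (eucl S) = S"
  by (simp add: eucl_def)

lemma points_prod [simp]: "points (prod_mfd M N) = points M \<times> points N"
  by (simp add: prod_mfd_def)

lemma atlas_prodE:
  assumes "D \<in> atlas (prod_mfd M N)"
  obtains c d where "c \<in> atlas M" "d \<in> atlas N" "D = (fst c \<times> fst d, map_prod (snd c) (snd d))"
  using assms by (auto simp: prod_mfd_def)

lemma atlas_prodI:
  "c \<in> atlas M \<Longrightarrow> d \<in> atlas N \<Longrightarrow> (fst c \<times> fst d, map_prod (snd c) (snd d)) \<in> atlas (prod_mfd M N)"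
  unfolding prod_mfd_def mfd.sel by blast

lemma param_prod:
  assumes "inj_on (snd c) (fst c)" "inj_on (snd d) (fst d)" "p \<in> fst c" "q \<in> fst d"
  shows "param (fst c \<times> fst d, map_prod (snd c) (snd d)) (snd c p, snd d q) = (p, q)"
proof -
  have "inv_into (fst c \<times> fst d) (map_prod (snd c) (snd d)) (map_prod (snd c) (snd d) (p, q)) = (p, q)"
    by (rule inv_into_f_f) (use assms in \<open>auto intro: map_prod_inj_on\<close>)
  then show ?thesis by (simp add: param_def)
qed

lemma has_charts_prod:
  assumes M: "has_charts M" and N: "has_charts N"
  shows "has_charts (prod_mfd M N)"
  unfolding has_charts_def
proof (intro conjI ballI)
  have "(\<Union>D\<in>atlas (prod_mfd M N). fst D) \<subseteq> (\<Union>c\<in>atlas M. fst c) \<times> (\<Union>d\<in>atlas N. fst d)"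
    by (auto elim!: atlas_prodE)
  moreover have "z \<in> (\<Union>D\<in>atlas (prod_mfd M N). fst D)" if z: "z \<in> (\<Union>c\<in>atlas M. fst c) \<times> (\<Union>d\<in>atlas N. fst d)" for z
  proof -
    obtain c d where "c \<in> atlas M" "d \<in> atlas N" "z \<in> fst c \<times> fst d" using z by auto
    then show ?thesis by (intro UN_I[OF atlas_prodI]) simp_all
  qed
  ultimately show "(\<Union>D\<in>atlas (prod_mfd M N). fst D) = points (prod_mfd M N)"
    using M N by (auto simp: has_charts_def)
next
  fix D assume "D \<in> atlas (prod_mfd M N)"
  then obtain c d where cd: "c \<in> atlas M" "d \<in> atlas N"
    and D: "D = (fst c \<times> fst d, map_prod (snd c) (snd d))"
    by (rule atlas_prodE)
  have im: "img D = (img c) \<times> (img d)"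
    by (auto simp: D map_prod_surj_on)
  show "openin (mtop (prod_mfd M N)) (fst D)"
    using has_chartsD(2)[OF M cd(1)] has_chartsD(2)[OF N cd(2)]
    by (simp add: D prod_mfd_def openin_prod_Times_iff)
  show "open (img D)"
    unfolding im using has_chartsD(3)[OF M cd(1)] has_chartsD(3)[OF N cd(2)] by (rule open_Times)
  obtain g h where gh: "homeomorphic_maps (subtopology (mtop M) (fst c)) (top_of_set (img c)) (snd c) g"
    "homeomorphic_maps (subtopology (mtop N) (fst d)) (top_of_set (img d)) (snd d) h"
  proof -
    have "homeomorphic_map (subtopology (mtop M) (fst c)) (top_of_set (img c)) (snd c)"
      "homeomorphic_map (subtopology (mtop N) (fst d)) (top_of_set (img d)) (snd d)"
      using M N cd by (simp_all add: has_charts_def)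
    then show ?thesis using that unfolding homeomorphic_map_maps by metis
  qed
  then have "homeomorphic_maps
      (prod_topology (subtopology (mtop M) (fst c)) (subtopology (mtop N) (fst d)))
      (prod_topology (top_of_set (img c)) (top_of_set (img d)))
      (\<lambda>(x, y). (snd c x, snd d y)) (\<lambda>(x, y). (g x, h y))"
    unfolding homeomorphic_maps_prod by (intro disjI2 conjI)
  then show "homeomorphic_map (subtopology (mtop (prod_mfd M N)) (fst D)) (top_of_set (img D)) (snd D)"
    unfolding im unfolding homeomorphic_map_maps
    by (auto simp: D prod_mfd_def subtopology_Times map_prod_def)
qed

lemma image_prod_chart:
  "map_prod f g ` ((A \<times> B) \<inter> (A' \<times> B')) = (f ` (A \<inter> A')) \<times> (g ` (B \<inter> B'))"
  by (auto simp: map_prod_def)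

lemma smooth_between_fst:
  assumes M: "smooth_atlas M" and N: "has_charts N"
  shows "smooth_between (prod_mfd M N) M fst"
proof (rule smooth_between.intro)
  note M' = smooth_atlasD[OF M]
  show "has_charts (prod_mfd M N)" "has_charts M" by (rule has_charts_prod[OF M' N]) (rule M')
  show "smooth_map (prod_mfd M N) M fst"
    unfolding smooth_map_def
  proof (intro conjI ballI)
    show "continuous_map (mtop (prod_mfd M N)) (mtop M) fst"
      by (simp add: prod_mfd_def continuous_map_fst)
    fix D c' assume "D \<in> atlas (prod_mfd M N)" and c': "c' \<in> atlas M"
    then obtain c d where cd: "c \<in> atlas M" "d \<in> atlas N" and D: "D = (fst c \<times> fst d, map_prod (snd c) (snd d))"
      by (elim atlas_prodE)
    let ?S = "snd c ` (fst c \<inter> fst c')" and ?T = "img d"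
    have op: "open ?S" "open ?T"
      using has_chartsD(5)[OF M' cd(1) has_chartsD(2)[OF M' c']] has_chartsD(3)[OF N cd(2)] by simp_all
    have "smooth_on ?S (snd c' \<circ> param c)" using M cd c' by (simp add: smooth_atlas_def)
    then have "smooth_on (?S \<times> ?T) (\<lambda>z. (snd c' \<circ> param c) (fst z))"
      by (rule smooth_on_compose[OF open_Times[OF op] op(1) _ smooth_on_linear]) (auto simp: linear_fst)
    moreover have "(snd c' \<circ> param c) (fst z) = (coord_map D fst c') z" if "z \<in> ?S \<times> ?T" for z
      using that has_chartsD(4)[OF M' cd(1)] has_chartsD(4)[OF N cd(2)]
      by (auto simp: D param_prod param_chart(1)[OF M' cd(1)])
    ultimately have "smooth_on (?S \<times> ?T) (coord_map D fst c')"
      by (rule smooth_on_cong[OF open_Times[OF op], rotated])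
    moreover have "coord_dom D fst c' = ?S \<times> ?T"
      using image_prod_chart[of "snd c" "snd d" "fst c" "fst d" "fst c'" UNIV]
      by (simp add: D fst_vimage_eq_Times)
    ultimately show "smooth_on (coord_dom D fst c') (coord_map D fst c')" by simp
  qed
qed

lemma smooth_fun_prod:
  assumes M: "has_charts M" and N: "has_charts N"
  shows "smooth_fun M g \<Longrightarrow> smooth_fun (prod_mfd M N) (g \<circ> fst)" "smooth_fun N h \<Longrightarrow> smooth_fun (prod_mfd M N) (h \<circ> snd)"
proof -
  have "(smooth_fun M g \<longrightarrow> smooth_on (img D) (g \<circ> fst \<circ> param D)) \<and>
      (smooth_fun N h \<longrightarrow> smooth_on (img D) (h \<circ> snd \<circ> param D))" if DA: "D \<in> atlas (prod_mfd M N)" for D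
  proof -
    obtain c d where cd: "c \<in> atlas M" "d \<in> atlas N" and D: "D = (fst c \<times> fst d, map_prod (snd c) (snd d))"
      using DA by (rule atlas_prodE)
    let ?S = "img c" and ?T = "img d"
    have op: "open ?S" "open ?T" using has_chartsD(3)[OF M cd(1)] has_chartsD(3)[OF N cd(2)] .
    have im: "img D = ?S \<times> ?T" by (auto simp: D map_prod_surj_on)
    have param: "param D z = (param c (fst z), param d (snd z))" if "z \<in> ?S \<times> ?T" for z
      using that has_chartsD(4)[OF M cd(1)] has_chartsD(4)[OF N cd(2)]
      by (auto simp: D param_prod param_chart(1)[OF M cd(1)] param_chart(1)[OF N cd(2)])
    have "smooth_on (?S \<times> ?T) (\<lambda>z. (g \<circ> param c) (fst z))" if "smooth_fun M g"
      by (rule smooth_on_compose[OF open_Times[OF op] op(1) smooth_funD[OF that cd(1)] smooth_on_linear])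
         (auto simp: linear_fst)
    moreover have "smooth_on (?S \<times> ?T) (\<lambda>z. (h \<circ> param d) (snd z))" if "smooth_fun N h"
      by (rule smooth_on_compose[OF open_Times[OF op] op(2) smooth_funD[OF that cd(2)] smooth_on_linear])
         (auto simp: linear_snd)
    ultimately show ?thesis
      unfolding im using param by (auto elim!: smooth_on_cong[OF open_Times[OF op], rotated])
  qed
  then show "smooth_fun M g \<Longrightarrow> smooth_fun (prod_mfd M N) (g \<circ> fst)" "smooth_fun N h \<Longrightarrow> smooth_fun (prod_mfd M N) (h \<circ> snd)"
    unfolding smooth_fun_def[of "prod_mfd M N"] by blast+
qed

lemma smooth_fun_eucl: "open S \<Longrightarrow> smooth_fun (eucl (S :: real set)) (\<lambda>t. t)"
  unfolding smooth_fun_def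
proof (intro ballI)
  fix c assume S: "open S" and "c \<in> atlas (eucl S)"
  then have c: "c = (S, id)" by (simp add: eucl_def)
  have "smooth_on S ((\<lambda>t. t) \<circ> param (S, id))"
    by (rule smooth_on_cong[OF S _ smooth_on_linear[of "\<lambda>x. x"]])
       (auto simp: param_def linear_iff intro: inv_into_f_eq[symmetric])
  then show "smooth_on (img c) ((\<lambda>t. t) \<circ> param c)" by (simp add: c)
qed

lemma complex_curve_smooth_atlas: "complex_curve X \<Longrightarrow> smooth_atlas X"
proof -
  assume X: "complex_curve X"
  then have X': "has_charts X" by (simp add: complex_curve_def topological_manifold_has_charts)
  show ?thesis
    unfolding smooth_atlas_def
  proof (intro conjI ballI X')
    fix c d assume c: "c \<in> atlas X" "d \<in> atlas X"
    have "open (snd c ` (fst c \<inter> fst d))"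
      by (rule has_chartsD(5)[OF X' c(1) has_chartsD(2)[OF X' c(2)]])
    then show "smooth_on (snd c ` (fst c \<inter> fst d)) (snd d \<circ> param c)"
      using X c by (intro holomorphic_on_smooth_on) (simp_all add: complex_curve_def)
  qed
qed

section \<open>Torus bundles\<close>

lemma circle_chart:
  assumes "t \<in> sphere 0 1"
  obtains C where "C \<in> atlas circle_mfd" "t \<in> fst C" "inj_on (snd C) (fst C)"
proof -
  \<comment> \<open>The angles of this chart form the interval of length 2 pi centred at the
    argument of \<open>t\<close>.\<close>
  let ?a = "Arg t - pi"
  have "norm t = 1" "t \<noteq> 0" using assms by auto
  then have t: "t = cis (Arg t)" using cis_Arg[of t] by (simp add: sgn_div_norm)
  have "(cis ` {?a<..<?a + 2 * pi}, inv_into {?a<..<?a + 2 * pi} cis) \<in> atlas circle_mfd"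
    unfolding circle_mfd_def mfd.sel by blast
  moreover have "t \<in> cis ` {?a<..<?a + 2 * pi}" by (rule image_eqI[where x = "Arg t"], rule t, simp)
  ultimately show ?thesis by (intro that) (auto intro: inj_on_inv_into)
qed

text \<open>In this chart the one-parameter group \<open>cis\<close> is its own parameter near the
  identity, which is what the differentiation of orbits at time 0 uses.\<close>

lemma circle_chart_one:
  "\<exists>C. C \<in> atlas circle_mfd \<and> inj_on (snd C) (fst C) \<and>
    (\<forall>t. \<bar>t\<bar> < pi \<longrightarrow> cis t \<in> fst C \<and> snd C (cis t) = t)"
proof -
  let ?I = "{- pi<..<- pi + 2 * pi}"
  let ?C = "(cis ` ?I, inv_into ?I cis)"
  have "?C \<in> atlas circle_mfd" unfolding circle_mfd_def mfd.sel by blast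
  moreover have "inj_on (snd ?C) (fst ?C)" by (simp add: inj_on_inv_into)
  moreover have inj: "inj_on cis ?I"
    by (rule inj_on_inverseI[of _ Arg]) (auto intro: Arg_cis)
  have "cis t \<in> fst ?C \<and> snd ?C (cis t) = t" if "\<bar>t\<bar> < pi" for t
  proof -
    have t: "t \<in> ?I" using that by auto
    show ?thesis unfolding fst_conv snd_conv
      using imageI[OF t] inv_into_f_f[OF inj t] by blast
  qed
  ultimately show ?thesis by blast
qed

text \<open>Together L and the two functionals map onto a space of the same dimension, since a
  preimage under L can be corrected along g1 and g2 without changing its L-value. Surjectivity then
  forces injectivity.\<close>

lemma linear_kernel_trivial:
  fixes L :: "'e::euclidean_space \<Rightarrow> 'f::euclidean_space" and \<theta>1 \<theta>2 :: "'e \<Rightarrow> real"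
  assumes dim: "DIM('e) = DIM('f) + 2" and L: "linear L" "surj L" and \<theta>: "linear \<theta>1" "linear \<theta>2"
    and g: "L g1 = 0" "L g2 = 0" "\<theta>1 g1 = 1" "\<theta>1 g2 = 0" "\<theta>2 g1 = 0" "\<theta>2 g2 = 1"
    and v: "L v = 0" "\<theta>1 v = 0" "\<theta>2 v = 0"
  shows "v = 0"
proof -
  let ?T = "\<lambda>v. (L v, \<theta>1 v, \<theta>2 v)"
  have lin: "linear ?T"
    using L(1) \<theta> by (auto simp: linear_iff)
  have "\<exists>w. ?T w = (f, a, b)" for f a b
  proof -
    obtain v0 where v0: "L v0 = f" using L(2) by (metis surjD)
    let ?w = "v0 + (a - \<theta>1 v0) *\<^sub>R g1 + (b - \<theta>2 v0) *\<^sub>R g2"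
    have "?T ?w = (f, a, b)"
      using v0 g L(1) \<theta> by (simp add: linear_add linear_cmul)
    then show ?thesis by blast
  qed
  then have ex: "\<exists>w. ?T w = (f, a, b)" for f a b .
  have "surj ?T"
    unfolding surj_def
  proof
    fix z
    show "\<exists>w. z = ?T w"
      using ex[of "fst z" "fst (snd z)" "snd (snd z)"] by (simp only: prod.collapse) (elim exE, rule exI, erule sym)
  qed
  then have "inj ?T"
    by (rule linear_surjective_imp_injective[OF lin]) (simp add: dim)
  moreover have "?T v = ?T 0" using v linear_0[OF L(1)] \<theta>[THEN linear_0] by simp
  ultimately show "v = 0" by (rule injD)
qed

locale torus_bundle =
  fixes B :: "('b, 'f::euclidean_space) mfd" and E :: "('c, 'e::euclidean_space) mfd"
    and \<pi> :: "'c \<Rightarrow> 'b" and act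
  assumes B: "has_charts B" and principal: "principal_torus_bundle B E \<pi> act"
begin

lemma E: "smooth_atlas E" "has_charts E"
  using principal smooth_manifold_smooth_atlas smooth_atlasD unfolding principal_torus_bundle_def by blast+

lemma proj: "smooth_between E B \<pi>"
  using principal E B by (simp add: smooth_between_def principal_torus_bundle_def)

text \<open>A local trivialisation provides a section through \<open>p\<close>, and the derivative
  of the section is a right inverse of that of \<pi>.\<close>

lemma deriv_surj:
  assumes p: "p \<in> points E" and b: "b \<in> atlas B" "\<pi> p \<in> fst b" and c: "c \<in> atlas E" "p \<in> fst c"
  shows "surj (chart_deriv c b \<pi> p)"
proof -
  interpret pr: smooth_between E B \<pi> by (rule proj)
  have "\<forall>b\<in>points B. \<exists>U \<psi>. openin (mtop B) U \<and> b \<in> U \<and>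
        diffeo (open_sub E (\<pi> -` U)) (prod_mfd (open_sub B U) torus_mfd) \<psi> \<and>
        (\<forall>p\<in>points E \<inter> \<pi> -` U. fst (\<psi> p) = \<pi> p)"
    using principal unfolding principal_torus_bundle_def by meson
  then obtain U \<psi> where U: "openin (mtop B) U" "\<pi> p \<in> U"
    and diff: "diffeo (open_sub E (\<pi> -` U)) (prod_mfd (open_sub B U) torus_mfd) \<psi>"
    and fib: "\<And>p. p \<in> points E \<Longrightarrow> \<pi> p \<in> U \<Longrightarrow> fst (\<psi> p) = \<pi> p"
    using pr.image_points[OF p] by (metis IntI vimageI2)
  have UB: "U \<subseteq> points B" using U(1) by (rule openin_subset)
  let ?EU = "open_sub E (\<pi> -` U)" and ?BU = "open_sub B U"
  have points: "points ?EU = points E \<inter> \<pi> -` U" "points ?BU = U"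
    "points torus_mfd = sphere 0 1 \<times> sphere 0 1"
    using UB by (auto simp: open_sub_def torus_mfd_def circle_mfd_def)
  obtain g where g: "smooth_map (prod_mfd ?BU torus_mfd) ?EU g"
    and g\<psi>: "\<And>x. x \<in> points ?EU \<Longrightarrow> g (\<psi> x) = x"
    and \<psi>g: "\<And>y. y \<in> points (prod_mfd ?BU torus_mfd) \<Longrightarrow> \<psi> (g y) = y"
    using diff unfolding diffeo_def by blast
  have \<psi>: "smooth_map ?EU (prod_mfd ?BU torus_mfd) \<psi>"
    using diff unfolding diffeo_def by blast
  define t where "t = snd (\<psi> p)"
  have pU: "p \<in> points ?EU" using p U(2) by (simp add: points)
  have \<psi>p: "\<psi> p = (\<pi> p, t)" using fib[OF p U(2)] by (simp add: t_def prod_eq_iff)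
  have "\<psi> p \<in> points (prod_mfd ?BU torus_mfd)"
    using \<psi> pU unfolding smooth_map_def continuous_map_def by blast
  then have t: "t \<in> sphere 0 1 \<times> sphere 0 1" by (simp add: \<psi>p points)
  obtain C1 where C1: "C1 \<in> atlas circle_mfd" "fst t \<in> fst C1" "inj_on (snd C1) (fst C1)"
    by (rule circle_chart[of "fst t"]) (use t in \<open>simp add: mem_Times_iff\<close>)
  obtain C2 where C2: "C2 \<in> atlas circle_mfd" "snd t \<in> fst C2" "inj_on (snd C2) (fst C2)"
    by (rule circle_chart[of "snd t"]) (use t in \<open>simp add: mem_Times_iff\<close>)
  define T where "T = (fst C1 \<times> fst C2, map_prod (snd C1) (snd C2))"
  have T: "T \<in> atlas torus_mfd" "t \<in> fst T" "inj_on (snd T) (fst T)"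
    using C1 C2 by (auto simp: T_def torus_mfd_def mem_Times_iff intro: atlas_prodI map_prod_inj_on)
  define b' where "b' = (fst b \<inter> U, snd b)"
  define c' where "c' = (fst c \<inter> \<pi> -` U, snd c)"
  have b': "b' \<in> atlas ?BU" "inj_on (snd b') (fst b')" and c': "c' \<in> atlas ?EU"
  proof -
    show "b' \<in> atlas ?BU" "c' \<in> atlas ?EU"
      unfolding b'_def c'_def open_sub_def mfd.sel using b(1) c(1) by blast+
    show "inj_on (snd b') (fst b')"
      using has_chartsD(4)[OF B b(1)] by (simp add: b'_def inj_on_subset[OF _ Int_lower1])
  qed
  define D where "D = (fst b' \<times> fst T, map_prod (snd b') (snd T))"
  have D: "D \<in> atlas (prod_mfd ?BU torus_mfd)"
    unfolding D_def using b'(1) T(1) by (rule atlas_prodI)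
  have paramD: "param D (snd b q, snd T t) = (q, t)" if "q \<in> fst b" "q \<in> U" for q
    using param_prod[OF b'(2) T(3) _ T(2), of q] that by (simp add: D_def b'_def)
  let ?\<theta> = "snd T t" and ?x = "snd b (\<pi> p)"
  have gp: "g (\<pi> p, t) = p" using g\<psi>[OF pU] by (simp add: \<psi>p)
  have "smooth_on (coord_dom D g c') (coord_map D g c')"
    using g D c' unfolding smooth_map_def by blast
  moreover have "(?x, ?\<theta>) \<in> coord_dom D g c'"
    by (rule image_eqI[of _ _ "(\<pi> p, t)"]) (use b c U T gp in \<open>auto simp: D_def b'_def c'_def\<close>)
  ultimately obtain G where G: "((coord_map D g c') has_derivative G) (at (?x, ?\<theta>))"
    using smooth_on_differentiable unfolding differentiable_def by blast
  \<comment> \<open>\<open>g (\<cdot>, t)\<close> is a section of \<open>\<pi>\<close> through \<open>p\<close>, and \<open>\<sigma>\<close> its coordinate expression.\<close>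
  define \<sigma> where "\<sigma> = (\<lambda>z. coord_map D g c' (z, ?\<theta>))"
  have \<sigma>': "(\<sigma> has_derivative (\<lambda>v. G (v, 0))) (at ?x)"
    unfolding \<sigma>_def
    by (rule has_derivative_compose[where g = "coord_map D g c'", OF has_derivative_Pair[OF has_derivative_ident has_derivative_const] G])
  \<comment> \<open>Over these base points the section stays inside the chart \<open>c\<close>. The
    set is open by continuity, as required to differentiate the identity satisfied by the
    section.\<close>
  define W where "W = {q \<in> topspace (subtopology (mtop B) U). g (q, t) \<in> fst c}"
  have "continuous_map (subtopology (mtop B) U) (mtop E) (\<lambda>q. g (q, t))"
  proof -
    have "continuous_map (mtop ?BU) (mtop (prod_mfd ?BU torus_mfd)) (\<lambda>q. (q, t))"
      using t by (simp add: prod_mfd_def torus_mfd_def circle_mfd_def continuous_map_pairedI mem_Times_iff)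
    moreover have "continuous_map (mtop (prod_mfd ?BU torus_mfd)) (mtop ?EU) g"
      using g by (simp add: smooth_map_def)
    ultimately have "continuous_map (mtop ?BU) (mtop ?EU) (g \<circ> (\<lambda>q. (q, t)))"
      by (rule continuous_map_compose)
    then show ?thesis by (simp add: open_sub_def o_def continuous_map_in_subtopology)
  qed
  from openin_continuous_map_preimage[OF this has_chartsD(2)[OF E(2) c(1)]]
  have "openin (mtop B) W" unfolding W_def using U(1) by (rule openin_trans_full)
  then have S: "open (snd b ` (fst b \<inter> W))" by (rule has_chartsD(5)[OF B b(1)])
  have xS: "?x \<in> snd b ` (fst b \<inter> W)"
    using b U UB gp c by (auto simp: W_def)
  have id: "(coord_map c \<pi> b) (\<sigma> z) = z" if z: "z \<in> snd b ` (fst b \<inter> W)" for z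
  proof -
    obtain q where qW: "q \<in> fst b" "q \<in> W" "z = snd b q"
      using z by blast
    then have q: "q \<in> fst b" "q \<in> U" "g (q, t) \<in> fst c" "z = snd b q"
      by (simp_all add: W_def)
    have qt: "(q, t) \<in> points (prod_mfd ?BU torus_mfd)" using q t by (simp add: points)
    have "continuous_map (mtop (prod_mfd ?BU torus_mfd)) (mtop ?EU) g"
      using g by (simp add: smooth_map_def)
    then have "g (q, t) \<in> points ?EU" using qt unfolding continuous_map_def by blast
    then have "\<pi> (g (q, t)) = q" using fib[of "g (q, t)"] \<psi>g[OF qt] by (simp add: points)
    then show ?thesis using q
      by (simp add: \<sigma>_def paramD c'_def param_chart(1)[OF E(2) c(1)])
  qed
  have \<sigma>x: "\<sigma> ?x = snd c p" using b U by (simp add: \<sigma>_def paramD gp c'_def)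
  have "((\<lambda>z. coord_map c \<pi> b (\<sigma> z)) has_derivative (\<lambda>v. chart_deriv c b \<pi> p (G (v, 0)))) (at ?x)"
    by (rule has_derivative_compose[OF \<sigma>']) (simp only: \<sigma>x pr.chart_deriv_has_derivative[OF c(1) b(1) c(2) b(2)])
  then have "((\<lambda>z. z) has_derivative (\<lambda>v. chart_deriv c b \<pi> p (G (v, 0)))) (at ?x)"
    by (rule has_derivative_transform_within_open[OF _ S xS]) (rule id)
  from has_derivative_unique[OF this has_derivative_ident]
  have "chart_deriv c b \<pi> p (G (v, 0)) = v" for v by (metis (no_types))
  then show ?thesis by (rule surjI)
qed

text \<open>\<pi> is constant along orbits. The two speeds k1 and k2 cover the generators of both
  circle factors in one argument.\<close>

lemma orbit_deriv:
  fixes k1 k2 :: real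
  assumes p: "p \<in> points E" and b: "b \<in> atlas B" "\<pi> p \<in> fst b" and c: "c \<in> atlas E" "p \<in> fst c"
  shows "chart_deriv c b \<pi> p
    (fderiv (\<lambda>t. snd c (act (cis (k1 * t)) (cis (k2 * t)) p)) 0 1) = 0"
proof -
  interpret pr: smooth_between E B \<pi> by (rule proj)
  let ?A = "\<lambda>((z1, z2), p). act z1 z2 p"
  let ?\<gamma> = "\<lambda>t. act (cis (k1 * t)) (cis (k2 * t)) p"
  have act: "smooth_map (prod_mfd torus_mfd E) E ?A" "act 1 1 p = p"
    "\<And>z1 z2. z1 \<in> sphere 0 1 \<Longrightarrow> z2 \<in> sphere 0 1 \<Longrightarrow> \<pi> (act z1 z2 p) = \<pi> p"
    using principal p unfolding principal_torus_bundle_def by blast+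
  obtain C where C: "C \<in> atlas circle_mfd" "inj_on (snd C) (fst C)"
      "\<And>t. \<bar>t\<bar> < pi \<Longrightarrow> cis t \<in> fst C \<and> snd C (cis t) = t"
    using circle_chart_one by blast
  define T where "T = (fst C \<times> fst C, map_prod (snd C) (snd C))"
  have T: "T \<in> atlas torus_mfd" "inj_on (snd T) (fst T)"
    using C by (auto simp: T_def torus_mfd_def intro: atlas_prodI map_prod_inj_on)
  define D where "D = (fst T \<times> fst c, map_prod (snd T) (snd c))"
  have D: "D \<in> atlas (prod_mfd torus_mfd E)"
    unfolding D_def using T(1) c(1) by (rule atlas_prodI)
  have paramD: "param D ((t1, t2), snd c p) = ((cis t1, cis t2), p)" if "\<bar>t1\<bar> < pi" "\<bar>t2\<bar> < pi" for t1 t2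
    using param_prod[OF T(2) has_chartsD(4)[OF E(2) c(1)] _ c(2), of "(cis t1, cis t2)"]
      C(3)[OF that(1)] C(3)[OF that(2)]
    by (simp add: D_def T_def)
  have "smooth_on (coord_dom D ?A c) (coord_map D ?A c)"
    using act(1) D c(1) unfolding smooth_map_def by blast
  moreover have "((0, 0), snd c p) \<in> coord_dom D ?A c"
    by (rule image_eqI[of _ _ "((1, 1), p)"])
       (use C(3)[of 0] c(2) act(2) in \<open>auto simp: D_def T_def\<close>)
  ultimately obtain G where G: "((coord_map D ?A c) has_derivative G) (at ((0, 0), snd c p))"
    using smooth_on_differentiable unfolding differentiable_def by blast
  have "((\<lambda>t. ((k1 * t, k2 * t), snd c p)) has_derivative (\<lambda>h. ((k1 * h, k2 * h), 0))) (at (0::real))"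
    by (auto intro!: derivative_eq_intros)
  from has_derivative_compose[where g = "coord_map D ?A c", OF this] G
  have "((\<lambda>t. coord_map D ?A c ((k1 * t, k2 * t), snd c p)) has_derivative (\<lambda>h. G ((k1 * h, k2 * h), 0))) (at 0)"
    by simp
  \<comment> \<open>At these times both angles remain in the circle chart around 1.\<close>
  moreover define R where "R = {t. \<bar>k1 * t\<bar> < pi} \<inter> {t. \<bar>k2 * t\<bar> < pi}"
  have R: "open R" "0 \<in> R"
    unfolding R_def by (auto intro!: open_Int open_Collect_less continuous_intros)
  ultimately have \<gamma>: "((\<lambda>t. snd c (?\<gamma> t)) has_derivative (\<lambda>h. G ((k1 * h, k2 * h), 0))) (at 0)"
    by (elim has_derivative_transform_within_open[OF _ R]) (auto simp: R_def paramD)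
  have "continuous_map (top_of_set UNIV) (mtop E) ?\<gamma>"
  proof -
    have cc: "continuous_map euclidean (top_of_set (sphere 0 1)) (\<lambda>t. cis (k * t))" for k :: real
      by (auto simp: continuous_map_in_subtopology intro!: continuous_intros)
    then have "continuous_map euclidean (mtop (prod_mfd torus_mfd E)) (\<lambda>t. ((cis (k1 * t), cis (k2 * t)), p))"
      using p unfolding prod_mfd_def torus_mfd_def circle_mfd_def mfd.sel
      by (intro continuous_map_pairedI cc) simp
    moreover have "continuous_map (mtop (prod_mfd torus_mfd E)) (mtop E) ?A"
      using act(1) by (simp add: smooth_map_def)
    ultimately have "continuous_map euclidean (mtop E) (?A \<circ> (\<lambda>t. ((cis (k1 * t), cis (k2 * t)), p)))"
      by (rule continuous_map_compose)
    then show ?thesis by (simp add: o_def)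
  qed
  from openin_continuous_map_preimage[OF this has_chartsD(2)[OF E(2) c(1)]]
  have O: "open {t. ?\<gamma> t \<in> fst c}" by simp
  have \<gamma>0: "?\<gamma> 0 = p" using act(2) by simp
  have "((\<lambda>t. coord_map c \<pi> b (snd c (?\<gamma> t))) has_derivative
      (\<lambda>h. chart_deriv c b \<pi> p (G ((k1 * h, k2 * h), 0)))) (at 0)"
    by (rule has_derivative_compose[OF \<gamma>]) (simp only: \<gamma>0 pr.chart_deriv_has_derivative[OF c(1) b(1) c(2) b(2)])
  then have "((\<lambda>t. snd b (\<pi> p)) has_derivative
      (\<lambda>h. chart_deriv c b \<pi> p (G ((k1 * h, k2 * h), 0)))) (at 0)"
    by (rule has_derivative_transform_within_open[OF _ O])
       (use \<gamma>0 c act(3) in \<open>auto simp: param_chart(1)[OF E(2) c(1)]\<close>)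
  from has_derivative_unique[OF this has_derivative_const]
  have "chart_deriv c b \<pi> p (G ((k1 * 1, k2 * 1), 0)) = 0" by (metis (no_types))
  then show ?thesis by (simp add: frechet_derivative_eq[OF \<gamma>])
qed

lemma generator_deriv:
  assumes p: "p \<in> points E" and b: "b \<in> atlas B" "\<pi> p \<in> fst b"
  shows "chart_deriv (chart_at E p) b \<pi> p (generator1 E act p) = 0"
    "chart_deriv (chart_at E p) b \<pi> p (generator2 E act p) = 0"
proof -
  have act: "act 1 1 p = p"
    using principal p unfolding principal_torus_bundle_def by blast
  have at: "chart_at (eucl UNIV) (0::real) = (UNIV, id)"
    unfolding chart_at_def eucl_def by (rule some_equality) auto
  have id: "param (UNIV, id :: real \<Rightarrow> real) = id"
    by (simp add: param_def fun_eq_iff inv_into_f_eq)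
  note c = chart_at[OF E(2) p]
  have "generator1 E act p = fderiv (\<lambda>t. snd (chart_at E p) (act (cis (1 * t)) (cis (0 * t)) p)) 0 1"
    "generator2 E act p = fderiv (\<lambda>t. snd (chart_at E p) (act (cis (0 * t)) (cis (1 * t)) p)) 0 1"
    unfolding generator1_def generator2_def mdiff_def at using act by (simp_all add: id o_def)
  then show "chart_deriv (chart_at E p) b \<pi> p (generator1 E act p) = 0"
    "chart_deriv (chart_at E p) b \<pi> p (generator2 E act p) = 0"
    using orbit_deriv[OF p b c] by metis+
qed

text \<open>The generators are vertical and dual to the connection forms, and by dimension they span
  the kernel of the derivative of \<pi>.\<close>

lemma tangent_eq_0:
  assumes dim: "DIM('e) = DIM('f) + 2" and conn: "connection_forms E act \<theta>1 \<theta>2"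
    and p: "p \<in> points E" and b: "b \<in> atlas B" "\<pi> p \<in> fst b"
    and v: "chart_deriv (chart_at E p) b \<pi> p v = 0" "\<theta>1 p (\<lambda>_. v) = 0" "\<theta>2 p (\<lambda>_. v) = 0"
  shows "v = 0"
proof -
  interpret pr: smooth_between E B \<pi> by (rule proj)
  note c = chart_at[OF E(2) p]
  have "alt_form 1 (\<theta>1 p)" "alt_form 1 (\<theta>2 p)"
    using conn p unfolding connection_forms_def smooth_form_def by blast+
  note lin = this[THEN alt_form_1_linear]
  from linear_kernel_trivial[OF dim pr.linear_chart_deriv[OF c(1) b(1) c(2) b(2)] deriv_surj[OF p b c] lin
      generator_deriv[OF p b] _ _ _ _ v]
  show ?thesis using conn p by (simp add: connection_forms_def)
qed

end

section \<open>The model form\<close>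

lemma UNIV_8: "UNIV = {0, 1, 2, 3, 4, 5, 6, 7 :: 8}"
proof -
  have "card {0, 1, 2, 3, 4, 5, 6, 7 :: 8} = 8" by simp
  then have "card {0, 1, 2, 3, 4, 5, 6, 7 :: 8} = card (UNIV :: 8 set)" by simp
  from card_subset_eq[OF _ _ this] show ?thesis by auto
qed

text \<open>A permutation of the larger set is a transposition moving \<open>a\<close> composed with
  a permutation of \<open>S\<close>; unless the transposition is trivial, it reverses the sign.
  Iteration enumerates the permutations of four points.\<close>

lemma sum_sign_permutes_insert:
  fixes f :: "('i \<Rightarrow> 'i) \<Rightarrow> real"
  assumes "finite S" "a \<notin> S"
  shows "(\<Sum>\<sigma> | \<sigma> permutes insert a S. of_int (sign \<sigma>) * f \<sigma>)
    = (\<Sum>b\<in>insert a S. (if a = b then 1 else - 1) *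
        (\<Sum>q | q permutes S. of_int (sign q) * f (Transposition.transpose a b \<circ> q)))"
proof -
  have "(\<Sum>\<sigma> | \<sigma> permutes insert a S. of_int (sign \<sigma>) * f \<sigma>)
    = (\<Sum>b\<in>insert a S. \<Sum>q | q permutes S.
        of_int (sign (Transposition.transpose a b \<circ> q)) * f (Transposition.transpose a b \<circ> q))"
    using assms by (rule sum_over_permutations_insert)
  also have "\<dots> = (\<Sum>b\<in>insert a S. (if a = b then 1 else - 1) *
        (\<Sum>q | q permutes S. of_int (sign q) * f (Transposition.transpose a b \<circ> q)))"
    unfolding sum_distrib_left
  proof (intro sum.cong refl)
    fix b q assume "q \<in> {q. q permutes S}"
    then have "permutation q" using assms(1) by (auto simp: permutation_permutes)
    then have "sign (Transposition.transpose a b \<circ> q) = (if a = b then 1 else - 1) * sign q"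
      by (subst sign_compose) (auto simp: sign_swap_id permutation_swap_id)
    then show "of_int (sign (Transposition.transpose a b \<circ> q)) * f (Transposition.transpose a b \<circ> q)
        = (if a = b then 1 else - 1) * (of_int (sign q) * f (Transposition.transpose a b \<circ> q))"
      by simp
  qed
  finally show ?thesis .
qed

text \<open>The bridge from the permutation sums of the model form to the recursive products. Over
  the 24 permutations each term of the determinant occurs 2! 2! = 4 times, which the normalisation
  divides out.\<close>

lemma wedge_2_2_eq_wedge_list:
  fixes a b c d :: "'e \<Rightarrow> real"
  shows "wedge 2 2 ((\<lambda>v. a (v 0)) \<and>\<^sub>1 (\<lambda>v. b (v 0))) ((\<lambda>v. c (v 0)) \<and>\<^sub>1 (\<lambda>v. d (v 0))) v
    = wedge_list [a, b, c, d] v"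
proof -
  have w: "((\<lambda>v. f (v 0)) \<and>\<^sub>1 (\<lambda>v. g (v 0))) v = f (v 0) * g (v 1) - f (v 1) * g (v 0)"
    for f g :: "'e \<Rightarrow> real" and v
    by (rule wedge11_cov) auto
  have set: "{..<2 + 2} = insert 3 (insert 2 (insert 1 {0 :: nat}))" by auto
  define f where "f = (\<lambda>\<sigma> :: nat \<Rightarrow> nat. (a (v (\<sigma> 0)) * b (v (\<sigma> 1)) - a (v (\<sigma> 1)) * b (v (\<sigma> 0)))
      * (c (v (\<sigma> 2)) * d (v (\<sigma> 3)) - c (v (\<sigma> 3)) * d (v (\<sigma> 2))))"
  have "wedge 2 2 ((\<lambda>v. a (v 0)) \<and>\<^sub>1 (\<lambda>v. b (v 0))) ((\<lambda>v. c (v 0)) \<and>\<^sub>1 (\<lambda>v. d (v 0))) v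
      = (\<Sum>\<sigma> | \<sigma> permutes insert 3 (insert 2 (insert 1 {0})). of_int (sign \<sigma>) * f \<sigma>) / 4"
    unfolding wedge_def[of 2 2] set w f_def by (simp add: mult.assoc numeral_2_eq_2 numeral_3_eq_3)
  also have "(\<Sum>\<sigma> | \<sigma> permutes insert 3 (insert 2 (insert 1 {0})). of_int (sign \<sigma>) * f \<sigma>)
      = 4 * wedge_list [a, b, c, d] v"
    by (simp add: sum_sign_permutes_insert permutes_sing)
       (simp add: f_def Transposition.transpose_def wedge_cov_def drop_arg_def numeral_2_eq_2 numeral_3_eq_3 atMost_Suc algebra_simps)
  finally show ?thesis by simp
qed

text \<open>The scalings are square roots of the metric coefficients, with uw on the curve because s
  y g_\<omega> = uw (\<Upsilon>1^2 + \<Upsilon>2^2). The minus signs at dy and \<Upsilon>2 fit the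
  coframe to the signs of the model form.\<close>

definition spin_frame :: "real \<Rightarrow> real \<Rightarrow> real \<Rightarrow> real \<Rightarrow> (nat \<Rightarrow> 'e \<Rightarrow> real) \<Rightarrow> 'e \<Rightarrow> real^8" where
  "spin_frame s y u w b a = (\<chi> i.
     if i = 0 then inverse s * b 0 a
     else if i = 1 then inverse y * b 1 a
     else if i = 2 then sqrt (y * s / u) * b 2 a
     else if i = 3 then (- sqrt (y * s * u)) * b 3 a
     else if i = 4 then sqrt (y * s / w) * b 4 a
     else if i = 5 then sqrt (y * s * w) * b 5 a
     else if i = 6 then sqrt (u * w) * b 6 a
     else (- sqrt (u * w)) * b 7 a)"

lemma spin_frame_nth:
  "spin_frame s y u w b a $ 0 = inverse s * b 0 a"
  "spin_frame s y u w b a $ 1 = inverse y * b 1 a"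
  "spin_frame s y u w b a $ 2 = sqrt (y * s / u) * b 2 a"
  "spin_frame s y u w b a $ 3 = (- sqrt (y * s * u)) * b 3 a"
  "spin_frame s y u w b a $ 4 = sqrt (y * s / w) * b 4 a"
  "spin_frame s y u w b a $ 5 = sqrt (y * s * w) * b 5 a"
  "spin_frame s y u w b a $ 6 = sqrt (u * w) * b 6 a"
  "spin_frame s y u w b a $ 7 = (- sqrt (u * w)) * b 7 a"
  by (simp_all add: spin_frame_def)

lemma wedge_list_scale4:
  "wedge_list [\<lambda>x. p * a x, \<lambda>x. q * b x, \<lambda>x. r * c x, \<lambda>x. t * d x] v = p * q * r * t * wedge_list [a, b, c, d] v"
  by (simp add: wedge_cov_lin mult_ac)

lemma Phi0_spin_frame:
  assumes pos: "s > 0" "y > 0" "u > 0" "w > 0"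
  shows "Phi0 (\<lambda>i. spin_frame s y u w b (v i)) = cayley_form s y u w b v"
proof -
  let ?A = "spin_frame s y u w b"
  have 4: "dx4 i j k l (\<lambda>m. ?A (v m)) = wedge_list [\<lambda>a. ?A a $ i, \<lambda>a. ?A a $ j, \<lambda>a. ?A a $ k, \<lambda>a. ?A a $ l] v"
    for i j k l
  proof -
    have "dx4 i j k l (\<lambda>m. ?A (v m)) = wedge_list [\<lambda>x. x $ i, \<lambda>x. x $ j, \<lambda>x. x $ k, \<lambda>x. x $ l] (\<lambda>m. ?A (v m))"
      unfolding dx4_def dx_def[abs_def] by (rule wedge_2_2_eq_wedge_list)
    also have "\<dots> = wedge_list [\<lambda>a. ?A a $ i, \<lambda>a. ?A a $ j, \<lambda>a. ?A a $ k, \<lambda>a. ?A a $ l] v"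
      by (simp add: wedge_cov_def drop_arg_comp)
    finally show ?thesis .
  qed
  \<comment> \<open>In terms of these square roots each product of four scalings is a rational
    expression, so the comparison is field arithmetic.\<close>
  define S Y U W where "S = sqrt s" "Y = sqrt y" "U = sqrt u" "W = sqrt w"
  have pos': "S > 0" "Y > 0" "U > 0" "W > 0" and sq: "s = S * S" "y = Y * Y" "u = U * U" "w = W * W"
    using pos by (simp_all add: S_Y_U_W_def)
  have sqrts: "sqrt (y * s / u) = Y * S / U" "sqrt (y * s * u) = Y * S * U" "sqrt (y * s / w) = Y * S / W"
    "sqrt (y * s * w) = Y * S * W" "sqrt (u * w) = U * W"
    by (simp_all add: S_Y_U_W_def real_sqrt_mult real_sqrt_divide)
  show ?thesis
    unfolding Phi0_def 4 spin_frame_nth wedge_list_scale4 sqrts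
    using pos' by (simp add: cayley_form_def cayley_terms_def sq field_simps del: wedge_list.simps)
qed

lemma linear_spin_frame:
  assumes "\<And>i. i < 8 \<Longrightarrow> linear (b i)"
  shows "linear (spin_frame s y u w b)"
  by (rule linearI)
     (simp_all add: spin_frame_def vec_eq_iff assms[THEN linear_add] assms[THEN linear_cmul] algebra_simps)

lemma inner_spin_frame:
  assumes "s > 0" "y > 0" "u > 0" "w > 0"
  shows "spin_frame s y u w b a \<bullet> spin_frame s y u w b a'
    = s powi (- 2) * (b 0 a * b 0 a') + y powi (- 2) * (b 1 a * b 1 a')
      + y * s * (inverse u * (b 2 a * b 2 a') + u * (b 3 a * b 3 a')
        + inverse w * (b 4 a * b 4 a') + w * (b 5 a * b 5 a'))
      + u * w * (b 6 a * b 6 a' + b 7 a * b 7 a')"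
proof -
  have sq: "sqrt t * x * (sqrt t * x') = t * (x * x')" "- (sqrt t) * x * (- (sqrt t) * x') = t * (x * x')" if "t > 0" for t x x' :: real
  proof -
    have "sqrt t * x * (sqrt t * x') = (sqrt t * sqrt t) * (x * x')" by (simp only: mult_ac)
    then show "sqrt t * x * (sqrt t * x') = t * (x * x')" using that by simp
    then show "- (sqrt t) * x * (- (sqrt t) * x') = t * (x * x')" by simp
  qed
  have "spin_frame s y u w b a \<bullet> spin_frame s y u w b a' = (\<Sum>i\<in>UNIV. spin_frame s y u w b a $ i * spin_frame s y u w b a' $ i)"
    by (simp add: inner_vec_def)
  also have "\<dots> = inverse s * b 0 a * (inverse s * b 0 a') + inverse y * b 1 a * (inverse y * b 1 a')
      + y * s / u * (b 2 a * b 2 a') + y * s * u * (b 3 a * b 3 a') + y * s / w * (b 4 a * b 4 a')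
      + y * s * w * (b 5 a * b 5 a') + u * w * (b 6 a * b 6 a') + u * w * (b 7 a * b 7 a')"
    unfolding UNIV_8 using assms
    by (simp add: spin_frame_nth sq[OF divide_pos_pos] sq[OF mult_pos_pos] del: mult_minus_left mult_minus_right)
  also have "\<dots> = s powi (- 2) * (b 0 a * b 0 a') + y powi (- 2) * (b 1 a * b 1 a')
      + y * s * (inverse u * (b 2 a * b 2 a') + u * (b 3 a * b 3 a')
        + inverse w * (b 4 a * b 4 a') + w * (b 5 a * b 5 a'))
      + u * w * (b 6 a * b 6 a' + b 7 a * b 7 a')"
    by (simp add: power_int_minus power2_eq_square divide_inverse algebra_simps)
  finally show ?thesis .
qed

section \<open>Holomorphic forms\<close>

text \<open>Real linearity and compatibility with multiplication by i make the form complex linear,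
  hence determined by its value on 1.\<close>

lemma holomorphic_10_form_eq:
  assumes \<Upsilon>: "holomorphic_10_form X \<Upsilon>" and p: "p \<in> points X"
  shows "\<Upsilon> p v = v 0 * \<Upsilon> p (\<lambda>_. 1)"
proof -
  have alt: "alt_form 1 (\<Upsilon> p)" and J: "\<And>v. \<Upsilon> p (\<lambda>i. \<i> * v i) = \<i> * \<Upsilon> p v"
    using \<Upsilon> p unfolding holomorphic_10_form_def J_form_def by blast+
  have lin: "linear (\<lambda>a. \<Upsilon> p (\<lambda>_. a))" by (rule alt_form_1_linear[OF alt])
  have v0: "v 0 = Re (v 0) *\<^sub>R 1 + Im (v 0) *\<^sub>R \<i>" by (simp add: complex_eq_iff)
  have "\<Upsilon> p v = \<Upsilon> p (\<lambda>_. Re (v 0) *\<^sub>R 1 + Im (v 0) *\<^sub>R \<i>)"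
    by (rule trans[OF alt_form_1_eq[OF alt, of v] arg_cong[OF v0, of "\<lambda>a. \<Upsilon> p (\<lambda>_. a)"]])
  also have "\<dots> = Re (v 0) *\<^sub>R \<Upsilon> p (\<lambda>_. 1) + Im (v 0) *\<^sub>R \<Upsilon> p (\<lambda>_. \<i>)"
    using linear_add[OF lin] linear_cmul[OF lin] by simp
  also have "\<Upsilon> p (\<lambda>_. \<i>) = \<i> * \<Upsilon> p (\<lambda>_. 1)" using J[of "\<lambda>_. 1"] by simp
  also have "Re (v 0) *\<^sub>R \<Upsilon> p (\<lambda>_. 1) + Im (v 0) *\<^sub>R (\<i> * \<Upsilon> p (\<lambda>_. 1)) = v 0 * \<Upsilon> p (\<lambda>_. 1)"
    by (simp add: complex_eq_iff algebra_simps)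
  finally show ?thesis .
qed

text \<open>Holomorphic transition maps have complex linear derivatives, so the shape h dz persists
  in every chart.\<close>

lemma local_rep_holomorphic_10_form:
  assumes X: "complex_curve X" and \<Upsilon>: "holomorphic_10_form X \<Upsilon>" and c: "c \<in> atlas X" "z \<in> img c"
  shows "local_rep X c \<Upsilon> z v = v 0 * local_rep X c \<Upsilon> z (\<lambda>_. 1)"
proof -
  have sX: "smooth_atlas X" by (rule complex_curve_smooth_atlas[OF X])
  note X' = smooth_atlasD[OF sX]
  obtain p where p: "p \<in> fst c" "z = snd c p" using c(2) by auto
  have pX: "p \<in> points X" using has_chartsD(1)[OF X' c(1)] p by blast
  let ?d = "chart_at X p"
  note d = chart_at[OF X' pX]
  have "open (snd c ` (fst c \<inter> fst ?d))"
    by (rule has_chartsD(5)[OF X' c(1) has_chartsD(2)[OF X' d(1)]])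
  moreover have "(snd ?d \<circ> param c) holomorphic_on (snd c ` (fst c \<inter> fst ?d))"
    using X c(1) d(1) by (simp add: complex_curve_def)
  moreover have "snd c p \<in> snd c ` (fst c \<inter> fst ?d)" using p d by blast
  ultimately have "((snd ?d \<circ> param c) has_field_derivative deriv (snd ?d \<circ> param c) z) (at z)"
    unfolding p(2) using holomorphic_derivI by blast
  then have "fderiv (snd ?d \<circ> param c) z = (\<lambda>a. deriv (snd ?d \<circ> param c) z * a)"
    by (intro frechet_derivative_eq) (simp add: has_field_derivative_def)
  then have "chart_deriv c ?d id p a = deriv (snd ?d \<circ> param c) z * a" for a
    by (simp add: chart_deriv_def p(2))
  then show ?thesis
    unfolding p(2) local_rep_chart[OF X' c(1) p(1)]
    by (subst (1 2) holomorphic_10_form_eq[OF \<Upsilon> pX]) (simp add: p(2))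
qed

text \<open>A general real-linear \<open>r\<close> covers \<Upsilon>1 and \<Upsilon>2 together, as
  the real part and minus the imaginary part. The derivative of r(a H) along b depends only on the
  product of a and b, so antisymmetrising it gives 0.\<close>

lemma holomorphic_10_form_real_part:
  fixes r :: "complex \<Rightarrow> real"
  assumes X: "complex_curve X" and \<Upsilon>: "holomorphic_10_form X \<Upsilon>" and r: "linear r"
  shows "smooth_form 1 X (\<lambda>p v. r (\<Upsilon> p v))"
    "p \<in> points X \<Longrightarrow> ext_d 1 X (\<lambda>p v. r (\<Upsilon> p v)) p v = 0"
proof -
  have sX: "smooth_atlas X" by (rule complex_curve_smooth_atlas[OF X])
  note X' = smooth_atlasD[OF sX]
  define H where "H = (\<lambda>c z. local_rep X c \<Upsilon> z (\<lambda>_. 1))"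
  have hol: "H c holomorphic_on (img c)" if "c \<in> atlas X" for c
    using \<Upsilon> that by (simp add: holomorphic_10_form_def H_def)
  have rep: "local_rep X c (\<lambda>p v. r (\<Upsilon> p v)) z v = r (v 0 * H c z)"
    if "c \<in> atlas X" "z \<in> img c" for c z v
    using local_rep_holomorphic_10_form[OF X \<Upsilon> that, of v]
    by (simp add: local_rep_def pullback_def H_def)
  have lin: "linear (\<lambda>a. r (a * h))" for h
    using r by (auto simp: linear_iff distrib_right)
  show "smooth_form 1 X (\<lambda>p v. r (\<Upsilon> p v))"
    unfolding smooth_form_def
  proof (intro conjI ballI allI)
    fix p assume "p \<in> points X"
    show "alt_form 1 (\<lambda>v. r (\<Upsilon> p v))"
      by (rule alt_form_1I[OF _ lin]) (subst holomorphic_10_form_eq[OF \<Upsilon> \<open>p \<in> points X\<close>], rule refl)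
  next
    fix c and v :: "nat \<Rightarrow> complex" assume c: "c \<in> atlas X"
    note V = has_chartsD(3)[OF X' c]
    have "linear (\<lambda>z. r (v 0 * z))" using lin[of "v 0"] by (simp add: mult.commute)
    then have "smooth_on (img c) (\<lambda>z. r (v 0 * H c z))"
      by (rule smooth_on_linear_comp[OF V _ holomorphic_on_smooth_on[OF V hol[OF c]]])
    then show "smooth_on (img c) (\<lambda>z. local_rep X c (\<lambda>p v. r (\<Upsilon> p v)) z v)"
      by (rule smooth_on_cong[OF V, rotated]) (rule rep[OF c, symmetric])
  qed
  assume p: "p \<in> points X"
  let ?c = "chart_at X p"
  note c = chart_at[OF X' p]
  note V = has_chartsD(3)[OF X' c(1)]
  have x: "snd ?c p \<in> img ?c" using c by blast
  let ?h = "deriv (H ?c) (snd ?c p)"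
  have D: "fderiv (\<lambda>z. r (a * H ?c z)) (snd ?c p) b = r (a * (?h * b))" for a b
  proof -
    have "(H ?c has_derivative (\<lambda>b. ?h * b)) (at (snd ?c p))"
      using holomorphic_derivI[OF hol[OF c(1)] V x] by (simp add: has_field_derivative_def)
    from bounded_linear.has_derivative[OF _ has_derivative_mult_right[OF this, of a], of r]
    have "((\<lambda>z. r (a * H ?c z)) has_derivative (\<lambda>b. r (a * (?h * b)))) (at (snd ?c p))"
      using r by (simp add: linear_conv_bounded_linear)
    then show ?thesis by (simp add: frechet_derivative_eq)
  qed
  have "ext_d 1 X (\<lambda>p v. r (\<Upsilon> p v)) p v = ext_d_eucl 1 (\<lambda>z v. r (v 0 * H ?c z)) (snd ?c p) v"
    unfolding ext_d_def by (rule ext_d_eucl_cong[OF V x rep[OF c(1)]])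
  also have "\<dots> = 0"
    unfolding ext_d_eucl_1[OF V x alt_form_1I[OF refl lin]] D by (simp add: mult_ac)
  finally show "ext_d 1 X (\<lambda>p v. r (\<Upsilon> p v)) p v = 0" .
qed

text \<open>A real-linear functional is the real part of multiplication by some \<open>l\<close>;
  division by h expresses it in the basis Re(h x), -Im(h x). Applied to a differential, the second
  equation gives the coefficients of d^c.\<close>

lemma complex_linear_functional:
  fixes L :: "complex \<Rightarrow> real"
  assumes "linear L" "h \<noteq> 0"
  shows "\<exists>a b. \<forall>x. L x = a * Re (h * x) + b * (- Im (h * x)) \<and> L (\<i> * x) = a * (- Im (h * x)) - b * Re (h * x)"
proof -
  define l where "l = Complex (L 1) (- L \<i>)"
  have L: "L x = Re (l * x)" for x
  proof -
    have "x = Re x *\<^sub>R 1 + Im x *\<^sub>R \<i>" by (simp add: complex_eq_iff)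
    then have "L x = L (Re x *\<^sub>R 1 + Im x *\<^sub>R \<i>)" by (rule arg_cong)
    also have "\<dots> = Re x * L 1 + Im x * L \<i>"
      using assms(1) by (simp add: linear_add linear_cmul)
    finally show ?thesis by (simp add: l_def)
  qed
  define m where "m = l / h"
  have l: "l = m * h" using assms(2) by (simp add: m_def)
  have "L x = Re m * Re (h * x) + Im m * (- Im (h * x))" for x
    unfolding L l by (simp add: algebra_simps)
  moreover have "L (\<i> * x) = Re m * (- Im (h * x)) - Im m * Re (h * x)" for x
    unfolding L l by (simp add: algebra_simps)
  ultimately show ?thesis by blast
qed

section \<open>Families of functions on the base\<close>

text \<open>In a chart the family becomes one function of point and parameter. Composed with the
  pair (f, g), its differential splits into the one on \<open>X\<close> at a frozen parameter and
  the parameter derivative times dg.\<close>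

lemma smooth_family_fun:
  fixes X :: "('a, 'e::euclidean_space) mfd" and P :: "('p, 'f::euclidean_space) mfd"
  assumes fam: "smooth_family 0 X T (\<lambda>t p v. u t p)" and T: "open (T :: real set)"
    and f: "smooth_between P X f" and g: "smooth_fun P g" "\<And>q. q \<in> points P \<Longrightarrow> g q \<in> T"
  shows "smooth_fun P (\<lambda>q. u (g q) (f q))"
    "q \<in> points P \<Longrightarrow> d_fun P (\<lambda>q. u (g q) (f q)) q v
      = d_fun X (u (g q)) (f q) (\<lambda>i. mdiff P X f q (v i)) + deriv (\<lambda>t. u t (f q)) (g q) * d_fun P g q v"
    "t \<in> T \<Longrightarrow> smooth_fun X (u t)"
    "t \<in> T \<Longrightarrow> p \<in> points X \<Longrightarrow> ((\<lambda>t. u t p) has_real_derivative deriv (\<lambda>t. u t p) t) (at t)"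
proof -
  interpret f: smooth_between P X f by fact
  note X' = f.N
  define \<Phi> :: "('a, 'e) chart \<Rightarrow> 'e \<times> real \<Rightarrow> real" where "\<Phi> = (\<lambda>d z. u (snd z) (param d (fst z)))"
  have \<Phi>: "smooth_on (img d \<times> T) (\<Phi> d)" if "d \<in> atlas X" for d
  proof -
    \<comment> \<open>The argument sequence of a 0-form is irrelevant; the zero sequence is
      inserted.\<close>
    have "smooth_on (img d \<times> T) (\<lambda>(x, t). local_rep X d (\<lambda>p v. u t p) x (\<lambda>_. 0))"
      using fam that by (simp add: smooth_family_def)
    moreover have "(\<lambda>(x, t). local_rep X d (\<lambda>p v. u t p) x (\<lambda>_. 0)) = \<Phi> d"
      by (auto simp: local_rep_def pullback_def \<Phi>_def)
    ultimately show ?thesis by simp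
  qed
  have comp: "open (coord_dom c f d)"
    "smooth_on (coord_dom c f d) (\<lambda>x. ((coord_map c f d) x, (g \<circ> param c) x))"
    "(\<lambda>x. ((coord_map c f d) x, (g \<circ> param c) x)) ` (coord_dom c f d) \<subseteq> img d \<times> T"
    "x \<in> coord_dom c f d \<Longrightarrow> \<Phi> d ((coord_map c f d) x, (g \<circ> param c) x) = ((\<lambda>q. u (g q) (f q)) \<circ> param c) x"
    if c: "c \<in> atlas P" and d: "d \<in> atlas X" for c d x
  proof -
    show S: "open (coord_dom c f d)" by (rule f.open_rep[OF c d])
    show "smooth_on (coord_dom c f d) (\<lambda>x. ((coord_map c f d) x, (g \<circ> param c) x))"
      by (rule smooth_on_Pair[OF S f.smooth_rep[OF c d] smooth_on_subset[OF smooth_funD[OF g(1) c]]]) blast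
    show "(\<lambda>x. ((coord_map c f d) x, (g \<circ> param c) x)) ` (coord_dom c f d) \<subseteq> img d \<times> T"
      using has_chartsD(1)[OF f.M c] by (auto simp: param_chart(1)[OF f.M c] intro!: g(2))
    show "\<Phi> d ((coord_map c f d) x, (g \<circ> param c) x) = ((\<lambda>q. u (g q) (f q)) \<circ> param c) x"
      if "x \<in> coord_dom c f d"
      using f.rep_maps(2)[OF c that] by (simp add: \<Phi>_def param_chart(1)[OF X' d])
  qed
  show "smooth_fun P (\<lambda>q. u (g q) (f q))"
    unfolding smooth_fun_def
  proof (intro ballI smooth_on_local)
    fix c x assume c: "c \<in> atlas P" and "x \<in> img c"
    then obtain q where q: "q \<in> fst c" "x = snd c q" by auto
    have qP: "q \<in> points P" using has_chartsD(1)[OF f.M c] q by blast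
    note d = chart_at[OF X' f.image_points[OF qP]]
    note cc = comp[OF c d(1)]
    have "smooth_on (coord_dom c f (chart_at X (f q))) ((\<lambda>q. u (g q) (f q)) \<circ> param c)"
      by (rule smooth_on_cong[OF cc(1,4) smooth_on_compose[OF cc(1) open_Times[OF has_chartsD(3)[OF X' d(1)] T] \<Phi>[OF d(1)] cc(2,3)]])
    then show "\<exists>S. open S \<and> x \<in> S \<and> smooth_on S ((\<lambda>q. u (g q) (f q)) \<circ> param c)"
      using cc(1) q d by blast
  qed
  show "smooth_fun X (u t)" if t: "t \<in> T" for t
    unfolding smooth_fun_def
  proof
    fix d assume d: "d \<in> atlas X"
    note V = has_chartsD(3)[OF X' d]
    have "smooth_on (img d) (\<lambda>x. (x, t))"
      by (rule smooth_on_Pair[OF V smooth_on_linear smooth_on_const]) (simp add: linear_iff)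
    from smooth_on_compose[OF V open_Times[OF V T] \<Phi>[OF d] this] t
    show "smooth_on (img d) (u t \<circ> param d)" by (auto simp: \<Phi>_def o_def)
  qed
  have D2: "((\<lambda>t. u t (param d x)) has_real_derivative fderiv (\<Phi> d) (x, t) (0, 1)) (at t)"
    if "d \<in> atlas X" "x \<in> img d" "t \<in> T" for d x t
  proof -
    have 0: "(\<Phi> d has_derivative fderiv (\<Phi> d) (x, t)) (at (x, t))"
      using \<Phi>[OF that(1)] that by (intro smooth_on_has_derivative) auto
    have 1: "((\<lambda>t. \<Phi> d (x, t)) has_derivative (\<lambda>h. fderiv (\<Phi> d) (x, t) (0, h))) (at t)"
      by (rule has_derivative_compose[OF has_derivative_Pair[OF has_derivative_const has_derivative_ident] 0])
    have 2: "(\<lambda>h. fderiv (\<Phi> d) (x, t) (0, h)) = (*) (fderiv (\<Phi> d) (x, t) (0, 1))"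
    proof
      show "fderiv (\<Phi> d) (x, t) (0, h) = fderiv (\<Phi> d) (x, t) (0, 1) * h" for h
        using linear_cmul[OF has_derivative_linear[OF 0], of h "(0, 1)"] by simp
    qed
    show ?thesis
      using 1 unfolding 2 has_field_derivative_def by (simp only: \<Phi>_def fst_conv snd_conv)
  qed
  show "((\<lambda>t. u t p) has_real_derivative deriv (\<lambda>t. u t p) t) (at t)" if "t \<in> T" "p \<in> points X" for t p
  proof -
    note d = chart_at[OF X' that(2)]
    have D: "((\<lambda>t. u t p) has_real_derivative fderiv (\<Phi> (chart_at X p)) (snd (chart_at X p) p, t) (0, 1)) (at t)"
      using D2[OF d(1) imageI[OF d(2)] that(1)] unfolding param_chart(1)[OF X' d] .
    show ?thesis unfolding DERIV_imp_deriv[OF D] by (rule D)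
  qed
  show "d_fun P (\<lambda>q. u (g q) (f q)) q v
      = d_fun X (u (g q)) (f q) (\<lambda>i. mdiff P X f q (v i)) + deriv (\<lambda>t. u t (f q)) (g q) * d_fun P g q v"
    if q: "q \<in> points P" for q v
  proof -
    let ?c = "chart_at P q" and ?d = "chart_at X (f q)"
    note c = chart_at[OF f.M q] and d = chart_at[OF X' f.image_points[OF q]]
    note cc = comp[OF c(1) d(1)]
    let ?x = "snd ?c q" and ?y = "(snd ?d (f q), g q)"
    have x: "?x \<in> coord_dom ?c f ?d" using c d by blast
    let ?D = "fderiv (\<Phi> ?d) ?y"
    have 0: "(\<Phi> ?d has_derivative ?D) (at ?y)"
      using \<Phi>[OF d(1)] d g(2)[OF q] by (intro smooth_on_has_derivative) auto
    have fg: "((\<lambda>x. ((coord_map ?c f ?d) x, (g \<circ> param ?c) x)) has_derivative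
        (\<lambda>a. (chart_deriv ?c ?d f q a, fun_deriv ?c g q a))) (at ?x)"
      by (rule has_derivative_Pair[OF f.chart_deriv_has_derivative[OF c(1) d(1) c(2) d(2)] fun_deriv_has_derivative[OF g(1) c]])
    have "((\<lambda>x. \<Phi> ?d ((coord_map ?c f ?d) x, (g \<circ> param ?c) x)) has_derivative
        (\<lambda>a. ?D (chart_deriv ?c ?d f q a, fun_deriv ?c g q a))) (at ?x)"
      by (rule has_derivative_compose[OF fg]) (use 0 in \<open>simp add: param_chart(1)[OF f.M c]\<close>)
    then have "(((\<lambda>q. u (g q) (f q)) \<circ> param ?c) has_derivative
        (\<lambda>a. ?D (chart_deriv ?c ?d f q a, fun_deriv ?c g q a))) (at ?x)"
      by (rule has_derivative_transform_within_open[OF _ cc(1) x cc(4)])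
    then have 1: "fun_deriv ?c (\<lambda>q. u (g q) (f q)) q (v 0) = ?D (chart_deriv ?c ?d f q (v 0), fun_deriv ?c g q (v 0))"
      by (simp add: fun_deriv_def frechet_derivative_eq)
    have "((\<lambda>x. \<Phi> ?d (x, g q)) has_derivative (\<lambda>h. ?D (h, 0))) (at (snd ?d (f q)))"
      by (rule has_derivative_compose[OF has_derivative_Pair[OF has_derivative_ident has_derivative_const] 0])
    then have 2: "fun_deriv ?d (u (g q)) (f q) h = ?D (h, 0)" for h
      unfolding fun_deriv_def by (simp add: \<Phi>_def o_def frechet_derivative_eq)
    have 3: "deriv (\<lambda>t. u t (f q)) (g q) = ?D (0, 1)"
      using D2[OF d(1) imageI[OF d(2)] g(2)[OF q]] unfolding param_chart(1)[OF X' d] by (rule DERIV_imp_deriv)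
    have 4: "?D (a, h) = ?D (a, 0) + h * ?D (0, 1)" for a h
      using linear_add[OF has_derivative_linear[OF 0], of "(a, 0)" "(0, h)"]
        linear_cmul[OF has_derivative_linear[OF 0], of h "(0, 1)"] by simp
    show ?thesis
      unfolding 1 d_fun_eq[OF f.M q] d_fun_eq[OF X' f.image_points[OF q]] 2 3 mdiff_eq
        4[of _ "fun_deriv ?c g q (v 0)"] by simp
  qed
qed

section \<open>The Cayley form is a smooth alternating form\<close>

lemma wedge_list_comp:
  "wedge_list as (\<lambda>i. L (v i)) = wedge_list (map (\<lambda>\<phi> a. \<phi> (L a)) as) v"
  by (induction as arbitrary: v) (simp_all add: wedge_cov_def drop_arg_comp)

lemma cayley_form_comp:
  "cayley_form s y u w b (\<lambda>i. L (v i)) = cayley_form s y u w (\<lambda>i a. b i (L a)) v"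
  by (simp add: cayley_form_def wedge_list_comp o_def)

text \<open>With the Laplace expansion of the 4 by 4 determinant written out, linearity and
  alternation can be checked slot by slot.\<close>

lemma alt_form_wedge_list_4:
  fixes a b c d :: "'e::real_vector \<Rightarrow> real"
  assumes "linear a" "linear b" "linear c" "linear d"
  shows "alt_form 4 (wedge_list [a, b, c, d])"
proof -
  have eq: "wedge_list [a, b, c, d] v =
      a (v 0) * (b (v 1) * (c (v 2) * d (v 3) - c (v 3) * d (v 2)) - b (v 2) * (c (v 1) * d (v 3) - c (v 3) * d (v 1))
        + b (v 3) * (c (v 1) * d (v 2) - c (v 2) * d (v 1)))
      - a (v 1) * (b (v 0) * (c (v 2) * d (v 3) - c (v 3) * d (v 2)) - b (v 2) * (c (v 0) * d (v 3) - c (v 3) * d (v 0))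
        + b (v 3) * (c (v 0) * d (v 2) - c (v 2) * d (v 0)))
      + a (v 2) * (b (v 0) * (c (v 1) * d (v 3) - c (v 3) * d (v 1)) - b (v 1) * (c (v 0) * d (v 3) - c (v 3) * d (v 0))
        + b (v 3) * (c (v 0) * d (v 1) - c (v 1) * d (v 0)))
      - a (v 3) * (b (v 0) * (c (v 1) * d (v 2) - c (v 2) * d (v 1)) - b (v 1) * (c (v 0) * d (v 2) - c (v 2) * d (v 0))
        + b (v 2) * (c (v 0) * d (v 1) - c (v 1) * d (v 0)))" for v
    by (simp add: wedge_cov_def drop_arg_def numeral_2_eq_2 numeral_3_eq_3 algebra_simps)
  have 4: "i = 0 \<or> i = 1 \<or> i = 2 \<or> i = 3" if "i < 4" for i :: nat
    using that by linarith
  show ?thesis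
    unfolding alt_form_def
  proof (intro conjI allI impI)
    fix v w :: "nat \<Rightarrow> 'e" assume "\<forall>i<4. v i = w i"
    then have "v 0 = w 0" "v 1 = w 1" "v 2 = w 2" "v 3 = w 3" by auto
    then show "wedge_list [a, b, c, d] v = wedge_list [a, b, c, d] w" by (simp only: eq)
  next
    fix i :: nat and v :: "nat \<Rightarrow> 'e" assume "i < 4"
    note lin = assms[THEN linear_add] assms[THEN linear_cmul]
    show "linear (\<lambda>x. wedge_list [a, b, c, d] (v(i := x)))"
      unfolding eq using 4[OF \<open>i < 4\<close>]
      by (elim disjE) (rule linearI; simp add: lin algebra_simps)+
  next
    fix i j :: nat and v :: "nat \<Rightarrow> 'e" assume "i < 4" "j < 4" "i \<noteq> j" "v i = v j"
    then show "wedge_list [a, b, c, d] v = 0"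
      unfolding eq using 4[OF \<open>i < 4\<close>] 4[OF \<open>j < 4\<close>]
      by (elim disjE) (simp_all add: algebra_simps)
  qed
qed

lemma alt_form_add_cmul:
  fixes \<phi> \<psi> :: "(nat \<Rightarrow> 'e::real_vector) \<Rightarrow> real"
  assumes "alt_form k \<phi>" "alt_form k \<psi>"
  shows "alt_form k (\<lambda>v. t * \<phi> v + \<psi> v)"
proof -
  have \<phi>: "\<And>v w. (\<forall>i<k. v i = w i) \<Longrightarrow> \<phi> v = \<phi> w" "\<And>i v. i < k \<Longrightarrow> linear (\<lambda>x. \<phi> (v(i := x)))"
    "\<And>i j v. i < k \<Longrightarrow> j < k \<Longrightarrow> i \<noteq> j \<Longrightarrow> v i = v j \<Longrightarrow> \<phi> v = 0"
    using assms(1) by (simp_all add: alt_form_def)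
  have \<psi>: "\<And>v w. (\<forall>i<k. v i = w i) \<Longrightarrow> \<psi> v = \<psi> w" "\<And>i v. i < k \<Longrightarrow> linear (\<lambda>x. \<psi> (v(i := x)))"
    "\<And>i j v. i < k \<Longrightarrow> j < k \<Longrightarrow> i \<noteq> j \<Longrightarrow> v i = v j \<Longrightarrow> \<psi> v = 0"
    using assms(2) by (simp_all add: alt_form_def)
  show ?thesis
    unfolding alt_form_def
  proof (intro conjI allI impI)
    fix v w :: "nat \<Rightarrow> 'e" assume "\<forall>i<k. v i = w i"
    then show "t * \<phi> v + \<psi> v = t * \<phi> w + \<psi> w" using \<phi>(1)[of v w] \<psi>(1)[of v w] by simp
  next
    fix i and v :: "nat \<Rightarrow> 'e" assume "i < k"
    from linear_compose_add[OF linear_compose_scale_right[OF \<phi>(2)[OF this], of t] \<psi>(2)[OF this]]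
    show "linear (\<lambda>x. t * \<phi> (v(i := x)) + \<psi> (v(i := x)))" by simp
  next
    fix i j and v :: "nat \<Rightarrow> 'e" assume "i < k" "j < k" "i \<noteq> j" "v i = v j"
    then show "t * \<phi> v + \<psi> v = 0" using \<phi>(3)[of i j v] \<psi>(3)[of i j v] by simp
  qed
qed

lemma alt_form_cayley_form:
  fixes b :: "nat \<Rightarrow> 'e::real_vector \<Rightarrow> real"
  assumes "\<And>i. i < 8 \<Longrightarrow> linear (b i)"
  shows "alt_form 4 (cayley_form s y u w b)"
proof -
  have *: "alt_form 4 (\<lambda>v. \<Sum>(c, I)\<leftarrow>L. c * wedge_list (map b I) v)"
    if "\<forall>(c, I)\<in>set L. \<exists>i j k l. I = [i, j, k, l] \<and> i < 8 \<and> j < 8 \<and> k < 8 \<and> l < 8" for L :: "(real \<times> nat list) list"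
    using that
  proof (induction L)
    case Nil
    then show ?case by (simp add: alt_form_def linear_iff)
  next
    case (Cons t L)
    obtain c i j k l where t: "t = (c, [i, j, k, l])" "i < 8" "j < 8" "k < 8" "l < 8"
      using Cons.prems by (cases t) auto
    have "alt_form 4 (wedge_list (map b [i, j, k, l]))"
      unfolding list.map by (intro alt_form_wedge_list_4 assms t)
    from alt_form_add_cmul[OF this Cons.IH, of c] Cons.prems show ?case
      by (simp add: t del: wedge_list.simps)
  qed
  have "cayley_form s y u w b = (\<lambda>v. \<Sum>(c, I)\<leftarrow>cayley_terms s y u w. c * wedge_list (map b I) v)"
    by (simp add: fun_eq_iff cayley_form_def)
  then show ?thesis
    by (simp only:) (rule *, simp add: cayley_terms_def)
qed

lemma less_8_cases:
  assumes "i < (8 :: nat)"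
  obtains "i = 0" | "i = 1" | "i = 2" | "i = 3" | "i = 4" | "i = 5" | "i = 6" | "i = 7"
  using assms by linarith

lemma smooth_on_minus:
  fixes f :: "'e::euclidean_space \<Rightarrow> real"
  shows "open S \<Longrightarrow> smooth_on S f \<Longrightarrow> smooth_on S (\<lambda>x. - f x)"
  using smooth_on_linear_comp[of S "\<lambda>t. - t" f] by (simp add: linear_iff)

lemma smooth_on_wedge_list:
  fixes b :: "nat \<Rightarrow> 'e::euclidean_space \<Rightarrow> 'v \<Rightarrow> real"
  assumes "open S" "\<And>i a. i \<in> set I \<Longrightarrow> smooth_on S (\<lambda>z. b i z a)"
  shows "smooth_on S (\<lambda>z. wedge_list (map (\<lambda>i. b i z) I) v)"
  using assms(2)
proof (induction I arbitrary: v)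
  case Nil
  then show ?case by (simp add: smooth_on_const)
next
  case (Cons i I)
  then show ?case
    unfolding list.map wedge_list.simps wedge_cov_def length_map
    by (intro smooth_on_sum smooth_on_mult assms(1) smooth_on_const) auto
qed

lemma smooth_on_cayley_form:
  fixes b :: "nat \<Rightarrow> 'e::euclidean_space \<Rightarrow> 'v \<Rightarrow> real"
  assumes S: "open S" and sm: "smooth_on S s" "smooth_on S y" "smooth_on S u" "smooth_on S w"
    and nz: "\<And>z. z \<in> S \<Longrightarrow> s z \<noteq> 0" "\<And>z. z \<in> S \<Longrightarrow> y z \<noteq> 0"
    and b: "\<And>i a. i < 8 \<Longrightarrow> smooth_on S (\<lambda>z. b i z a)"
  shows "smooth_on S (\<lambda>z. cayley_form (s z) (y z) (u z) (w z) (\<lambda>i. b i z) v)"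
proof -
  have W: "smooth_on S (\<lambda>z. wedge_list [b i z, b j z, b k z, b l z] v)" if "i < 8" "j < 8" "k < 8" "l < 8" for i j k l
    using smooth_on_wedge_list[OF S, of "[i, j, k, l]" b v] b that by auto
  show ?thesis
    unfolding cayley_form_def cayley_terms_def list.map prod.case sum_list.Cons sum_list.Nil
    by (intro smooth_on_add smooth_on_mult smooth_on_minus smooth_on_inverse smooth_on_const S sm nz W) simp_all
qed

section \<open>The nilbundle\<close>

locale nilbundle =
  fixes X :: "('a, complex) mfd"
    and \<Upsilon>1 \<Upsilon>2 and Is Iy and u w and \<omega>
    and P :: "('p, real^6) mfd" and \<pi> actP
    and N :: "('n, real^8) mfd" and \<rho> actN
    and \<alpha> \<kappa> \<xi> \<eta>
  assumes X: "complex_curve X"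
    and \<Upsilon>: "holomorphic_10_form X (\<lambda>p v. of_real (\<Upsilon>1 p v) - \<i> * of_real (\<Upsilon>2 p v))"
    and Is: "open Is" "Is \<subseteq> {0<..}"
    and Iy: "open Iy" "Iy \<subseteq> {0<..}"
    and u: "smooth_family 0 X Iy (\<lambda>y p v. u y p)" "\<forall>y\<in>Iy. \<forall>p\<in>points X. u y p > 0"
    and w: "smooth_family 0 X Is (\<lambda>s p v. w s p)" "\<forall>s\<in>Is. \<forall>p\<in>points X. w s p > 0"
    and kaehler: "\<forall>s\<in>Is. \<forall>y\<in>Iy. kaehler_form X (\<omega> s y)"
    and volume: "\<forall>s\<in>Is. \<forall>y\<in>Iy. \<forall>p\<in>points X. \<forall>v.
           - (s * y) * \<omega> s y p v = (u y p * w s p) * (\<Upsilon>1 p \<and>\<^sub>1 \<Upsilon>2 p) v"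
    and bundle_P: "principal_torus_bundle (prod_mfd X (prod_mfd (eucl Is) (eucl Iy))) P \<pi> actP"
    and conn_P: "connection_forms P actP \<alpha> \<kappa>"
    and d_\<alpha>: "\<forall>q\<in>points P. \<forall>v.
           ext_d 1 P \<alpha> q v =
             - (lift_family P X \<pi> (\<lambda>s y. dc_fun X (u y)) q \<and>\<^sub>1 d_fun P (pr_y \<pi>) q) v
             + lift_family P X \<pi> (partial_y \<omega>) q v"
    and d_\<kappa>: "\<forall>q\<in>points P. \<forall>v.
           ext_d 1 P \<kappa> q v =
             (lift_family P X \<pi> (\<lambda>s y. dc_fun X (w s)) q \<and>\<^sub>1 d_fun P (pr_s \<pi>) q) v
             - lift_family P X \<pi> (partial_s \<omega>) q v"
    and bundle_N: "principal_torus_bundle P N \<rho> actN"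
    and conn_N: "connection_forms N actN \<xi> \<eta>"
    and d_\<xi>: "\<forall>n\<in>points N. \<forall>v.
           ext_d 1 N \<xi> n v =
             pullback N P \<rho> (\<lambda>q v.
               (pullback P X (pr_curve \<pi>) \<Upsilon>1 q \<and>\<^sub>1 \<kappa> q) v
               + (pullback P X (pr_curve \<pi>) \<Upsilon>2 q \<and>\<^sub>1
                    (\<lambda>v. w (pr_s \<pi> q) (pr_curve \<pi> q) * d_fun P (pr_s \<pi>) q v)) v) n v"
    and d_\<eta>: "\<forall>n\<in>points N. \<forall>v.
           ext_d 1 N \<eta> n v =
             pullback N P \<rho> (\<lambda>q v.
               (\<alpha> q \<and>\<^sub>1 pullback P X (pr_curve \<pi>) \<Upsilon>2 q) v
               + u (pr_y \<pi> q) (pr_curve \<pi> q) *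
                   (d_fun P (pr_y \<pi>) q \<and>\<^sub>1 pullback P X (pr_curve \<pi>) \<Upsilon>1 q) v) n v"
begin

lemma atlas_X: "smooth_atlas X" "has_charts X"
  using complex_curve_smooth_atlas[OF X] smooth_atlasD by blast+

lemma atlas_base: "has_charts (eucl Is)" "has_charts (eucl Iy)" "has_charts (prod_mfd (eucl Is) (eucl Iy))"
  "has_charts (prod_mfd X (prod_mfd (eucl Is) (eucl Iy)))"
  by (intro has_charts_prod has_charts_eucl atlas_X Is Iy)+

sublocale P: torus_bundle "prod_mfd X (prod_mfd (eucl Is) (eucl Iy))" P \<pi> actP
  by (rule torus_bundle.intro[OF atlas_base(4) bundle_P])

sublocale N: torus_bundle P N \<rho> actN
  by (rule torus_bundle.intro[OF P.E(2) bundle_N])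

lemma smooth_pr_curve: "smooth_between P X (pr_curve \<pi>)"
proof -
  have "pr_curve \<pi> = fst \<circ> \<pi>" by (simp add: fun_eq_iff pr_curve_def)
  then show ?thesis
    using smooth_between_comp[OF P.proj smooth_between_fst[OF atlas_X(1) atlas_base(3)]] by simp
qed

lemma smooth_pr_s: "smooth_fun P (pr_s \<pi>)" and smooth_pr_y: "smooth_fun P (pr_y \<pi>)"
proof -
  have "pr_s \<pi> = (\<lambda>t. t) \<circ> fst \<circ> snd \<circ> \<pi>" "pr_y \<pi> = (\<lambda>t. t) \<circ> snd \<circ> snd \<circ> \<pi>"
    by (simp_all add: fun_eq_iff pr_s_def pr_y_def)
  moreover note smooth_fun_comp(1)[OF P.proj smooth_fun_prod(2)[OF atlas_X(2) atlas_base(3)]]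
  ultimately show "smooth_fun P (pr_s \<pi>)" "smooth_fun P (pr_y \<pi>)"
    using smooth_fun_prod(1)[OF atlas_base(1,2) smooth_fun_eucl[OF Is(1)]]
      smooth_fun_prod(2)[OF atlas_base(1,2) smooth_fun_eucl[OF Iy(1)]] by metis+
qed

lemma pr_ranges:
  assumes "q \<in> points P"
  shows "pr_curve \<pi> q \<in> points X" "pr_s \<pi> q \<in> Is" "pr_y \<pi> q \<in> Iy"
  using smooth_between.image_points[OF P.proj assms] by (auto simp: pr_curve_def pr_s_def pr_y_def mem_Times_iff)

lemma \<rho>_points: "n \<in> points N \<Longrightarrow> \<rho> n \<in> points P"
  by (rule smooth_between.image_points[OF N.proj])

section \<open>The holomorphic form and the derivatives of the Kaehler family\<close>

text \<open>The coefficient of \<open>dz\<close> in \<open>\<Upsilon>\<^sub>1 - i\<Upsilon>\<^sub>2\<close> in the chosen chart.\<close>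

definition "h p = of_real (\<Upsilon>1 p (\<lambda>_. 1)) - \<i> * of_real (\<Upsilon>2 p (\<lambda>_. 1))"

lemma \<Upsilon>_eq:
  assumes "p \<in> points X"
  shows "\<Upsilon>1 p v = Re (h p * v 0)" "\<Upsilon>2 p v = - Im (h p * v 0)"
proof -
  from holomorphic_10_form_eq[OF \<Upsilon> assms, of v]
  have "complex_of_real (\<Upsilon>1 p v) - \<i> * complex_of_real (\<Upsilon>2 p v) = h p * v 0"
    by (simp add: h_def mult.commute)
  from arg_cong[OF this, of Re] arg_cong[OF this, of Im]
  show "\<Upsilon>1 p v = Re (h p * v 0)" "\<Upsilon>2 p v = - Im (h p * v 0)" by simp_all
qed

lemma \<Upsilon>_wedge:
  assumes "p \<in> points X"
  shows "(\<Upsilon>1 p \<and>\<^sub>1 \<Upsilon>2 p) v = \<Upsilon>1 p (\<lambda>_. v 0) * \<Upsilon>2 p (\<lambda>_. v 1) - \<Upsilon>1 p (\<lambda>_. v 1) * \<Upsilon>2 p (\<lambda>_. v 0)"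
  by (rule wedge11_cov) (simp_all add: \<Upsilon>_eq[OF assms])

lemma \<Upsilon>_closed: "p \<in> points X \<Longrightarrow> ext_d 1 X \<Upsilon>1 p v = 0" "p \<in> points X \<Longrightarrow> ext_d 1 X \<Upsilon>2 p v = 0"
  and \<Upsilon>_smooth: "smooth_form 1 X \<Upsilon>1" "smooth_form 1 X \<Upsilon>2"
proof -
  have "linear Re" "linear (\<lambda>z. - Im z)" by (simp_all add: linear_iff)
  note this[THEN holomorphic_10_form_real_part(1)[OF X \<Upsilon>]] this[THEN holomorphic_10_form_real_part(2)[OF X \<Upsilon>]]
  then show "p \<in> points X \<Longrightarrow> ext_d 1 X \<Upsilon>1 p v = 0" "p \<in> points X \<Longrightarrow> ext_d 1 X \<Upsilon>2 p v = 0"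
    "smooth_form 1 X \<Upsilon>1" "smooth_form 1 X \<Upsilon>2" by simp_all
qed

lemma \<omega>_eq:
  assumes "s \<in> Is" "y \<in> Iy" "p \<in> points X"
  shows "\<omega> s y p v = - (u y p * w s p / (s * y)) * (\<Upsilon>1 p \<and>\<^sub>1 \<Upsilon>2 p) v"
proof -
  have "s > 0" "y > 0" using assms Is Iy by auto
  then have "\<omega> s y p v = (- (s * y) * \<omega> s y p v) / (- (s * y))" by simp
  also have "- (s * y) * \<omega> s y p v = (u y p * w s p) * (\<Upsilon>1 p \<and>\<^sub>1 \<Upsilon>2 p) v"
    using volume assms by blast
  finally show ?thesis by (simp del: One_nat_def)
qed

text \<open>\<omega> is a multiple of \<Upsilon>1 \<and> \<Upsilon>2, so a zero of \<Upsilon> would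
  contradict the positivity of the Kaehler metric at that point.\<close>

lemma h_nonzero:
  assumes "s \<in> Is" "y \<in> Iy" "p \<in> points X"
  shows "h p \<noteq> 0"
proof
  assume "h p = 0"
  then have "kaehler_metric (\<omega> s y p) 1 1 = 0"
    by (simp add: kaehler_metric_def \<omega>_eq[OF assms] \<Upsilon>_wedge[OF assms(3)] \<Upsilon>_eq[OF assms(3)] del: One_nat_def)
  moreover have "kaehler_metric (\<omega> s y p) 1 1 > 0"
    using kaehler assms by (simp add: kaehler_form_def)
  ultimately show False by simp
qed

lemma u_deriv: "y \<in> Iy \<Longrightarrow> p \<in> points X \<Longrightarrow> ((\<lambda>t. u t p) has_real_derivative deriv (\<lambda>t. u t p) y) (at y)"
  and w_deriv: "s \<in> Is \<Longrightarrow> p \<in> points X \<Longrightarrow> ((\<lambda>t. w t p) has_real_derivative deriv (\<lambda>t. w t p) s) (at s)"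
  by (rule smooth_family_fun(4)[OF u(1) Iy(1) smooth_pr_curve smooth_pr_y pr_ranges(3)]
      smooth_family_fun(4)[OF w(1) Is(1) smooth_pr_curve smooth_pr_s pr_ranges(2)]; assumption)+

text \<open>The expression of \<omega> through u and w is valid on all of the open set
  \<open>Iy\<close> and may therefore be differentiated; only the factor u/y depends on y.\<close>

lemma partial_y_\<omega>:
  assumes "s \<in> Is" "y \<in> Iy" "p \<in> points X"
  shows "partial_y \<omega> s y p v
    = - (w s p / s) * (deriv (\<lambda>t. u t p) y / y - u y p / y\<^sup>2) * (\<Upsilon>1 p \<and>\<^sub>1 \<Upsilon>2 p) v"
proof -
  have pos: "s > 0" "y > 0" using assms Is Iy by auto
  have "((\<lambda>t. - (u t p * w s p / (s * t)) * (\<Upsilon>1 p \<and>\<^sub>1 \<Upsilon>2 p) v) has_real_derivative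
      - (w s p / s) * (deriv (\<lambda>t. u t p) y / y - u y p / y\<^sup>2) * (\<Upsilon>1 p \<and>\<^sub>1 \<Upsilon>2 p) v) (at y)"
    using pos by (auto intro!: derivative_eq_intros u_deriv[OF assms(2,3)] simp: field_simps power2_eq_square)
  then have "((\<lambda>t. \<omega> s t p v) has_real_derivative
      - (w s p / s) * (deriv (\<lambda>t. u t p) y / y - u y p / y\<^sup>2) * (\<Upsilon>1 p \<and>\<^sub>1 \<Upsilon>2 p) v) (at y)"
    by (rule has_field_derivative_transform_within_open[OF _ Iy(1) assms(2)]) (simp add: \<omega>_eq assms)
  then show ?thesis unfolding partial_y_def by (rule DERIV_imp_deriv)
qed

lemma partial_s_\<omega>:
  assumes "s \<in> Is" "y \<in> Iy" "p \<in> points X"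
  shows "partial_s \<omega> s y p v
    = - (u y p / y) * (deriv (\<lambda>t. w t p) s / s - w s p / s\<^sup>2) * (\<Upsilon>1 p \<and>\<^sub>1 \<Upsilon>2 p) v"
proof -
  have pos: "s > 0" "y > 0" using assms Is Iy by auto
  have "((\<lambda>t. - (u y p * w t p / (t * y)) * (\<Upsilon>1 p \<and>\<^sub>1 \<Upsilon>2 p) v) has_real_derivative
      - (u y p / y) * (deriv (\<lambda>t. w t p) s / s - w s p / s\<^sup>2) * (\<Upsilon>1 p \<and>\<^sub>1 \<Upsilon>2 p) v) (at s)"
    using pos by (auto intro!: derivative_eq_intros w_deriv[OF assms(1,3)] simp: field_simps power2_eq_square)
  then have "((\<lambda>t. \<omega> t y p v) has_real_derivative
      - (u y p / y) * (deriv (\<lambda>t. w t p) s / s - w s p / s\<^sup>2) * (\<Upsilon>1 p \<and>\<^sub>1 \<Upsilon>2 p) v) (at s)"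
    by (rule has_field_derivative_transform_within_open[OF _ Is(1) assms(1)]) (simp add: \<omega>_eq assms)
  then show ?thesis unfolding partial_s_def by (rule DERIV_imp_deriv)
qed

section \<open>The coframe of the nilbundle and its structure equations\<close>

definition coframe :: "nat \<Rightarrow> ('n, real^8, real) form" where
  "coframe i = [\<eta>, \<xi>, pullback N P \<rho> \<alpha>, d_fun N (pr_y (\<pi> \<circ> \<rho>)), pullback N P \<rho> \<kappa>, d_fun N (pr_s (\<pi> \<circ> \<rho>)),
     pullback N X (pr_curve (\<pi> \<circ> \<rho>)) \<Upsilon>1, pullback N X (pr_curve (\<pi> \<circ> \<rho>)) \<Upsilon>2] ! i"

lemma coframe_simps:
  "coframe 0 = \<eta>" "coframe 1 = \<xi>" "coframe 2 = pullback N P \<rho> \<alpha>" "coframe 3 = d_fun N (pr_y (\<pi> \<circ> \<rho>))"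
  "coframe 4 = pullback N P \<rho> \<kappa>" "coframe 5 = d_fun N (pr_s (\<pi> \<circ> \<rho>))"
  "coframe 6 = pullback N X (pr_curve (\<pi> \<circ> \<rho>)) \<Upsilon>1" "coframe 7 = pullback N X (pr_curve (\<pi> \<circ> \<rho>)) \<Upsilon>2"
  by (simp_all add: coframe_def)

lemma pr_comp: "pr_curve (\<pi> \<circ> \<rho>) = pr_curve \<pi> \<circ> \<rho>" "pr_s (\<pi> \<circ> \<rho>) = pr_s \<pi> \<circ> \<rho>" "pr_y (\<pi> \<circ> \<rho>) = pr_y \<pi> \<circ> \<rho>"
  by (simp_all add: fun_eq_iff pr_curve_def pr_s_def pr_y_def)

lemma smooth_N: "smooth_between N X (pr_curve (\<pi> \<circ> \<rho>))" "smooth_fun N (pr_s (\<pi> \<circ> \<rho>))" "smooth_fun N (pr_y (\<pi> \<circ> \<rho>))"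
  unfolding pr_comp
  by (rule smooth_between_comp[OF N.proj smooth_pr_curve] smooth_fun_comp(1)[OF N.proj smooth_pr_s]
      smooth_fun_comp(1)[OF N.proj smooth_pr_y])+

lemma conn_smooth: "smooth_form 1 P \<alpha>" "smooth_form 1 P \<kappa>" "smooth_form 1 N \<xi>" "smooth_form 1 N \<eta>"
  using conn_P conn_N unfolding connection_forms_def by blast+

lemma coframe_smooth: "i < 8 \<Longrightarrow> smooth_form 1 N (coframe i)"
  by (elim less_8_cases; hypsubst; unfold coframe_simps)
     (intro conn_smooth smooth_form_pullback[OF N.proj N.E(1) P.E(1)] smooth_form_d_fun[OF N.E(1)] smooth_N
        smooth_form_pullback[OF smooth_N(1) N.E(1) atlas_X(1)] \<Upsilon>_smooth)+

text \<open>\<Upsilon>1 and \<Upsilon>2 are given twice: factored through \<open>P\<close>, to match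
  the curvatures defined there, and directly from \<open>N\<close>, to match the differentials of u
  and w.\<close>

lemma coframe_at:
  assumes n: "n \<in> points N"
  defines "q \<equiv> \<rho> n" and "p \<equiv> pr_curve \<pi> (\<rho> n)"
  shows "coframe 2 n (\<lambda>_. a) = \<alpha> q (\<lambda>_. mdiff N P \<rho> n a)"
    "coframe 3 n (\<lambda>_. a) = d_fun P (pr_y \<pi>) q (\<lambda>_. mdiff N P \<rho> n a)"
    "coframe 4 n (\<lambda>_. a) = \<kappa> q (\<lambda>_. mdiff N P \<rho> n a)"
    "coframe 5 n (\<lambda>_. a) = d_fun P (pr_s \<pi>) q (\<lambda>_. mdiff N P \<rho> n a)"
    "coframe 6 n (\<lambda>_. a) = \<Upsilon>1 p (\<lambda>_. mdiff P X (pr_curve \<pi>) q (mdiff N P \<rho> n a))"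
    "coframe 7 n (\<lambda>_. a) = \<Upsilon>2 p (\<lambda>_. mdiff P X (pr_curve \<pi>) q (mdiff N P \<rho> n a))"
    "coframe 6 n (\<lambda>_. a) = \<Upsilon>1 p (\<lambda>_. mdiff N X (pr_curve (\<pi> \<circ> \<rho>)) n a)"
    "coframe 7 n (\<lambda>_. a) = \<Upsilon>2 p (\<lambda>_. mdiff N X (pr_curve (\<pi> \<circ> \<rho>)) n a)"
  using pullback_d_fun[OF N.proj smooth_pr_y n, of "\<lambda>_. a"] pullback_d_fun[OF N.proj smooth_pr_s n, of "\<lambda>_. a"]
    mdiff_comp[OF N.proj smooth_pr_curve n, of a]
  by (simp_all add: coframe_simps pullback_def q_def p_def pr_comp)

text \<open>The constants are the coefficients of the differentials of u and w along the curve. The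
  same ones must occur in du, dw and, through d^c, in the curvatures, hence one existential
  statement for all three.\<close>

lemma coframe_structure:
  assumes n: "n \<in> points N"
  defines "p \<equiv> pr_curve (\<pi> \<circ> \<rho>) n" and "s \<equiv> pr_s (\<pi> \<circ> \<rho>) n" and "y \<equiv> pr_y (\<pi> \<circ> \<rho>) n"
  defines "b \<equiv> \<lambda>i a. coframe i n (\<lambda>_. a)"
  defines "u' \<equiv> deriv (\<lambda>t. u t p) y" and "w' \<equiv> deriv (\<lambda>t. w t p) s"
  shows "\<exists>c1 c2 e1 e2.
    (\<forall>a. d_fun N (\<lambda>n. u (pr_y (\<pi> \<circ> \<rho>) n) (pr_curve (\<pi> \<circ> \<rho>) n)) n (\<lambda>_. a) = c1 * b 6 a + c2 * b 7 a + u' * b 3 a) \<and>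
    (\<forall>a. d_fun N (\<lambda>n. w (pr_s (\<pi> \<circ> \<rho>) n) (pr_curve (\<pi> \<circ> \<rho>) n)) n (\<lambda>_. a) = e1 * b 6 a + e2 * b 7 a + w' * b 5 a) \<and>
    (\<forall>i<8. \<forall>v. ext_d 1 N (coframe i) n v = (\<Sum>(c, j, k)\<leftarrow>structure_terms s y (u y p) (w s p) c1 c2 u' e1 e2 w' i.
        c * (b j (v 0) * b k (v 1) - b j (v 1) * b k (v 0))))"
proof -
  let ?q = "\<rho> n" and ?d = "mdiff N P \<rho> n"
  let ?e = "mdiff P X (pr_curve \<pi>) (\<rho> n)"
  note q = \<rho>_points[OF n]
  have p: "p = pr_curve \<pi> ?q" and s: "s = pr_s \<pi> ?q" and y: "y = pr_y \<pi> ?q"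
    by (simp_all add: p_def s_def y_def pr_comp)
  have ran: "p \<in> points X" "s \<in> Is" "y \<in> Iy"
    unfolding p s y by (rule pr_ranges[OF q])+
  have b_eq: "b i a = coframe i n (\<lambda>_. a)" for i a by (simp add: b_def)
  note b = coframe_at[OF n, folded p, folded b_eq]
  note \<Upsilon> = \<Upsilon>_eq[OF ran(1)]
  note uX = smooth_family_fun(3)[OF u(1) Iy(1) smooth_pr_curve smooth_pr_y pr_ranges(3) ran(3)]
  note wX = smooth_family_fun(3)[OF w(1) Is(1) smooth_pr_curve smooth_pr_s pr_ranges(2) ran(2)]
  have alt: "alt_form 1 (d_fun X (u y) p)" "alt_form 1 (d_fun X (w s) p)"
    using smooth_form_d_fun[OF atlas_X(1) uX] smooth_form_d_fun[OF atlas_X(1) wX] ran(1)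
    unfolding smooth_form_def by blast+
  obtain c1 c2 where c: "\<And>x. d_fun X (u y) p (\<lambda>_. x) = c1 * \<Upsilon>1 p (\<lambda>_. x) + c2 * \<Upsilon>2 p (\<lambda>_. x)"
    "\<And>x. d_fun X (u y) p (\<lambda>_. \<i> * x) = c1 * \<Upsilon>2 p (\<lambda>_. x) - c2 * \<Upsilon>1 p (\<lambda>_. x)"
    using complex_linear_functional[OF alt_form_1_linear[OF alt(1)] h_nonzero[OF ran(2,3,1)]] unfolding \<Upsilon> by blast
  obtain e1 e2 where e: "\<And>x. d_fun X (w s) p (\<lambda>_. x) = e1 * \<Upsilon>1 p (\<lambda>_. x) + e2 * \<Upsilon>2 p (\<lambda>_. x)"
    "\<And>x. d_fun X (w s) p (\<lambda>_. \<i> * x) = e1 * \<Upsilon>2 p (\<lambda>_. x) - e2 * \<Upsilon>1 p (\<lambda>_. x)"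
    using complex_linear_functional[OF alt_form_1_linear[OF alt(2)] h_nonzero[OF ran(2,3,1)]] unfolding \<Upsilon> by blast
  have ranN: "pr_y (\<pi> \<circ> \<rho>) n \<in> Iy" "pr_s (\<pi> \<circ> \<rho>) n \<in> Is" if "n \<in> points N" for n
    unfolding pr_comp using pr_ranges[OF \<rho>_points[OF that]] by simp_all
  have du: "d_fun N (\<lambda>n. u (pr_y (\<pi> \<circ> \<rho>) n) (pr_curve (\<pi> \<circ> \<rho>) n)) n (\<lambda>_. a) = c1 * b 6 a + c2 * b 7 a + u' * b 3 a" for a
    using smooth_family_fun(2)[OF u(1) Iy(1) smooth_N(1,3) ranN(1) n, of "\<lambda>_. a"]
    by (simp add: p_def[symmetric] y_def[symmetric] u'_def c b(7,8)) (simp add: b_eq coframe_simps)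
  have dw: "d_fun N (\<lambda>n. w (pr_s (\<pi> \<circ> \<rho>) n) (pr_curve (\<pi> \<circ> \<rho>) n)) n (\<lambda>_. a) = e1 * b 6 a + e2 * b 7 a + w' * b 5 a" for a
    using smooth_family_fun(2)[OF w(1) Is(1) smooth_N(1,2) ranN(2) n, of "\<lambda>_. a"]
    by (simp add: p_def[symmetric] s_def[symmetric] w'_def e b(7,8)) (simp add: b_eq coframe_simps)
  \<comment> \<open>The dependence facts reduce one-forms to their value on \<open>v 0\<close>, as
    \<open>wedge11_cov\<close> demands of its factors.\<close>
  have dep: "d_fun P g ?q v = d_fun P g ?q v'" if "v 0 = v' 0" for g v v'
    using that by (simp add: d_fun_eq[OF P.E(2) q])
  have depX: "d_fun X g p v = d_fun X g p v'" if "v 0 = v' 0" for g v v'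
    using that by (simp add: d_fun_eq[OF atlas_X(2) ran(1)])
  have alt_conn: "alt_form 1 (\<alpha> ?q)" "alt_form 1 (\<kappa> ?q)"
    using conn_smooth(1,2) q unfolding smooth_form_def by blast+
  have dep_conn: "\<alpha> ?q v = \<alpha> ?q v'" "\<kappa> ?q v = \<kappa> ?q v'" if "v 0 = v' 0" for v v'
    using alt_form_1_eq[OF alt_conn(1)] alt_form_1_eq[OF alt_conn(2)] that by metis+
  have dep\<Upsilon>: "pullback P X (pr_curve \<pi>) \<Upsilon>1 ?q v = pullback P X (pr_curve \<pi>) \<Upsilon>1 ?q v'"
    "pullback P X (pr_curve \<pi>) \<Upsilon>2 ?q v = pullback P X (pr_curve \<pi>) \<Upsilon>2 ?q v'" if "v 0 = v' 0" for v v'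
    using that by (simp_all add: pullback_def \<Upsilon> p[symmetric])
  have d0: "ext_d 1 N \<eta> n v = (b 2 (v 0) * b 7 (v 1) - b 2 (v 1) * b 7 (v 0))
      + u y p * (b 3 (v 0) * b 6 (v 1) - b 3 (v 1) * b 6 (v 0))" for v
    unfolding d_\<eta>[rule_format, OF n] pullback_def[of N P \<rho>]
    by (subst wedge11_cov, erule dep_conn dep\<Upsilon>, erule dep_conn dep\<Upsilon>, subst wedge11_cov, erule dep, erule dep\<Upsilon>)
       (simp add: b(1,2,5,6) pullback_def p[symmetric] y[symmetric])
  have d1: "ext_d 1 N \<xi> n v = (b 6 (v 0) * b 4 (v 1) - b 6 (v 1) * b 4 (v 0))
      + w s p * (b 7 (v 0) * b 5 (v 1) - b 7 (v 1) * b 5 (v 0))" for v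
    unfolding d_\<xi>[rule_format, OF n] pullback_def[of N P \<rho>]
    by (subst wedge11_cov, erule dep_conn dep\<Upsilon>, erule dep_conn dep\<Upsilon>, subst wedge11_cov, erule dep\<Upsilon>, rule arg_cong[where f = "(*) _"], erule dep)
       (simp add: b(3,4,5,6) pullback_def p[symmetric] s[symmetric] algebra_simps)
  have lift_u: "lift_family P X \<pi> (\<lambda>s y. dc_fun X (u y)) ?q v
      = c1 * \<Upsilon>2 p (\<lambda>_. ?e (v 0)) - c2 * \<Upsilon>1 p (\<lambda>_. ?e (v 0))" for v
    unfolding lift_family_def pullback_def dc_fun_def J_form_def p[symmetric] y[symmetric] c(2)[symmetric]
    by (rule depX) simp
  have lift_w: "lift_family P X \<pi> (\<lambda>s y. dc_fun X (w s)) ?q v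
      = e1 * \<Upsilon>2 p (\<lambda>_. ?e (v 0)) - e2 * \<Upsilon>1 p (\<lambda>_. ?e (v 0))" for v
    unfolding lift_family_def pullback_def dc_fun_def J_form_def p[symmetric] s[symmetric] e(2)[symmetric]
    by (rule depX) simp
  have lift_dy: "lift_family P X \<pi> (partial_y \<omega>) ?q (\<lambda>i. ?d (v i))
      = - (w s p / s) * (u' / y - u y p / y\<^sup>2) * (b 6 (v 0) * b 7 (v 1) - b 6 (v 1) * b 7 (v 0))" for v
    unfolding lift_family_def pullback_def p[symmetric] y[symmetric] s[symmetric]
      partial_y_\<omega>[OF ran(2,3,1)] \<Upsilon>_wedge[OF ran(1)] u'_def by (simp add: b(5,6))
  have lift_ds: "lift_family P X \<pi> (partial_s \<omega>) ?q (\<lambda>i. ?d (v i))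
      = - (u y p / y) * (w' / s - w s p / s\<^sup>2) * (b 6 (v 0) * b 7 (v 1) - b 6 (v 1) * b 7 (v 0))" for v
    unfolding lift_family_def pullback_def p[symmetric] y[symmetric] s[symmetric]
      partial_s_\<omega>[OF ran(2,3,1)] \<Upsilon>_wedge[OF ran(1)] w'_def by (simp add: b(5,6))
  have d2: "ext_d 1 N (coframe 2) n v
      = - ((c1 * b 7 (v 0) - c2 * b 6 (v 0)) * b 3 (v 1) - (c1 * b 7 (v 1) - c2 * b 6 (v 1)) * b 3 (v 0))
        + - (w s p / s) * (u' / y - u y p / y\<^sup>2) * (b 6 (v 0) * b 7 (v 1) - b 6 (v 1) * b 7 (v 0))" for v
    unfolding coframe_simps ext_d_1_pullback[OF N.proj N.E(1) P.E(1) conn_smooth(1) n] pullback_def[of N P \<rho>]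
      d_\<alpha>[rule_format, OF q] lift_dy
    by (subst wedge11_cov, simp add: lift_u, erule dep) (simp add: lift_u b(2,5,6))
  have d4: "ext_d 1 N (coframe 4) n v
      = ((e1 * b 7 (v 0) - e2 * b 6 (v 0)) * b 5 (v 1) - (e1 * b 7 (v 1) - e2 * b 6 (v 1)) * b 5 (v 0))
        - - (u y p / y) * (w' / s - w s p / s\<^sup>2) * (b 6 (v 0) * b 7 (v 1) - b 6 (v 1) * b 7 (v 0))" for v
    unfolding coframe_simps ext_d_1_pullback[OF N.proj N.E(1) P.E(1) conn_smooth(2) n] pullback_def[of N P \<rho>]
      d_\<kappa>[rule_format, OF q] lift_ds
    by (subst wedge11_cov, simp add: lift_w, erule dep) (simp add: lift_w b(4,5,6))
  have d35: "ext_d 1 N (coframe 3) n v = 0" "ext_d 1 N (coframe 5) n v = 0" for v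
    unfolding coframe_simps by (rule ext_d_1_d_fun[OF N.E(1) _ n] smooth_N)+
  have d67: "ext_d 1 N (coframe 6) n v = 0" "ext_d 1 N (coframe 7) n v = 0" for v
    unfolding coframe_simps ext_d_1_pullback[OF smooth_N(1) N.E(1) atlas_X(1) \<Upsilon>_smooth(1) n]
      ext_d_1_pullback[OF smooth_N(1) N.E(1) atlas_X(1) \<Upsilon>_smooth(2) n]
    using \<Upsilon>_closed[OF ran(1)] by (simp_all add: pullback_def p_def[symmetric])
  show ?thesis
  proof (intro exI conjI allI impI)
    fix i :: nat and v assume "i < 8"
    then show "ext_d 1 N (coframe i) n v = (\<Sum>(c, j, k)\<leftarrow>structure_terms s y (u y p) (w s p) c1 c2 u' e1 e2 w' i.
        c * (b j (v 0) * b k (v 1) - b j (v 1) * b k (v 0)))"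
      by (cases rule: less_8_cases)
         (simp_all add: structure_terms_def coframe_simps(1) coframe_simps(2)[simplified] d0[simplified] d1[simplified]
           d2[simplified] d4[simplified] d35[simplified] d67[simplified], simp_all add: algebra_simps)
  qed (rule du dw)+
qed

section \<open>The closed form on the nilbundle\<close>

abbreviation "sN \<equiv> pr_s (\<pi> \<circ> \<rho>)"
abbreviation "yN \<equiv> pr_y (\<pi> \<circ> \<rho>)"
abbreviation "pN \<equiv> pr_curve (\<pi> \<circ> \<rho>)"
abbreviation "uN \<equiv> \<lambda>n. u (yN n) (pN n)"
abbreviation "wN \<equiv> \<lambda>n. w (sN n) (pN n)"

lemma ranges_N:
  assumes "n \<in> points N"
  shows "pN n \<in> points X" "sN n \<in> Is" "yN n \<in> Iy"
  using pr_ranges[OF \<rho>_points[OF assms]] by (simp_all add: pr_comp)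

lemma positive_N:
  assumes "n \<in> points N"
  shows "sN n > 0" "yN n > 0" "uN n > 0" "wN n > 0"
  using ranges_N[OF assms] Is Iy u(2) w(2) by auto

lemma smooth_fun_uw: "smooth_fun N uN" "smooth_fun N wN"
  by (rule smooth_family_fun(1)[OF u(1) Iy(1) smooth_N(1,3) ranges_N(3)]
      smooth_family_fun(1)[OF w(1) Is(1) smooth_N(1,2) ranges_N(2)]; assumption)+

lemma alt_form_coframe: "n \<in> points N \<Longrightarrow> i < 8 \<Longrightarrow> alt_form 1 (coframe i n)"
  using coframe_smooth unfolding smooth_form_def by blast

lemma linear_coframe: "n \<in> points N \<Longrightarrow> i < 8 \<Longrightarrow> linear (\<lambda>a. coframe i n (\<lambda>_. a))"
  by (rule alt_form_1_linear[OF alt_form_coframe])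

definition cayley :: "('n, real^8, real) form" where
  "cayley n = cayley_form (sN n) (yN n) (uN n) (wN n) (\<lambda>i a. coframe i n (\<lambda>_. a))"

text \<open>Passing to a chart substitutes a linear map into all arguments, and this commutes with
  products of covectors.\<close>

lemma local_rep_cayley:
  "local_rep N c cayley z v = cayley_form (sN (param c z)) (yN (param c z)) (uN (param c z)) (wN (param c z))
     (\<lambda>i a. local_rep N c (coframe i) z (\<lambda>_. a)) v"
  by (simp add: local_rep_def pullback_def cayley_def cayley_form_comp)

lemma smooth_form_cayley: "smooth_form 4 N cayley"
  unfolding smooth_form_def
proof (intro conjI ballI allI)
  fix n assume n: "n \<in> points N"
  show "alt_form 4 (cayley n)"
    unfolding cayley_def by (rule alt_form_cayley_form[OF linear_coframe[OF n]])
next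
  fix c v assume c: "c \<in> atlas N"
  have pt: "param c z \<in> points N" if "z \<in> img c" for z
    using param_chart(3)[OF N.E(2) c that] has_chartsD(1)[OF N.E(2) c] by blast
  have sm: "smooth_on (img c) (\<lambda>z. g (param c z))" if "smooth_fun N g" for g
    using smooth_funD[OF that c] by (simp add: o_def)
  show "smooth_on (img c) (\<lambda>z. local_rep N c cayley z v)"
    unfolding local_rep_cayley
  proof (rule smooth_on_cayley_form[OF has_chartsD(3)[OF N.E(2) c]
        sm[OF smooth_N(2)] sm[OF smooth_N(3)] sm[OF smooth_fun_uw(1)] sm[OF smooth_fun_uw(2)]])
    fix z assume "z \<in> img c"
    then show "sN (param c z) \<noteq> 0" "yN (param c z) \<noteq> 0"
      using positive_N(1,2)[OF pt[of z]] by simp_all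
  next
    fix i a assume "i < (8 :: nat)"
    then show "smooth_on (img c) (\<lambda>z. local_rep N c (coframe i) z (\<lambda>_. a))"
      using coframe_smooth c unfolding smooth_form_def by blast
  qed
qed

text \<open>The chart chosen at \<open>n\<close> is kept fixed nearby. At \<open>n\<close> itself
  the chart expressions of the coframe equal its stored values, so the structure equations at
  \<open>n\<close> carry over.\<close>

lemma torsion_free_cayley: "torsion_free N cayley"
  unfolding torsion_free_def
proof (intro ballI ext)
  fix n v assume n: "n \<in> points N"
  let ?c = "chart_at N n"
  let ?x = "snd ?c n"
  let ?b = "\<lambda>i z a. local_rep N ?c (coframe i) z (\<lambda>_. a)"
  let ?u' = "deriv (\<lambda>t. u t (pN n)) (yN n)" and ?w' = "deriv (\<lambda>t. w t (pN n)) (sN n)"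
  note c = chart_at[OF N.E(2) n]
  note V = has_chartsD(3)[OF N.E(2) c(1)]
  have x: "?x \<in> img ?c" using c(2) by blast
  have param: "param ?c ?x = n" by (rule param_chart(1)[OF N.E(2) c])
  have b: "?b i ?x a = coframe i n (\<lambda>_. a)" for i a
    by (rule local_rep_chart_at[OF N.E(2) n])
  have has_deriv: "((\<lambda>z. g (param ?c z)) has_derivative (\<lambda>a. d_fun N g n (\<lambda>_. a))) (at ?x)" if "smooth_fun N g" for g
    using fun_deriv_has_derivative[OF that c] by (simp add: d_fun_eq[OF N.E(2) n] o_def)
  obtain c1 c2 e1 e2 where
    du: "\<And>a. d_fun N uN n (\<lambda>_. a) = c1 * ?b 6 ?x a + c2 * ?b 7 ?x a + ?u' * ?b 3 ?x a" and
    dw: "\<And>a. d_fun N wN n (\<lambda>_. a) = e1 * ?b 6 ?x a + e2 * ?b 7 ?x a + ?w' * ?b 5 ?x a" and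
    struct: "\<And>i v. i < 8 \<Longrightarrow> ext_d 1 N (coframe i) n v = (\<Sum>(c, j, k)\<leftarrow>structure_terms (sN n) (yN n) (uN n) (wN n) c1 c2 ?u' e1 e2 ?w' i.
        c * (?b j ?x (v 0) * ?b k ?x (v 1) - ?b j ?x (v 1) * ?b k ?x (v 0)))"
    using coframe_structure[OF n] unfolding b by blast
  have "ext_d 4 N cayley n v
      = ext_d_eucl 4 (\<lambda>z. cayley_form (sN (param ?c z)) (yN (param ?c z)) (uN (param ?c z)) (wN (param ?c z)) (\<lambda>i. ?b i z)) ?x v"
    unfolding ext_d_def by (rule ext_d_eucl_cong[OF V x local_rep_cayley])
  also have "\<dots> = 0"
  proof (rule cayley_form_closed[OF _ _ _ _ _ _ _ refl, of "\<lambda>z. sN (param ?c z)" ?x "\<lambda>z. yN (param ?c z)" ?b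
        "\<lambda>z. uN (param ?c z)" c1 c2 ?u' "\<lambda>z. wN (param ?c z)" e1 e2 ?w',
        unfolded param])
    show "sN n \<noteq> 0" "yN n \<noteq> 0" using positive_N[OF n] by simp_all
    show "(\<lambda>z. ?b i z a) differentiable (at ?x)" if "i < 8" for i a
      using coframe_smooth[OF that] c(1) x unfolding smooth_form_def by (blast intro: smooth_on_differentiable)
    show "((\<lambda>z. sN (param ?c z)) has_derivative ?b 5 ?x) (at ?x)"
      using has_deriv[OF smooth_N(2)] unfolding b by (simp add: coframe_simps)
    show "((\<lambda>z. yN (param ?c z)) has_derivative ?b 3 ?x) (at ?x)"
      using has_deriv[OF smooth_N(3)] unfolding b by (simp add: coframe_simps)
    show "((\<lambda>z. uN (param ?c z)) has_derivative
        (\<lambda>a. c1 * ?b 6 ?x a + c2 * ?b 7 ?x a + ?u' * ?b 3 ?x a)) (at ?x)"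
      using has_deriv[OF smooth_fun_uw(1)] unfolding du .
    show "((\<lambda>z. wN (param ?c z)) has_derivative
        (\<lambda>a. e1 * ?b 6 ?x a + e2 * ?b 7 ?x a + ?w' * ?b 5 ?x a)) (at ?x)"
      using has_deriv[OF smooth_fun_uw(2)] unfolding dw .
    fix i :: nat and a a' assume i: "i < 8"
    have "fderiv (\<lambda>z. ?b i z a') ?x a - fderiv (\<lambda>z. ?b i z a) ?x a'
        = ext_d 1 N (coframe i) n (\<lambda>j. if j = 0 then a else a')"
      unfolding ext_d_def
      using ext_d_eucl_1[OF V x alt_form_local_rep[OF N.E(1) c(1) _ coframe_smooth[OF i]], where v = "\<lambda>j. if j = 0 then a else a'"]
      by simp
    then show "fderiv (\<lambda>z. ?b i z a') ?x a - fderiv (\<lambda>z. ?b i z a) ?x a' = (\<Sum>(c, j, k)\<leftarrow>structure_terms (sN n) (yN n) (uN n) (wN n) c1 c2 ?u' e1 e2 ?w' i.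
        c * (?b j ?x a * ?b k ?x a' - ?b j ?x a' * ?b k ?x a))"
      using struct[OF i, of "\<lambda>j. if j = 0 then a else a'"] by (simp only: if_True if_False zero_neq_one one_neq_zero simp_thms)
  qed
  finally show "ext_d 4 N cayley n v = 0" .
qed

section \<open>Nondegeneracy of the coframe and the induced metric\<close>

abbreviation "frame n \<equiv> spin_frame (sN n) (yN n) (uN n) (wN n) (\<lambda>i a. coframe i n (\<lambda>_. a))"

text \<open>In a product chart the derivative of \<pi> has the components along the curve, s and y.
  If all three vanish the vector is vertical, and the connection forms decide.\<close>

lemma tangent_P_eq_0:
  assumes q: "q \<in> points P" and v: "mdiff P X (pr_curve \<pi>) q v = 0" "d_fun P (pr_s \<pi>) q (\<lambda>_. v) = 0"
      "d_fun P (pr_y \<pi>) q (\<lambda>_. v) = 0" "\<alpha> q (\<lambda>_. v) = 0" "\<kappa> q (\<lambda>_. v) = 0"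
  shows "v = 0"
proof -
  let ?c = "chart_at P q" and ?d = "chart_at X (pr_curve \<pi> q)"
  note c = chart_at[OF P.E(2) q] and d = chart_at[OF atlas_X(2) pr_ranges(1)[OF q]]
  let ?cs = "(Is, id :: real \<Rightarrow> real)" and ?cy = "(Iy, id :: real \<Rightarrow> real)"
  define T where "T = (fst ?cs \<times> fst ?cy, map_prod (snd ?cs) (snd ?cy))"
  define D where "D = (fst ?d \<times> fst T, map_prod (snd ?d) (snd T))"
  have T: "T \<in> atlas (prod_mfd (eucl Is) (eucl Iy))"
    unfolding T_def by (rule atlas_prodI) (simp_all add: eucl_def)
  have D: "D \<in> atlas (prod_mfd X (prod_mfd (eucl Is) (eucl Iy)))"
    unfolding D_def by (rule atlas_prodI[OF d(1) T])
  have \<pi>: "\<pi> q = (pr_curve \<pi> q, pr_s \<pi> q, pr_y \<pi> q)" for q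
    by (simp add: pr_curve_def pr_s_def pr_y_def)
  have \<pi>D: "\<pi> q \<in> fst D"
    using d(2) pr_ranges[OF q] by (subst \<pi>) (simp add: D_def T_def)
  have "((\<lambda>z. ((snd ?d \<circ> pr_curve \<pi> \<circ> param ?c) z, (pr_s \<pi> \<circ> param ?c) z, (pr_y \<pi> \<circ> param ?c) z)) has_derivative
      (\<lambda>a. (chart_deriv ?c ?d (pr_curve \<pi>) q a, fun_deriv ?c (pr_s \<pi>) q a, fun_deriv ?c (pr_y \<pi>) q a))) (at (snd ?c q))"
    by (intro has_derivative_Pair smooth_between.chart_deriv_has_derivative[OF smooth_pr_curve c(1) d(1) c(2) d(2)]
        fun_deriv_has_derivative[OF smooth_pr_s c] fun_deriv_has_derivative[OF smooth_pr_y c])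
  moreover have "(\<lambda>z. ((snd ?d \<circ> pr_curve \<pi> \<circ> param ?c) z, (pr_s \<pi> \<circ> param ?c) z, (pr_y \<pi> \<circ> param ?c) z))
      = coord_map ?c \<pi> D"
    by (simp add: fun_eq_iff D_def T_def map_prod_def case_prod_unfold pr_curve_def pr_s_def pr_y_def)
  ultimately have "chart_deriv ?c D \<pi> q v
      = (chart_deriv ?c ?d (pr_curve \<pi>) q v, fun_deriv ?c (pr_s \<pi>) q v, fun_deriv ?c (pr_y \<pi>) q v)"
    unfolding chart_deriv_def[of ?c D] by (simp add: frechet_derivative_eq)
  also have "\<dots> = 0"
    using v(1-3) by (simp add: mdiff_eq d_fun_eq[OF P.E(2) q] zero_prod_def)
  finally show ?thesis
    using v by (intro P.tangent_eq_0[OF _ conn_P q D \<pi>D]) simp_all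
qed

text \<open>The tower is climbed from its base: \<Upsilon>1 and \<Upsilon>2 determine the component
  along the curve since h is nonzero, then \<alpha>, dy, \<kappa>, ds settle the projection to
  \<open>P\<close>, and \<eta>, \<xi> the fibre of \<open>N\<close>.\<close>

lemma tangent_N_eq_0:
  assumes n: "n \<in> points N" and a: "\<And>i. i < 8 \<Longrightarrow> coframe i n (\<lambda>_. a) = 0"
  shows "a = 0"
proof -
  let ?A = "mdiff N P \<rho> n a" and ?p = "pr_curve \<pi> (\<rho> n)"
  note q = \<rho>_points[OF n]
  note at = coframe_at[OF n]
  have "h ?p * mdiff P X (pr_curve \<pi>) (\<rho> n) ?A = 0"
    using at(5,6)[of a] a[of 6] a[of 7] by (simp add: \<Upsilon>_eq[OF pr_ranges(1)[OF q]] complex_eq_iff)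
  then have "mdiff P X (pr_curve \<pi>) (\<rho> n) ?A = 0"
    using h_nonzero[OF pr_ranges(2)[OF q] pr_ranges(3)[OF q] pr_ranges(1)[OF q]] by simp
  then have A: "?A = 0"
    using at(1-4)[of a] a[of 2] a[of 3] a[of 4] a[of 5] by (intro tangent_P_eq_0[OF q]) simp_all
  note d = chart_at[OF P.E(2) q]
  show ?thesis
    using A a[of 0] a[of 1] by (intro N.tangent_eq_0[OF _ conn_N n d]) (simp_all add: mdiff_eq coframe_simps[simplified])
qed

text \<open>The scalings are nonzero, so the frame is injective because the coframe is
  nondegenerate; equal dimensions make it bijective.\<close>

lemma spin7_frame_cayley:
  assumes n: "n \<in> points N"
  shows "spin7_frame (cayley n) (frame n)"
proof -
  note pos = positive_N[OF n]
  have lin: "linear (frame n)" by (rule linear_spin_frame[OF linear_coframe[OF n]])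
  have "a = 0" if "frame n a = 0" for a
  proof (rule tangent_N_eq_0[OF n])
    fix i :: nat assume "i < 8"
    have "frame n a $ k = 0" for k using that by simp
    from this[of 0] this[of 1] this[of 2] this[of 3] this[of 4] this[of 5] this[of 6] this[of 7]
    have "coframe 0 n (\<lambda>_. a) = 0" "coframe 1 n (\<lambda>_. a) = 0" "coframe 2 n (\<lambda>_. a) = 0" "coframe 3 n (\<lambda>_. a) = 0"
      "coframe 4 n (\<lambda>_. a) = 0" "coframe 5 n (\<lambda>_. a) = 0" "coframe 6 n (\<lambda>_. a) = 0" "coframe 7 n (\<lambda>_. a) = 0"
      unfolding spin_frame_nth using pos by simp_all
    with \<open>i < 8\<close> show "coframe i n (\<lambda>_. a) = 0" by (cases rule: less_8_cases) simp_all
  qed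
  then have "inj (frame n)" using linear_injective_0[OF lin] by blast
  then have "bij (frame n)" using linear_injective_imp_surjective[OF lin] by (simp add: bij_def)
  then show ?thesis
    unfolding spin7_frame_def cayley_def using lin by (simp add: Phi0_spin_frame[OF pos])
qed

text \<open>Rotation by i takes \<Upsilon>1 to \<Upsilon>2 and \<Upsilon>2 to -\<Upsilon>1, so
  evaluating \<Upsilon>1 \<and> \<Upsilon>2 on (a, i a') yields a negative definite form. The minus
  sign in the volume condition compensates for this.\<close>

lemma kaehler_metric_\<omega>:
  assumes "s \<in> Is" "y \<in> Iy" "p \<in> points X"
  shows "kaehler_metric (\<omega> s y p) a a'
    = u y p * w s p / (s * y) * (\<Upsilon>1 p (\<lambda>_. a) * \<Upsilon>1 p (\<lambda>_. a') + \<Upsilon>2 p (\<lambda>_. a) * \<Upsilon>2 p (\<lambda>_. a'))"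
  by (simp add: kaehler_metric_def \<omega>_eq[OF assms] \<Upsilon>_wedge[OF assms(3)] \<Upsilon>_eq[OF assms(3)] algebra_simps del: One_nat_def)

lemma inner_frame:
  assumes n: "n \<in> points N"
  shows "frame n a \<bullet> frame n a' =
    sN n powi (-2) * sym_prod (\<eta> n) a a' + yN n powi (-2) * sym_prod (\<xi> n) a a'
    + yN n * sN n * (inverse (uN n) * sym_prod (pullback N P \<rho> \<alpha> n) a a' + uN n * sym_prod (d_fun N yN n) a a'
      + inverse (wN n) * sym_prod (pullback N P \<rho> \<kappa> n) a a' + wN n * sym_prod (d_fun N sN n) a a'
      + kaehler_metric (\<omega> (sN n) (yN n) (pN n)) (mdiff N X pN n a) (mdiff N X pN n a'))"
proof -
  note pos = positive_N[OF n]
  have p: "pr_curve \<pi> (\<rho> n) = pN n" by (simp add: pr_comp)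
  \<comment> \<open>The conformal factor sy cancels the denominator of \<omega>, leaving the scaling
    uw of the last two covectors.\<close>
  have "yN n * sN n * kaehler_metric (\<omega> (sN n) (yN n) (pN n)) (mdiff N X pN n a) (mdiff N X pN n a')
      = uN n * wN n * (coframe 6 n (\<lambda>_. a) * coframe 6 n (\<lambda>_. a') + coframe 7 n (\<lambda>_. a) * coframe 7 n (\<lambda>_. a'))"
    using pos(1,2) by (simp add: kaehler_metric_\<omega>[OF ranges_N(2)[OF n] ranges_N(3)[OF n] ranges_N(1)[OF n]] coframe_at(7,8)[OF n] p)
  then show ?thesis
    unfolding inner_spin_frame[OF pos] by (simp add: sym_prod_def coframe_simps[simplified] distrib_left)
qed

end

theorem theorem10p1:
  fixes X :: "('a, complex) mfd"
    and \<Upsilon>1 \<Upsilon>2 :: "('a, complex, real) form"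
    and Is Iy :: "real set"
    and u w :: "real \<Rightarrow> 'a \<Rightarrow> real"
    and \<omega> :: "real \<Rightarrow> real \<Rightarrow> ('a, complex, real) form"
    and P :: "('p, real^6) mfd" and \<pi> :: "'p \<Rightarrow> 'a \<times> real \<times> real"
    and actP :: "complex \<Rightarrow> complex \<Rightarrow> 'p \<Rightarrow> 'p"
    and N :: "('n, real^8) mfd" and \<rho> :: "'n \<Rightarrow> 'p"
    and actN :: "complex \<Rightarrow> complex \<Rightarrow> 'n \<Rightarrow> 'n"
    and \<alpha> \<kappa> :: "('p, real^6, real) form"
    and \<xi> \<eta> :: "('n, real^8, real) form"
  assumes "complex_curve X"
    and "holomorphic_10_form X (\<lambda>p v. of_real (\<Upsilon>1 p v) - \<i> * of_real (\<Upsilon>2 p v))"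
    and "open Is" "is_interval Is" "Is \<subseteq> {0<..}"
    and "open Iy" "is_interval Iy" "Iy \<subseteq> {0<..}"
    and "smooth_family 0 X Iy (\<lambda>y p v. u y p)" "\<forall>y\<in>Iy. \<forall>p\<in>points X. u y p > 0"
    and "smooth_family 0 X Is (\<lambda>s p v. w s p)" "\<forall>s\<in>Is. \<forall>p\<in>points X. w s p > 0"
    and "smooth_family 2 X (Is \<times> Iy) (\<lambda>(s, y). \<omega> s y)"
    and "\<forall>s\<in>Is. \<forall>y\<in>Iy. kaehler_form X (\<omega> s y)"
    and "\<forall>s\<in>Is. \<forall>y\<in>Iy. \<forall>p\<in>points X. \<forall>v.
           - (s * y) * \<omega> s y p v = (u y p * w s p) * (\<Upsilon>1 p \<and>\<^sub>1 \<Upsilon>2 p) v"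
    and "\<forall>s\<in>Is. \<forall>y\<in>Iy. \<forall>p\<in>points X. \<forall>v.
           partial_y (partial_y \<omega>) s y p v = ddc X (u y) p v"
    and "\<forall>s\<in>Is. \<forall>y\<in>Iy. \<forall>p\<in>points X. \<forall>v.
           partial_s (partial_s \<omega>) s y p v = ddc X (w s) p v"
    and "\<forall>s\<in>Is. \<forall>y\<in>Iy. \<forall>p\<in>points X. \<forall>v.
           partial_y (partial_s \<omega>) s y p v = 0"
    and "principal_torus_bundle (prod_mfd X (prod_mfd (eucl Is) (eucl Iy))) P \<pi> actP"
    and "connection_forms P actP \<alpha> \<kappa>"
    and "\<forall>q\<in>points P. \<forall>v.
           ext_d 1 P \<alpha> q v =
             - (lift_family P X \<pi> (\<lambda>s y. dc_fun X (u y)) q \<and>\<^sub>1 d_fun P (pr_y \<pi>) q) v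
             + lift_family P X \<pi> (partial_y \<omega>) q v"
    and "\<forall>q\<in>points P. \<forall>v.
           ext_d 1 P \<kappa> q v =
             (lift_family P X \<pi> (\<lambda>s y. dc_fun X (w s)) q \<and>\<^sub>1 d_fun P (pr_s \<pi>) q) v
             - lift_family P X \<pi> (partial_s \<omega>) q v"
    and "principal_torus_bundle P N \<rho> actN"
    and "connection_forms N actN \<xi> \<eta>"
    and "\<forall>n\<in>points N. \<forall>v.
           ext_d 1 N \<xi> n v =
             pullback N P \<rho> (\<lambda>q v.
               (pullback P X (pr_curve \<pi>) \<Upsilon>1 q \<and>\<^sub>1 \<kappa> q) v
               + (pullback P X (pr_curve \<pi>) \<Upsilon>2 q \<and>\<^sub>1
                    (\<lambda>v. w (pr_s \<pi> q) (pr_curve \<pi> q) * d_fun P (pr_s \<pi>) q v)) v) n v"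
    and "\<forall>n\<in>points N. \<forall>v.
           ext_d 1 N \<eta> n v =
             pullback N P \<rho> (\<lambda>q v.
               (\<alpha> q \<and>\<^sub>1 pullback P X (pr_curve \<pi>) \<Upsilon>2 q) v
               + u (pr_y \<pi> q) (pr_curve \<pi> q) *
                   (d_fun P (pr_y \<pi>) q \<and>\<^sub>1 pullback P X (pr_curve \<pi>) \<Upsilon>1 q) v) n v"
  shows "\<exists>\<Phi>. spin7_structure N \<Phi> \<and> torsion_free N \<Phi> \<and>
    induces_metric N \<Phi> (\<lambda>n a b.
      let p = pr_curve (\<pi> \<circ> \<rho>) n; s = pr_s (\<pi> \<circ> \<rho>) n; y = pr_y (\<pi> \<circ> \<rho>) n in
        s powi (-2) * sym_prod (\<eta> n) a b
        + y powi (-2) * sym_prod (\<xi> n) a b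
        + y * s *
          (inverse (u y p) * sym_prod (pullback N P \<rho> \<alpha> n) a b
           + u y p * sym_prod (d_fun N (pr_y (\<pi> \<circ> \<rho>)) n) a b
           + inverse (w s p) * sym_prod (pullback N P \<rho> \<kappa> n) a b
           + w s p * sym_prod (d_fun N (pr_s (\<pi> \<circ> \<rho>)) n) a b
           + kaehler_metric (\<omega> s y p)
               (mdiff N X (pr_curve (\<pi> \<circ> \<rho>)) n a) (mdiff N X (pr_curve (\<pi> \<circ> \<rho>)) n b)))"
proof -
  interpret nilbundle X \<Upsilon>1 \<Upsilon>2 Is Iy u w \<omega> P \<pi> actP N \<rho> actN \<alpha> \<kappa> \<xi> \<eta>
    by (rule nilbundle.intro) (fact assms)+
  \<comment> \<open>At each point one and the same frame witnesses both the algebraic type of the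
    form and its metric.\<close>
  have "spin7_structure N cayley" "induces_metric N cayley (\<lambda>n a b. frame n a \<bullet> frame n b)"
    using smooth_form_cayley spin7_frame_cayley by (auto simp: spin7_structure_def induces_metric_def)
  then show ?thesis
    using torsion_free_cayley inner_frame
    by (intro exI[of _ cayley] conjI) (auto simp: induces_metric_def Let_def)
qed

end
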